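(* Let $A\in\mathcal{V}$ and let $\theta$ be a congruence of $A$ with $\theta\subseteq Rad(A)$. Let $\Omega'$ be an orthogonal subset of $B(Con(A/\theta))$ which is lifted by $p_\theta$ to a subset $\Omega$ of $B(Con(A))$. Then $\Omega$ is the unique subset of $B(Con(A))$ to which $p_\theta$ lifts $\Omega'$, and $\Omega$ is orthogonal.
   Context: $\mathcal{V}$ is a congruence modular, semidegenerate variety (no nontrivial algebra has a one-element subalgebra) of finite signature, such that for every $B\in\mathcal{V}$ the set $K(B)$ of compact congruences is closed under the Freese–McKenzie commutator $[\cdot,\cdot]$. $Con(A)$ is the congruence lattice with bounds $\Delta_A,\nabla_A$; $Rad(A)$ is the intersection of all maximal congruences of $A$; $B(Con(A))$ is the Boolean algebra of complemented elements of $Con(A)$. $p_\theta:A\to A/\theta$ is the canonical surjection, and $p_\theta^{\bullet}(\alpha)=(\alpha\vee\theta)/\theta$ for $\alpha\in Con(A)$; it restricts to a Boolean morphism $B(Con(A))\to B(Con(A/\theta))$. $p_\theta$ lifts $\Omega'\subseteq Con(A/\theta)$ to $\Omega\subseteq Con(A)$ if $\Omega'=\{p_\theta^{\bullet}(\alpha):\alpha\in\Omega\}$. A subset of a Boolean algebra of congruences is orthogonal if any two distinct elements meet (equivalently, have commutator) equal to the least congruence. *)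

theory Defs
  imports Main
begin

text \<open>A signature is a set F of operation symbols with an arity map ar.
An algebra of the signature is a carrier A together with an interpretation
I f :: 'a list \<Rightarrow> 'a (applied to argument lists of length ar f).\<close>

datatype ('f,'v) trm = Var 'v | Fn 'f "('f,'v) trm list"

fun wf_trm :: "'f set \<Rightarrow> ('f \<Rightarrow> nat) \<Rightarrow> ('f,'v) trm \<Rightarrow> bool" where
  "wf_trm F ar (Var v) = True"
| "wf_trm F ar (Fn f ts) = (f \<in> F \<and> length ts = ar f \<and> (\<forall>t\<in>set ts. wf_trm F ar t))"

fun eval :: "('f \<Rightarrow> 'a list \<Rightarrow> 'a) \<Rightarrow> ('v \<Rightarrow> 'a) \<Rightarrow> ('f,'v) trm \<Rightarrow> 'a" where
  "eval I \<sigma> (Var v) = \<sigma> v"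
| "eval I \<sigma> (Fn f ts) = I f (map (eval I \<sigma>) ts)"

definition is_alg :: "'f set \<Rightarrow> ('f \<Rightarrow> nat) \<Rightarrow> 'a set \<Rightarrow> ('f \<Rightarrow> 'a list \<Rightarrow> 'a) \<Rightarrow> bool" where
  "is_alg F ar A I \<longleftrightarrow> A \<noteq> {} \<and>
     (\<forall>f\<in>F. \<forall>xs. length xs = ar f \<and> set xs \<subseteq> A \<longrightarrow> I f xs \<in> A)"

definition in_variety :: "'f set \<Rightarrow> ('f \<Rightarrow> nat) \<Rightarrow> (('f,nat) trm \<times> ('f,nat) trm) set
    \<Rightarrow> 'a set \<Rightarrow> ('f \<Rightarrow> 'a list \<Rightarrow> 'a) \<Rightarrow> bool" where
  "in_variety F ar \<Sigma> A I \<longleftrightarrow> is_alg F ar A I \<and>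
     (\<forall>(s,t)\<in>\<Sigma>. \<forall>\<sigma>. (\<forall>v. \<sigma> v \<in> A) \<longrightarrow> eval I \<sigma> s = eval I \<sigma> t)"

definition wf_identities :: "'f set \<Rightarrow> ('f \<Rightarrow> nat) \<Rightarrow> (('f,nat) trm \<times> ('f,nat) trm) set \<Rightarrow> bool" where
  "wf_identities F ar \<Sigma> \<longleftrightarrow> (\<forall>(s,t)\<in>\<Sigma>. wf_trm F ar s \<and> wf_trm F ar t)"

definition Con :: "'f set \<Rightarrow> ('f \<Rightarrow> nat) \<Rightarrow> 'a set \<Rightarrow> ('f \<Rightarrow> 'a list \<Rightarrow> 'a) \<Rightarrow> 'a rel set" where
  "Con F ar A I = {\<theta>. equiv A \<theta> \<and>
     (\<forall>f\<in>F. \<forall>xs ys. length xs = ar f \<and> length ys = ar f \<and> set xs \<subseteq> A \<and> set ys \<subseteq> A \<and>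
        (\<forall>i<ar f. (xs ! i, ys ! i) \<in> \<theta>) \<longrightarrow> (I f xs, I f ys) \<in> \<theta>)}"

definition Delta :: "'a set \<Rightarrow> 'a rel" where "Delta A = Id_on A"
definition Nabla :: "'a set \<Rightarrow> 'a rel" where "Nabla A = A \<times> A"

definition Cg :: "'f set \<Rightarrow> ('f \<Rightarrow> nat) \<Rightarrow> 'a set \<Rightarrow> ('f \<Rightarrow> 'a list \<Rightarrow> 'a) \<Rightarrow> 'a rel \<Rightarrow> 'a rel" where
  "Cg F ar A I R = \<Inter>{\<gamma> \<in> Con F ar A I. R \<subseteq> \<gamma>}"

definition cjoin :: "'f set \<Rightarrow> ('f \<Rightarrow> nat) \<Rightarrow> 'a set \<Rightarrow> ('f \<Rightarrow> 'a list \<Rightarrow> 'a) \<Rightarrow> 'a rel \<Rightarrow> 'a rel \<Rightarrow> 'a rel" where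
  "cjoin F ar A I \<alpha> \<beta> = Cg F ar A I (\<alpha> \<union> \<beta>)"

definition con_modular :: "'f set \<Rightarrow> ('f \<Rightarrow> nat) \<Rightarrow> 'a set \<Rightarrow> ('f \<Rightarrow> 'a list \<Rightarrow> 'a) \<Rightarrow> bool" where
  "con_modular F ar A I \<longleftrightarrow> (\<forall>\<alpha>\<in>Con F ar A I. \<forall>\<beta>\<in>Con F ar A I. \<forall>\<gamma>\<in>Con F ar A I.
     \<alpha> \<subseteq> \<gamma> \<longrightarrow> cjoin F ar A I \<alpha> (\<beta> \<inter> \<gamma>) = cjoin F ar A I \<alpha> \<beta> \<inter> \<gamma>)"

definition compact_con :: "'f set \<Rightarrow> ('f \<Rightarrow> nat) \<Rightarrow> 'a set \<Rightarrow> ('f \<Rightarrow> 'a list \<Rightarrow> 'a) \<Rightarrow> 'a rel set" where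
  "compact_con F ar A I = {\<alpha> \<in> Con F ar A I. \<forall>S \<subseteq> Con F ar A I.
     \<alpha> \<subseteq> Cg F ar A I (\<Union>S) \<longrightarrow> (\<exists>S'. finite S' \<and> S' \<subseteq> S \<and> \<alpha> \<subseteq> Cg F ar A I (\<Union>S'))}"

definition centralizes :: "'f set \<Rightarrow> ('f \<Rightarrow> nat) \<Rightarrow> 'a set \<Rightarrow> ('f \<Rightarrow> 'a list \<Rightarrow> 'a)
    \<Rightarrow> 'a rel \<Rightarrow> 'a rel \<Rightarrow> 'a rel \<Rightarrow> bool" where
  "centralizes F ar A I \<alpha> \<beta> \<gamma> \<longleftrightarrow>
     (\<forall>t :: ('f, nat + nat) trm. \<forall>a b c d :: nat \<Rightarrow> 'a. wf_trm F ar t \<longrightarrow>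
        (\<forall>i. (a i, b i) \<in> \<alpha>) \<longrightarrow> (\<forall>j. (c j, d j) \<in> \<beta>) \<longrightarrow>
        (eval I (case_sum a c) t, eval I (case_sum a d) t) \<in> \<gamma> \<longrightarrow>
        (eval I (case_sum b c) t, eval I (case_sum b d) t) \<in> \<gamma>)"

definition commutator :: "'f set \<Rightarrow> ('f \<Rightarrow> nat) \<Rightarrow> 'a set \<Rightarrow> ('f \<Rightarrow> 'a list \<Rightarrow> 'a)
    \<Rightarrow> 'a rel \<Rightarrow> 'a rel \<Rightarrow> 'a rel" where
  "commutator F ar A I \<alpha> \<beta> = \<Inter>{\<gamma> \<in> Con F ar A I. centralizes F ar A I \<alpha> \<beta> \<gamma>}"

definition max_con :: "'f set \<Rightarrow> ('f \<Rightarrow> nat) \<Rightarrow> 'a set \<Rightarrow> ('f \<Rightarrow> 'a list \<Rightarrow> 'a) \<Rightarrow> 'a rel set" where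
  "max_con F ar A I = {\<mu> \<in> Con F ar A I. \<mu> \<noteq> Nabla A \<and>
     (\<forall>\<gamma>\<in>Con F ar A I. \<mu> \<subseteq> \<gamma> \<longrightarrow> \<gamma> = \<mu> \<or> \<gamma> = Nabla A)}"

text \<open>Intersection of all maximal congruences (equal to Nabla A if there are none).\<close>
definition Rad :: "'f set \<Rightarrow> ('f \<Rightarrow> nat) \<Rightarrow> 'a set \<Rightarrow> ('f \<Rightarrow> 'a list \<Rightarrow> 'a) \<Rightarrow> 'a rel" where
  "Rad F ar A I = Nabla A \<inter> \<Inter>(max_con F ar A I)"

definition BCon :: "'f set \<Rightarrow> ('f \<Rightarrow> nat) \<Rightarrow> 'a set \<Rightarrow> ('f \<Rightarrow> 'a list \<Rightarrow> 'a) \<Rightarrow> 'a rel set" where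
  "BCon F ar A I = {\<alpha> \<in> Con F ar A I. \<exists>\<beta>\<in>Con F ar A I.
     \<alpha> \<inter> \<beta> = Delta A \<and> cjoin F ar A I \<alpha> \<beta> = Nabla A}"

definition orthogonal :: "'a set \<Rightarrow> 'a rel set \<Rightarrow> bool" where
  "orthogonal A S \<longleftrightarrow> (\<forall>\<alpha>\<in>S. \<forall>\<beta>\<in>S. \<alpha> \<noteq> \<beta> \<longrightarrow> \<alpha> \<inter> \<beta> = Delta A)"

definition quot_ops :: "'a rel \<Rightarrow> ('f \<Rightarrow> 'a list \<Rightarrow> 'a) \<Rightarrow> 'f \<Rightarrow> 'a set list \<Rightarrow> 'a set" where
  "quot_ops \<theta> I f Xs = \<theta> `` {I f (map (\<lambda>X. SOME x. x \<in> X) Xs)}"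

definition pbullet :: "'f set \<Rightarrow> ('f \<Rightarrow> nat) \<Rightarrow> 'a set \<Rightarrow> ('f \<Rightarrow> 'a list \<Rightarrow> 'a)
    \<Rightarrow> 'a rel \<Rightarrow> 'a rel \<Rightarrow> 'a set rel" where
  "pbullet F ar A I \<theta> \<alpha> =
     {(\<theta> `` {x}, \<theta> `` {y}) | x y. (x, y) \<in> cjoin F ar A I \<alpha> \<theta>}"

definition good_variety :: "'f set \<Rightarrow> ('f \<Rightarrow> nat) \<Rightarrow> (('f,nat) trm \<times> ('f,nat) trm) set
    \<Rightarrow> 'a itself \<Rightarrow> bool" where
  "good_variety F ar \<Sigma> _ \<longleftrightarrow> finite F \<and> wf_identities F ar \<Sigma> \<and>
     (\<forall>(B :: 'a set) J. in_variety F ar \<Sigma> B J \<longrightarrow>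
        con_modular F ar B J \<and>
        (\<forall>\<alpha>\<in>compact_con F ar B J. \<forall>\<beta>\<in>compact_con F ar B J.
           commutator F ar B J \<alpha> \<beta> \<in> compact_con F ar B J) \<and>
        ((\<exists>x\<in>B. \<exists>y\<in>B. x \<noteq> y) \<longrightarrow>
           \<not> (\<exists>e\<in>B. \<forall>f\<in>F. J f (replicate (ar f) e) = e)))"

end

theory Submission
  imports Defs "HOL-Library.FuncSet"
begin

text \<open>
  Everything reduces to two facts about \<open>Con(A)\<close>: a congruence \<open>\<delta>\<close> with \<open>\<delta> \<or> \<theta> = \<nabla>\<close> equals \<open>\<nabla>\<close>,
  because \<open>\<nabla>\<close> is finitely generated; and \<open>\<beta> \<or> \<gamma> = \<nabla>\<close> implies
  \<open>\<alpha> = (\<alpha> \<and> \<beta>) \<or> (\<alpha> \<and> \<gamma>)\<close>. By modularity, a failure of the latter yields, in a quotient of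
  \<open>A\<close>, a nontrivial \<open>\<alpha>\<close> with \<open>\<alpha> \<and> \<beta> = \<alpha> \<and> \<gamma> = \<Delta>\<close> and \<open>\<beta> \<or> \<gamma> = \<nabla>\<close>. Such an \<open>\<alpha>\<close> is
  central: \<open>C(\<nabla>, \<alpha>; \<Delta>)\<close> holds. A nontrivial central congruence produces a nontrivial algebra of
  the variety with an idempotent element, contradicting semidegeneracy.

  The hypothesis on the variety speaks only about algebras whose carrier lies in the type \<open>'a\<close>, so
  that algebra has to fit into \<open>'a\<close>. For infinite \<open>'a\<close> a quotient of \<open>\<alpha>\<close>, as a subalgebra of
  \<open>A \<times> A\<close>, will do. For finite \<open>'a\<close> an algebra with at most \<open>|A|\<close> elements is needed. It is a
  quotient of the algebra of unary polynomials of \<open>A\<close> in which the constants are collapsed: choose a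
  retraction \<open>e\<close> of the least rank \<open>c\<close> such that the identity is composed, modulo \<open>\<alpha>\<close>-local
  equivalence, of polynomials of rank at most \<open>c\<close>, and take the syntactic congruence of the set of
  polynomials \<open>s\<close> for which \<open>e \<circ> s\<close> permutes the range of \<open>e\<close>.
\<close>

section \<open>Congruences and images of subpowers\<close>

text \<open>Hybrid argument along \<open>take k qs @ drop k ps\<close>. It reduces compatibility
  with an operation to the change of one argument, which is what a context with a single hole
  expresses.\<close>

lemma list_replace_one_by_one:
  assumes step: "\<And>rs k p q. length rs = n \<Longrightarrow> set rs \<subseteq> P \<Longrightarrow> k < n \<Longrightarrow> p \<in> P \<Longrightarrow> q \<in> P \<Longrightarrow>
      E p q \<Longrightarrow> G (rs[k := p]) = G (rs[k := q])"
    and len: "length ps = n" "length qs = n" and P: "set ps \<subseteq> P" "set qs \<subseteq> P"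
    and E: "\<forall>i<n. E (ps ! i) (qs ! i)"
  shows "G ps = G qs"
proof -
  have "G ps = G (take k qs @ drop k ps)" if "k \<le> n" for k
    using that
  proof (induction k)
    case 0
    then show ?case by simp
  next
    case (Suc k)
    let ?rs = "take k qs @ drop k ps"
    have k: "k < n" using Suc by simp
    have rs: "length ?rs = n" "set ?rs \<subseteq> P"
      using len P k by (auto dest: in_set_takeD in_set_dropD)
    have in_P: "ps ! k \<in> P" "qs ! k \<in> P"
      using len P k by auto
    have 1: "?rs[k := ps ! k] = ?rs"
      using len k by (intro list_update_same_conv[THEN iffD2]) (auto simp: nth_append)
    have 2: "?rs[k := qs ! k] = take (Suc k) qs @ drop (Suc k) ps"
      using len k by (simp add: list_update_append Cons_nth_drop_Suc[symmetric] take_Suc_conv_app_nth)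
    show ?case
      using step[OF rs k in_P] E k Suc unfolding 1 2 by simp
  qed
  from this[of n] show ?thesis using len by simp
qed

section \<open>The congruence lattice of one algebra\<close>

lemma Con_equiv: "\<alpha> \<in> Con F ar A I \<Longrightarrow> equiv A \<alpha>"
  by (simp add: Con_def)

lemma Con_subset: "\<alpha> \<in> Con F ar A I \<Longrightarrow> \<alpha> \<subseteq> A \<times> A"
  by (simp add: Con_def equiv_type)

lemma Con_refl: "\<alpha> \<in> Con F ar A I \<Longrightarrow> x \<in> A \<Longrightarrow> (x, x) \<in> \<alpha>"
  by (simp add: Con_def equiv_def refl_on_def)

lemma Con_sym: "\<alpha> \<in> Con F ar A I \<Longrightarrow> (x, y) \<in> \<alpha> \<Longrightarrow> (y, x) \<in> \<alpha>"
  by (auto simp: Con_def equiv_def dest: symD)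

lemma Con_trans: "\<alpha> \<in> Con F ar A I \<Longrightarrow> (x, y) \<in> \<alpha> \<Longrightarrow> (y, z) \<in> \<alpha> \<Longrightarrow> (x, z) \<in> \<alpha>"
  by (auto simp: Con_def equiv_def dest: transD)

lemma Con_compat:
  "\<alpha> \<in> Con F ar A I \<Longrightarrow> f \<in> F \<Longrightarrow> length xs = ar f \<Longrightarrow> length ys = ar f \<Longrightarrow>
    (\<And>i. i < ar f \<Longrightarrow> (xs ! i, ys ! i) \<in> \<alpha>) \<Longrightarrow> (I f xs, I f ys) \<in> \<alpha>"
proof -
  assume a: "\<alpha> \<in> Con F ar A I" "f \<in> F" "length xs = ar f" "length ys = ar f"
    "\<And>i. i < ar f \<Longrightarrow> (xs ! i, ys ! i) \<in> \<alpha>"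
  have "set xs \<subseteq> A" "set ys \<subseteq> A"
    using a(3-5) Con_subset[OF a(1)] by (fastforce simp: in_set_conv_nth)+
  then show ?thesis using a unfolding Con_def by blast
qed

lemma ConI:
  assumes "\<alpha> \<subseteq> A \<times> A" "\<And>x. x \<in> A \<Longrightarrow> (x, x) \<in> \<alpha>"
    "\<And>x y. (x, y) \<in> \<alpha> \<Longrightarrow> (y, x) \<in> \<alpha>"
    "\<And>x y z. (x, y) \<in> \<alpha> \<Longrightarrow> (y, z) \<in> \<alpha> \<Longrightarrow> (x, z) \<in> \<alpha>"
    "\<And>f xs ys. f \<in> F \<Longrightarrow> length xs = ar f \<Longrightarrow> length ys = ar f \<Longrightarrow> set xs \<subseteq> A \<Longrightarrow> set ys \<subseteq> A \<Longrightarrow>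
      \<forall>i<ar f. (xs ! i, ys ! i) \<in> \<alpha> \<Longrightarrow> (I f xs, I f ys) \<in> \<alpha>"
  shows "\<alpha> \<in> Con F ar A I"
proof -
  have "equiv A \<alpha>"
  proof (rule equivI)
    show "\<alpha> \<subseteq> A \<times> A" "refl_on A \<alpha>"
      using assms(1,2) by (auto simp: refl_on_def)
    show "sym \<alpha>" using assms(3) by (rule symI)
    show "trans \<alpha>" using assms(4) by (rule transI)
  qed
  then show ?thesis using assms(5) unfolding Con_def by blast
qed

lemma Nabla_Con: "is_alg F ar A I \<Longrightarrow> Nabla A \<in> Con F ar A I"
  by (rule ConI) (auto simp: Nabla_def is_alg_def)

lemma Inter_Con:
  assumes "S \<subseteq> Con F ar A I" "S \<noteq> {}"
  shows "\<Inter>S \<in> Con F ar A I"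
proof (rule ConI)
  show "\<Inter>S \<subseteq> A \<times> A" using assms Con_subset by fastforce
  show "(x, x) \<in> \<Inter>S" if "x \<in> A" for x using assms that by (auto intro: Con_refl)
  show "(y, x) \<in> \<Inter>S" if "(x, y) \<in> \<Inter>S" for x y using assms that by (auto intro: Con_sym)
  show "(x, z) \<in> \<Inter>S" if "(x, y) \<in> \<Inter>S" "(y, z) \<in> \<Inter>S" for x y z
  proof
    fix \<gamma> assume "\<gamma> \<in> S"
    then show "(x, z) \<in> \<gamma>"
      using assms(1) that by (intro Con_trans[of \<gamma> F ar A I x y z]) auto
  qed
  show "(I f xs, I f ys) \<in> \<Inter>S"
    if "f \<in> F" "length xs = ar f" "length ys = ar f" "set xs \<subseteq> A" "set ys \<subseteq> A"
      "\<forall>i<ar f. (xs ! i, ys ! i) \<in> \<Inter>S" for f xs ys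
  proof
    fix \<gamma> assume "\<gamma> \<in> S"
    then show "(I f xs, I f ys) \<in> \<gamma>"
      using assms(1) that by (intro Con_compat[of \<gamma> F ar A I f xs ys]) auto
  qed
qed

lemma Int_Con: "\<alpha> \<in> Con F ar A I \<Longrightarrow> \<beta> \<in> Con F ar A I \<Longrightarrow> \<alpha> \<inter> \<beta> \<in> Con F ar A I"
  using Inter_Con[of "{\<alpha>, \<beta>}" F ar A I] by simp

lemma Cg_Con:
  assumes "is_alg F ar A I" "R \<subseteq> A \<times> A"
  shows "Cg F ar A I R \<in> Con F ar A I"
  unfolding Cg_def
proof (rule Inter_Con)
  show "{\<gamma> \<in> Con F ar A I. R \<subseteq> \<gamma>} \<noteq> {}"
    using Nabla_Con[OF assms(1)] assms(2) unfolding Nabla_def by blast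
qed blast

lemma Cg_ext: "R \<subseteq> Cg F ar A I R"
  by (auto simp: Cg_def)

lemma Cg_least: "\<gamma> \<in> Con F ar A I \<Longrightarrow> R \<subseteq> \<gamma> \<Longrightarrow> Cg F ar A I R \<subseteq> \<gamma>"
  by (auto simp: Cg_def)

lemma cjoin_Con:
  "is_alg F ar A I \<Longrightarrow> \<alpha> \<in> Con F ar A I \<Longrightarrow> \<beta> \<in> Con F ar A I \<Longrightarrow> cjoin F ar A I \<alpha> \<beta> \<in> Con F ar A I"
  unfolding cjoin_def using Con_subset[of \<alpha> F ar A I] Con_subset[of \<beta> F ar A I]
  by (intro Cg_Con) auto

lemma cjoin_ub1: "\<alpha> \<subseteq> cjoin F ar A I \<alpha> \<beta>"
  and cjoin_ub2: "\<beta> \<subseteq> cjoin F ar A I \<alpha> \<beta>"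
  using Cg_ext[of "\<alpha> \<union> \<beta>" F ar A I] by (auto simp: cjoin_def)

lemma cjoin_least:
  "\<gamma> \<in> Con F ar A I \<Longrightarrow> \<alpha> \<subseteq> \<gamma> \<Longrightarrow> \<beta> \<subseteq> \<gamma> \<Longrightarrow> cjoin F ar A I \<alpha> \<beta> \<subseteq> \<gamma>"
  unfolding cjoin_def by (rule Cg_least) auto

lemma Con_eq_NablaI: "\<gamma> \<in> Con F ar A I \<Longrightarrow> Nabla A \<subseteq> \<gamma> \<Longrightarrow> \<gamma> = Nabla A"
  using Con_subset[of \<gamma> F ar A I] by (auto simp: Nabla_def)

lemma Con_Delta_least: "\<gamma> \<in> Con F ar A I \<Longrightarrow> Delta A \<subseteq> \<gamma>"
  using Con_refl[of \<gamma> F ar A I] by (auto simp: Delta_def)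

text \<open>Homomorphic images of subalgebras of powers of \<open>A\<close>, realised on a subset of the carrier
  type: the elements of \<open>P\<close> are only relevant on the index set \<open>X\<close>.\<close>

locale subpower_image =
  fixes F :: "'f set" and ar :: "'f \<Rightarrow> nat" and \<Sigma> :: "(('f,nat) trm \<times> ('f,nat) trm) set"
    and A :: "'a set" and I :: "'f \<Rightarrow> 'a list \<Rightarrow> 'a"
    and X :: "'b set" and P :: "('b \<Rightarrow> 'a) set" and \<Phi> :: "('b \<Rightarrow> 'a) \<Rightarrow> 'a"
  assumes wf: "wf_identities F ar \<Sigma>" and V: "in_variety F ar \<Sigma> A I"
    and ne: "P \<noteq> {}" and val: "\<And>p x. p \<in> P \<Longrightarrow> x \<in> X \<Longrightarrow> p x \<in> A"
    and closed: "\<And>f ps. f \<in> F \<Longrightarrow> length ps = ar f \<Longrightarrow> set ps \<subseteq> P \<Longrightarrow>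
        (\<lambda>x. I f (map (\<lambda>p. p x) ps)) \<in> P"
    and agree: "\<And>p q. p \<in> P \<Longrightarrow> q \<in> P \<Longrightarrow> (\<And>x. x \<in> X \<Longrightarrow> p x = q x) \<Longrightarrow> \<Phi> p = \<Phi> q"
    and compat: "\<And>f rs k p q. f \<in> F \<Longrightarrow> length rs = ar f \<Longrightarrow> set rs \<subseteq> P \<Longrightarrow> k < ar f \<Longrightarrow>
        p \<in> P \<Longrightarrow> q \<in> P \<Longrightarrow> \<Phi> p = \<Phi> q \<Longrightarrow>
        \<Phi> (\<lambda>x. I f (map (\<lambda>r. r x) (rs[k := p]))) = \<Phi> (\<lambda>x. I f (map (\<lambda>r. r x) (rs[k := q])))"
begin

definition rep :: "'a \<Rightarrow> 'b \<Rightarrow> 'a" where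
  "rep y = (SOME p. p \<in> P \<and> \<Phi> p = y)"

definition img_ops :: "'f \<Rightarrow> 'a list \<Rightarrow> 'a" where
  "img_ops f ys = \<Phi> (\<lambda>x. I f (map (\<lambda>y. rep y x) ys))"

lemma rep: "y \<in> \<Phi> ` P \<Longrightarrow> rep y \<in> P \<and> \<Phi> (rep y) = y"
  using someI_ex[of "\<lambda>p. p \<in> P \<and> \<Phi> p = y"] unfolding rep_def by blast

lemma img_ops:
  assumes "f \<in> F" "length ps = ar f" "set ps \<subseteq> P"
  shows "img_ops f (map \<Phi> ps) = \<Phi> (\<lambda>x. I f (map (\<lambda>p. p x) ps))"
proof -
  have "img_ops f (map \<Phi> ps) = \<Phi> (\<lambda>x. I f (map (\<lambda>p. p x) (map (\<lambda>p. rep (\<Phi> p)) ps)))"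
    by (simp add: img_ops_def comp_def)
  also have "\<dots> = \<Phi> (\<lambda>x. I f (map (\<lambda>p. p x) ps))"
  proof (rule list_replace_one_by_one[where n = "ar f" and P = P and E = "\<lambda>p q. \<Phi> p = \<Phi> q"
        and G = "\<lambda>ps. \<Phi> (\<lambda>x. I f (map (\<lambda>p. p x) ps))"])
    show "set (map (\<lambda>p. rep (\<Phi> p)) ps) \<subseteq> P"
      using assms rep by auto
    show "\<forall>i<ar f. \<Phi> (map (\<lambda>p. rep (\<Phi> p)) ps ! i) = \<Phi> (ps ! i)"
      using assms(2,3) by (metis imageI nth_map nth_mem rep subsetD)
    show "\<Phi> (\<lambda>x. I f (map (\<lambda>p. p x) (rs[k := p]))) = \<Phi> (\<lambda>x. I f (map (\<lambda>p. p x) (rs[k := q])))"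
      if "length rs = ar f" "set rs \<subseteq> P" "k < ar f" "p \<in> P" "q \<in> P" "\<Phi> p = \<Phi> q" for rs k p q
      using assms(1) that by (rule compat)
  qed (use assms in simp_all)
  finally show ?thesis .
qed

lemma in_variety_image: "in_variety F ar \<Sigma> (\<Phi> ` P) img_ops"
proof -
  have lift: "\<exists>ps. xs = map \<Phi> ps \<and> set ps \<subseteq> P" if "set xs \<subseteq> \<Phi> ` P" for xs
  proof (intro exI conjI)
    show "xs = map \<Phi> (map rep xs)" using that rep by (simp add: subset_iff map_idI)
    show "set (map rep xs) \<subseteq> P" using that rep by auto
  qed
  have alg: "is_alg F ar (\<Phi> ` P) img_ops"
    unfolding is_alg_def
  proof (intro conjI ballI allI impI)
    show "\<Phi> ` P \<noteq> {}" using ne by simp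
    fix f xs
    assume f: "f \<in> F" and xs: "length xs = ar f \<and> set xs \<subseteq> \<Phi> ` P"
    then obtain ps where ps: "xs = map \<Phi> ps" "set ps \<subseteq> P" using lift by blast
    then show "img_ops f xs \<in> \<Phi> ` P"
      using f xs closed[of f ps] img_ops[of f ps] by auto
  qed
  \<comment> \<open>\<open>\<Phi>\<close> acts as a homomorphism on terms: evaluation in the image
    is \<open>\<Phi>\<close> of the pointwise evaluation in the power of \<open>A\<close>. This is
    how identities of \<open>A\<close> are inherited.\<close>
  have ev: "(\<lambda>x. eval I (\<lambda>v. \<tau> v x) t) \<in> P \<and>
      eval img_ops (\<lambda>v. \<Phi> (\<tau> v)) t = \<Phi> (\<lambda>x. eval I (\<lambda>v. \<tau> v x) t)"
    if "wf_trm F ar t" "\<And>v. \<tau> v \<in> P" for t and \<tau> :: "nat \<Rightarrow> 'b \<Rightarrow> 'a"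
    using that
  proof (induction t)
    case (Var v)
    then show ?case by simp
  next
    case (Fn f ts)
    let ?ps = "map (\<lambda>t x. eval I (\<lambda>v. \<tau> v x) t) ts"
    have ps: "f \<in> F" "length ?ps = ar f" "set ?ps \<subseteq> P"
      using Fn by auto
    have *: "map (eval img_ops (\<lambda>v. \<Phi> (\<tau> v))) ts = map \<Phi> ?ps"
      using Fn by auto
    have "(\<lambda>x. eval I (\<lambda>v. \<tau> v x) (Fn f ts)) = (\<lambda>x. I f (map (\<lambda>p. p x) ?ps))"
      by (simp add: comp_def)
    then show ?case
      using closed[OF ps] img_ops[OF ps] unfolding *[symmetric] by simp
  qed
  have "eval img_ops \<sigma> s = eval img_ops \<sigma> t"
    if st: "(s, t) \<in> \<Sigma>" and \<sigma>: "\<forall>v. \<sigma> v \<in> \<Phi> ` P" for s t \<sigma>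
  proof -
    define \<tau> where "\<tau> v = rep (\<sigma> v)" for v
    have \<tau>: "\<And>v. \<tau> v \<in> P" and \<sigma>_eq: "\<sigma> = (\<lambda>v. \<Phi> (\<tau> v))"
      using \<sigma> rep by (auto simp: \<tau>_def)
    have wfs: "wf_trm F ar s" "wf_trm F ar t"
      using wf st by (auto simp: wf_identities_def)
    have "eval I (\<lambda>v. \<tau> v x) s = eval I (\<lambda>v. \<tau> v x) t" if "x \<in> X" for x
    proof -
      have "\<forall>\<sigma>. (\<forall>v. \<sigma> v \<in> A) \<longrightarrow> eval I \<sigma> s = eval I \<sigma> t"
        using V st unfolding in_variety_def by blast
      then show ?thesis using val[OF \<tau> that] by simp
    qed
    then have "\<Phi> (\<lambda>x. eval I (\<lambda>v. \<tau> v x) s) = \<Phi> (\<lambda>x. eval I (\<lambda>v. \<tau> v x) t)"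
      using ev[OF wfs(1) \<tau>] ev[OF wfs(2) \<tau>] by (intro agree) auto
    then show ?thesis
      using ev[OF wfs(1) \<tau>] ev[OF wfs(2) \<tau>] by (simp add: \<sigma>_eq)
  qed
  then show ?thesis
    using alg unfolding in_variety_def by blast
qed

text \<open>The form in which semidegeneracy is used throughout: the condition on \<open>e\<close>
  makes \<open>\<Phi> e\<close> a one-element subalgebra of the image, so the image has no second
  element.\<close>

lemma trivial_if_pointed:
  assumes good: "good_variety F ar \<Sigma> TYPE('a)" and e: "e \<in> P"
    and idem: "\<And>f. f \<in> F \<Longrightarrow> \<Phi> (\<lambda>x. I f (replicate (ar f) (e x))) = \<Phi> e"
    and p: "p \<in> P"
  shows "\<Phi> p = \<Phi> e"
proof (rule ccontr)
  assume "\<Phi> p \<noteq> \<Phi> e"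
  then have nontrivial: "\<exists>x\<in>\<Phi> ` P. \<exists>y\<in>\<Phi> ` P. x \<noteq> y" using e p by blast
  have fixpoint: "img_ops f (replicate (ar f) (\<Phi> e)) = \<Phi> e" if f: "f \<in> F" for f
  proof -
    have "set (replicate (ar f) e) \<subseteq> P" using e by auto
    from img_ops[OF f _ this] show ?thesis using idem[OF f] by (simp add: map_replicate)
  qed
  have "\<not> (\<exists>e\<in>\<Phi> ` P. \<forall>f\<in>F. img_ops f (replicate (ar f) e) = e)"
    using good in_variety_image nontrivial unfolding good_variety_def by metis
  then show False using e fixpoint by blast
qed

end

section \<open>Polynomials and central congruences\<close>

locale algebra =
  fixes F :: "'f set" and ar :: "'f \<Rightarrow> nat" and A :: "'a set" and I :: "'f \<Rightarrow> 'a list \<Rightarrow> 'a"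
  assumes alg: "is_alg F ar A I"
begin

text \<open>Polynomials are functions of an infinite sequence of variables, so that
  \<open>case_nat\<close> can single out variable 0 and shift the others.\<close>

inductive_set pol :: "((nat \<Rightarrow> 'a) \<Rightarrow> 'a) set" where
  proj: "(\<lambda>\<sigma>. \<sigma> i) \<in> pol"
| const: "a \<in> A \<Longrightarrow> (\<lambda>\<sigma>. a) \<in> pol"
| op: "f \<in> F \<Longrightarrow> length gs = ar f \<Longrightarrow> \<forall>g\<in>set gs. g \<in> pol \<Longrightarrow> (\<lambda>\<sigma>. I f (map (\<lambda>g. g \<sigma>) gs)) \<in> pol"

lemma pol_subst: "f \<in> pol \<Longrightarrow> (\<And>i. g i \<in> pol) \<Longrightarrow> (\<lambda>\<sigma>. f (\<lambda>i. g i \<sigma>)) \<in> pol"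
proof (induction rule: pol.induct)
  case (op f hs)
  have "(\<lambda>\<sigma>. I f (map (\<lambda>h. h \<sigma>) (map (\<lambda>h \<sigma>. h (\<lambda>i. g i \<sigma>)) hs))) \<in> pol"
    by (rule pol.op) (use op in auto)
  then show ?case by (simp add: comp_def)
qed (auto intro: pol.intros)

lemma pol_case_nat:
  assumes "f \<in> pol" "u \<in> pol" "\<And>i. v i \<in> pol"
  shows "(\<lambda>\<sigma>. f (case_nat (u \<sigma>) (\<lambda>i. v i \<sigma>))) \<in> pol"
proof -
  have "(\<lambda>i. case_nat u v i \<sigma>) = case_nat (u \<sigma>) (\<lambda>i. v i \<sigma>)" for \<sigma>
    by (auto split: nat.split)
  moreover have "(\<lambda>\<sigma>. f (\<lambda>i. case_nat u v i \<sigma>)) \<in> pol"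
    by (rule pol_subst) (use assms in \<open>auto split: nat.split\<close>)
  ultimately show ?thesis by simp
qed

lemma op_closed: "f \<in> F \<Longrightarrow> length xs = ar f \<Longrightarrow> set xs \<subseteq> A \<Longrightarrow> I f xs \<in> A"
  using alg unfolding is_alg_def by blast

lemma pol_val: "f \<in> pol \<Longrightarrow> (\<And>i. \<sigma> i \<in> A) \<Longrightarrow> f \<sigma> \<in> A"
proof (induction rule: pol.induct)
  case (op f gs)
  then show ?case by (intro op_closed) auto
qed auto

lemma pol_Con:
  "f \<in> pol \<Longrightarrow> \<alpha> \<in> Con F ar A I \<Longrightarrow> (\<And>i. (\<sigma> i, \<tau> i) \<in> \<alpha>) \<Longrightarrow> (f \<sigma>, f \<tau>) \<in> \<alpha>"
proof (induction rule: pol.induct)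
  case (op f gs)
  show ?case
    by (rule Con_compat[of \<alpha> F ar A I]) (use op in auto)
qed (auto intro: Con_refl)

text \<open>The term condition \<open>C(\<nabla>, \<alpha>; \<Delta>)\<close>, for one parameter at a time.\<close>

definition central :: "'a rel \<Rightarrow> bool" where
  "central \<alpha> \<longleftrightarrow> (\<forall>f\<in>pol. \<forall>x\<in>A. \<forall>y\<in>A. \<forall>\<sigma> \<tau>. (\<forall>i. (\<sigma> i, \<tau> i) \<in> \<alpha>) \<longrightarrow>
     f (case_nat x \<sigma>) = f (case_nat x \<tau>) \<longrightarrow> f (case_nat y \<sigma>) = f (case_nat y \<tau>))"

lemma centralD:
  "central \<alpha> \<Longrightarrow> f \<in> pol \<Longrightarrow> x \<in> A \<Longrightarrow> y \<in> A \<Longrightarrow> (\<And>i. (\<sigma> i, \<tau> i) \<in> \<alpha>) \<Longrightarrow>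
     f (case_nat x \<sigma>) = f (case_nat x \<tau>) \<Longrightarrow> f (case_nat y \<sigma>) = f (case_nat y \<tau>)"
  unfolding central_def by blast

text \<open>The pairs of parameters that are interchangeable in the term condition form a congruence,
  and it contains every congruence that meets \<open>\<alpha>\<close> trivially.\<close>

lemma central_if_two_complements:
  assumes \<alpha>: "\<alpha> \<in> Con F ar A I" and \<beta>: "\<beta> \<in> Con F ar A I" and \<gamma>: "\<gamma> \<in> Con F ar A I"
    and meet: "\<alpha> \<inter> \<beta> = Delta A" "\<alpha> \<inter> \<gamma> = Delta A"
    and join: "cjoin F ar A I \<beta> \<gamma> = Nabla A"
  shows "central \<alpha>"
proof -
  \<comment> \<open>\<open>S x\<close> collects the instances of the term condition whose premise
    holds at \<open>x\<close>. Centrality means that \<open>S\<close> is constant on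
    \<open>A\<close>, and \<rho> is the kernel of \<open>S\<close>.\<close>
  define S where "S x = {(f, \<sigma>, \<tau>). f \<in> pol \<and> (\<forall>i. (\<sigma> i, \<tau> i) \<in> \<alpha>) \<and>
    f (case_nat x \<sigma>) = f (case_nat x \<tau>)}" for x
  define \<rho> where "\<rho> = {(x, y) \<in> A \<times> A. S x = S y}"
  have le: "\<delta> \<subseteq> \<rho>" if \<delta>: "\<delta> \<in> Con F ar A I" "\<alpha> \<inter> \<delta> = Delta A" for \<delta>
  proof -
    have sub: "S x \<subseteq> S y" if xy: "(x, y) \<in> \<delta>" for x y
    proof (clarsimp simp: S_def)
      fix f \<sigma> \<tau>
      assume f: "f \<in> pol" "\<forall>i. (\<sigma> i, \<tau> i) \<in> \<alpha>" and eq: "f (case_nat x \<sigma>) = f (case_nat x \<tau>)"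
      have A: "y \<in> A" "\<And>i. \<sigma> i \<in> A" "\<And>i. \<tau> i \<in> A"
        using xy f(2) Con_subset[OF \<delta>(1)] Con_subset[OF \<alpha>] by auto
      have yx: "(y, x) \<in> \<delta>" using Con_sym[OF \<delta>(1) xy] .
      \<comment> \<open>The two values at \<open>y\<close> are linked by \<delta> through the equal
        values at \<open>x\<close>, and by \<alpha> directly. Since \<alpha> and \<delta> meet
        trivially, they are equal.\<close>
      have "(f (case_nat y \<sigma>), f (case_nat x \<sigma>)) \<in> \<delta>"
        by (rule pol_Con[OF f(1) \<delta>(1)]) (use yx A Con_refl[OF \<delta>(1)] in \<open>auto split: nat.split\<close>)
      moreover have "(f (case_nat x \<tau>), f (case_nat y \<tau>)) \<in> \<delta>"
        by (rule pol_Con[OF f(1) \<delta>(1)]) (use xy A Con_refl[OF \<delta>(1)] in \<open>auto split: nat.split\<close>)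
      ultimately have "(f (case_nat y \<sigma>), f (case_nat y \<tau>)) \<in> \<delta>"
        using eq Con_trans[OF \<delta>(1)] by metis
      moreover have "(f (case_nat y \<sigma>), f (case_nat y \<tau>)) \<in> \<alpha>"
        by (rule pol_Con[OF f(1) \<alpha>]) (use A f(2) Con_refl[OF \<alpha>] in \<open>auto split: nat.split\<close>)
      ultimately have "(f (case_nat y \<sigma>), f (case_nat y \<tau>)) \<in> Id_on A"
        using \<delta>(2) unfolding Delta_def[symmetric] by auto
      then show "f (case_nat y \<sigma>) = f (case_nat y \<tau>)" by (rule Id_onE) simp
    qed
    then show ?thesis
      using Con_sym[OF \<delta>(1)] Con_subset[OF \<delta>(1)] unfolding \<rho>_def by blast
  qed
  have "\<rho> \<in> Con F ar A I"
  proof (rule ConI)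
    fix f0 xs ys
    assume f0: "f0 \<in> F" and len: "length xs = ar f0" "length ys = ar f0" and A: "set xs \<subseteq> A" "set ys \<subseteq> A"
      and \<rho>: "\<forall>i<ar f0. (xs ! i, ys ! i) \<in> \<rho>"
    have "S (I f0 xs) = S (I f0 ys)"
    proof (rule list_replace_one_by_one[where n = "ar f0" and P = A and E = "\<lambda>x y. S x = S y"
          and G = "\<lambda>xs. S (I f0 xs)"])
      fix rs k p q
      assume rs: "length rs = ar f0" "set rs \<subseteq> A" and k: "k < ar f0" and pq: "S p = S q"
      \<comment> \<open>\<open>h f\<close> absorbs the operation into the polynomial, with variable
        0 as the hole at place \<open>k\<close>; thus \<open>S (I f0 (rs[k := x]))\<close> is
        determined by \<open>S x\<close>.\<close>
      define h where "h f = (\<lambda>\<sigma>. f (case_nat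
        (I f0 (map (\<lambda>g. g \<sigma>) ((map (\<lambda>r (\<sigma> :: nat \<Rightarrow> 'a). r) rs)[k := \<lambda>\<sigma>. \<sigma> 0]))) (\<lambda>i. \<sigma> (Suc i))))"
        for f :: "(nat \<Rightarrow> 'a) \<Rightarrow> 'a"
      have h: "h f (case_nat x \<sigma>) = f (case_nat (I f0 (rs[k := x])) \<sigma>)" for f x \<sigma>
        by (simp add: h_def map_update comp_def)
      have "h f \<in> pol" if "f \<in> pol" for f
        unfolding h_def
      proof (rule pol_case_nat[OF that pol.op[OF f0]])
        show "\<forall>g\<in>set ((map (\<lambda>r (\<sigma> :: nat \<Rightarrow> 'a). r) rs)[k := \<lambda>\<sigma>. \<sigma> 0]). g \<in> pol"
          using rs(2) set_update_subset_insert[of "map (\<lambda>r (\<sigma> :: nat \<Rightarrow> 'a). r) rs" k "\<lambda>\<sigma>. \<sigma> 0"]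
          by (auto intro: pol.intros)
      qed (use rs in \<open>auto intro: pol.intros\<close>)
      then have "(f, \<sigma>, \<tau>) \<in> S (I f0 (rs[k := x])) \<longleftrightarrow>
          f \<in> pol \<and> (h f, \<sigma>, \<tau>) \<in> S x" for f x \<sigma> \<tau>
        by (auto simp: S_def h)
      then show "S (I f0 (rs[k := p])) = S (I f0 (rs[k := q]))"
        using pq by auto
    qed (use len A \<rho> in \<open>auto simp: \<rho>_def\<close>)
    then show "(I f0 xs, I f0 ys) \<in> \<rho>"
      using op_closed[OF f0] len A by (simp add: \<rho>_def)
  qed (auto simp: \<rho>_def)
  then have "Nabla A \<subseteq> \<rho>"
    using cjoin_least[of \<rho> F ar A I \<beta> \<gamma>] le[OF \<beta> meet(1)] le[OF \<gamma> meet(2)] join by simp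
  then have "S x = S y" if "x \<in> A" "y \<in> A" for x y
    using that by (auto simp: \<rho>_def Nabla_def)
  then show ?thesis
    unfolding central_def S_def by blast
qed

end

lemma ex_inj_pair_if_infinite:
  assumes "infinite (UNIV :: 'a set)"
  shows "\<exists>j :: 'a \<times> 'a \<Rightarrow> 'a. inj j"
proof -
  obtain j :: "'a \<times> 'a \<Rightarrow> 'a" where "bij_betw j (UNIV \<times> UNIV) UNIV"
    using card_of_Times_same_infinite[OF assms] card_of_ordIso by blast
  then show ?thesis by (auto simp: bij_betw_def)
qed

text \<open>For infinite types, \<open>\<alpha>\<close> as a subalgebra of \<open>A \<times> A\<close>, divided by the syntactic congruence of
  the diagonal, is an algebra of the variety in which the diagonal is an idempotent element.\<close>

lemma (in algebra) central_trivial_infinite: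
  assumes inf: "infinite (UNIV :: 'a set)"
    and good: "good_variety F ar \<Sigma> TYPE('a)" and V: "in_variety F ar \<Sigma> A I"
    and \<alpha>: "\<alpha> \<in> Con F ar A I" and central: "central \<alpha>" and uv: "(u, v) \<in> \<alpha>"
  shows "u = v"
proof -
  define P :: "(bool \<Rightarrow> 'a) set" where "P = {p. (p True, p False) \<in> \<alpha>}"
  \<comment> \<open>The contexts that give both components of a pair the same value; the kernel of
    \<open>C\<close> is the syntactic congruence of the diagonal.\<close>
  define C where "C p = {(f, \<sigma>, \<tau>). f \<in> pol \<and> (\<forall>i. (\<sigma> i, \<tau> i) \<in> \<alpha>) \<and>
    f (case_nat (p True) \<sigma>) = f (case_nat (p False) \<tau>)}" for p :: "bool \<Rightarrow> 'a"
  obtain j :: "'a \<times> 'a \<Rightarrow> 'a" where j: "inj j"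
    using ex_inj_pair_if_infinite[OF inf] by blast
  \<comment> \<open>A class is named by the code of a chosen representative pair; \<open>j\<close>
    brings pairs back into the type \<open>'a\<close>.\<close>
  define \<Phi> where "\<Phi> p = (let q = inv_into P C (C p) in j (q True, q False))" for p
  have \<Phi>: "\<Phi> p = \<Phi> q \<longleftrightarrow> C p = C q" if "p \<in> P" "q \<in> P" for p q
  proof
    assume "\<Phi> p = \<Phi> q"
    then have "inv_into P C (C p) True = inv_into P C (C q) True"
      "inv_into P C (C p) False = inv_into P C (C q) False"
      using j by (auto simp: \<Phi>_def Let_def dest: injD)
    then have "inv_into P C (C p) = inv_into P C (C q)"
      by (intro ext) (metis (full_types))
    then show "C p = C q"
      by (metis f_inv_into_f imageI that)
  qed (simp add: \<Phi>_def)
  \<comment> \<open>By centrality all diagonal pairs have the same contexts. Their common class will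
    be the idempotent element.\<close>
  have C_const: "C (\<lambda>_. x) = C (\<lambda>_. y)" if "x \<in> A" "y \<in> A" for x y
    using centralD[OF central] that unfolding C_def by blast
  interpret subpower_image F ar \<Sigma> A I UNIV P \<Phi>
  proof
    show "wf_identities F ar \<Sigma>" using good by (simp add: good_variety_def)
    show "in_variety F ar \<Sigma> A I" by (rule V)
    show "P \<noteq> {}" using uv by (auto simp: P_def intro: exI[of _ "\<lambda>b. if b then u else v"])
    show "p x \<in> A" if "p \<in> P" for p x
      using that Con_subset[OF \<alpha>] by (cases x) (auto simp: P_def)
    show "(\<lambda>x. I f (map (\<lambda>p. p x) ps)) \<in> P" if "f \<in> F" "length ps = ar f" "set ps \<subseteq> P" for f ps
      unfolding P_def mem_Collect_eq using that nth_mem[of _ ps]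
      by (intro Con_compat[OF \<alpha> that(1)]) (auto simp: P_def subset_iff)
    show "\<Phi> p = \<Phi> q" if "\<And>x. x \<in> UNIV \<Longrightarrow> p x = q x" for p q
    proof -
      have "p = q" using that by auto
      then show ?thesis by simp
    qed
    fix f and rs :: "(bool \<Rightarrow> 'a) list" and k p q
    assume f: "f \<in> F" and rs: "length rs = ar f" "set rs \<subseteq> P" and k: "k < ar f"
      and p: "p \<in> P" and q: "q \<in> P" and pq: "\<Phi> p = \<Phi> q"
    \<comment> \<open>Variable 0 is the hole at place \<open>k\<close>, the next \<open>ar f\<close>
      variables carry the arguments \<open>rs\<close>, and the old variables of \<open>g\<close> are
      shifted behind them. Variables are needed here because the two components of the arguments may
      differ.\<close>
    define hs where "hs = (map (\<lambda>i (\<tau> :: nat \<Rightarrow> 'a). \<tau> (Suc i)) [0..<ar f])[k := \<lambda>\<tau>. \<tau> 0]"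
    define h where "h g = (\<lambda>\<tau>. g (case_nat (I f (map (\<lambda>g. g \<tau>) hs)) (\<lambda>i. \<tau> (Suc (ar f + i)))))"
      for g :: "(nat \<Rightarrow> 'a) \<Rightarrow> 'a"
    define ext where "ext b \<sigma> = (\<lambda>i. if i < ar f then (rs ! i) b else \<sigma> (i - ar f))"
      for b and \<sigma> :: "nat \<Rightarrow> 'a"
    have hs_eval: "map (\<lambda>g. g (case_nat (r b) (ext b \<sigma>))) hs = map (\<lambda>r. r b) (rs[k := r])" for r b \<sigma>
      by (rule nth_equalityI) (use rs k in \<open>auto simp: hs_def ext_def nth_list_update\<close>)
    have h: "h g (case_nat (r b) (ext b \<sigma>)) = g (case_nat (I f (map (\<lambda>r. r b) (rs[k := r]))) \<sigma>)"
      for g r b \<sigma>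
      unfolding h_def hs_eval by (simp add: ext_def)
    have h_pol: "h g \<in> pol" if "g \<in> pol" for g
      unfolding h_def
    proof (rule pol_case_nat[OF that pol.op[OF f]])
      show "\<forall>g\<in>set hs. g \<in> pol"
        unfolding hs_def using set_update_subset_insert[of "map (\<lambda>i (\<tau> :: nat \<Rightarrow> 'a). \<tau> (Suc i)) [0..<ar f]" k "\<lambda>\<tau>. \<tau> 0"]
        by (auto intro: pol.intros)
    qed (auto simp: hs_def intro: pol.intros)
    have ext_\<alpha>: "(ext True \<sigma> i, ext False \<tau> i) \<in> \<alpha>" if "\<forall>i. (\<sigma> i, \<tau> i) \<in> \<alpha>" for \<sigma> \<tau> i
      using that rs nth_mem[of i rs] by (auto simp: ext_def P_def subset_iff)
    have mem: "(g, \<sigma>, \<tau>) \<in> C (\<lambda>x. I f (map (\<lambda>r. r x) (rs[k := r]))) \<longleftrightarrow>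
        g \<in> pol \<and> (\<forall>i. (\<sigma> i, \<tau> i) \<in> \<alpha>) \<and> (h g, ext True \<sigma>, ext False \<tau>) \<in> C r" for g \<sigma> \<tau> r
      using h_pol ext_\<alpha> by (auto simp: C_def h)
    have "C (\<lambda>x. I f (map (\<lambda>r. r x) (rs[k := p]))) = C (\<lambda>x. I f (map (\<lambda>r. r x) (rs[k := q])))"
      using \<Phi>[OF p q] pq by (auto simp: mem)
    then show "\<Phi> (\<lambda>x. I f (map (\<lambda>r. r x) (rs[k := p]))) = \<Phi> (\<lambda>x. I f (map (\<lambda>r. r x) (rs[k := q])))"
      by (simp add: \<Phi>_def)
  qed
  have uA: "u \<in> A" using uv Con_subset[OF \<alpha>] by auto
  define p where "p b = (if b then u else v)" for b
  have "\<Phi> p = \<Phi> (\<lambda>_. u)"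
  proof (rule trivial_if_pointed[OF good, where e = "\<lambda>_. u"])
    show "(\<lambda>_. u) \<in> P" "p \<in> P" using uv uA Con_refl[OF \<alpha>] by (auto simp: P_def p_def)
    show "\<Phi> (\<lambda>x. I f (replicate (ar f) u)) = \<Phi> (\<lambda>_. u)" if "f \<in> F" for f
      unfolding \<Phi>_def using C_const[OF op_closed[OF that] uA, of "replicate (ar f) u"] uA
      by (auto simp: set_replicate_conv_if)
  qed
  then have "C p = C (\<lambda>_. u)"
    using \<Phi>[of p "\<lambda>_. u"] uv uA Con_refl[OF \<alpha>] by (auto simp: P_def p_def)
  \<comment> \<open>The projection is a context of the diagonal, hence of \<open>p\<close>, and this
    says that the components of \<open>p\<close> agree.\<close>
  moreover have "(\<lambda>\<sigma>. \<sigma> 0, \<lambda>_. u, \<lambda>_. u) \<in> C (\<lambda>_. u)"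
    using uA Con_refl[OF \<alpha>] by (auto simp: C_def intro: pol.proj)
  ultimately have "(\<lambda>\<sigma>. \<sigma> 0, \<lambda>_. u, \<lambda>_. u) \<in> C p" by simp
  then show "u = v" by (simp add: C_def p_def)
qed

section \<open>Unary polynomials of a finite algebra with a central congruence\<close>

lemma funpow_closed: "f ` U \<subseteq> U \<Longrightarrow> x \<in> U \<Longrightarrow> (f ^^ n) x \<in> U"
  by (induction n) auto

lemma inj_on_funpow: "f ` U \<subseteq> U \<Longrightarrow> inj_on f U \<Longrightarrow> inj_on (f ^^ n) U"
proof (induction n)
  case (Suc n)
  then show ?case
    using funpow_closed[of f U] by (auto simp: inj_on_def)
qed auto

lemma inj_on_of_funpow:
  fixes f :: "'a \<Rightarrow> 'a"
  assumes "inj_on (f ^^ n) U" "n > 0"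
  shows "inj_on f U"
proof -
  obtain m where "n = Suc m" using assms(2) by (cases n) auto
  then have "f ^^ n = f ^^ m \<circ> f" by (simp add: funpow_Suc_right del: funpow.simps)
  then show ?thesis using assms(1) inj_on_imageI2 by metis
qed

text \<open>One exponent serves all self-maps at once because the operators sending \<open>f\<close>
  to \<open>f ^^ n\<close> live in a finite set and must repeat; a positive multiple of the period
  beyond the preperiod will do.\<close>

lemma ex_idempotent_exponent:
  assumes "finite U"
  shows "\<exists>K>0. \<forall>f. f ` U \<subseteq> U \<longrightarrow> (\<forall>x\<in>U. (f ^^ K) ((f ^^ K) x) = (f ^^ K) x)"
proof -
  define G where "G n = (\<lambda>f\<in>U \<rightarrow>\<^sub>E U. restrict (f ^^ n) U)" for n :: nat
  have "G n \<in> (U \<rightarrow>\<^sub>E U) \<rightarrow>\<^sub>E (U \<rightarrow>\<^sub>E U)" for n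
  proof -
    have "restrict (f ^^ n) U \<in> U \<rightarrow>\<^sub>E U" if "f \<in> U \<rightarrow>\<^sub>E U" for f
    proof -
      have "f ` U \<subseteq> U" using that by auto
      then show ?thesis using funpow_closed[of f U] by auto
    qed
    then show ?thesis unfolding G_def by auto
  qed
  moreover have "finite ((U \<rightarrow>\<^sub>E U) \<rightarrow>\<^sub>E (U \<rightarrow>\<^sub>E U))"
    by (intro finite_PiE assms)
  ultimately have "finite (range G)" by (meson finite_subset image_subsetI)
  then have "\<not> inj G" using finite_imageD by fastforce
  then obtain i j where ij: "G i = G j" "i < j"
    unfolding inj_def by (metis linorder_neqE_nat)
  define p where "p = j - i"
  \<comment> \<open>The factor \<open>Suc i\<close> instead of \<open>i\<close> keeps
    \<open>K\<close> positive and still gives \<open>i \<le> K\<close>.\<close>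
  define K where "K = Suc i * p"
  have p: "p > 0" "j = i + p" using ij by (auto simp: p_def)
  have "(f ^^ K) ((f ^^ K) x) = (f ^^ K) x" if f: "f ` U \<subseteq> U" and x: "x \<in> U" for f x
  proof -
    define f' where "f' = restrict f U"
    have f': "f' \<in> U \<rightarrow>\<^sub>E U" using f by (auto simp: f'_def)
    have f'_pow: "(f' ^^ n) y = (f ^^ n) y" if "y \<in> U" for n y
      using that by (induction n) (use funpow_closed[OF f] in \<open>auto simp: f'_def\<close>)
    have eq: "restrict (f' ^^ i) U = restrict (f' ^^ j) U"
      using fun_cong[OF ij(1), of f'] f' by (simp add: G_def)
    have period: "(f ^^ (i + p)) y = (f ^^ i) y" if "y \<in> U" for y
      using fun_cong[OF eq, of y] that f'_pow p(2) by simp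
    have shift: "(f ^^ (n + p)) x = (f ^^ n) x" if "i \<le> n" for n
    proof -
      obtain k where n: "n = k + i" using \<open>i \<le> n\<close> by (metis add.commute le_Suc_ex)
      have "(f ^^ (k + (i + p))) x = (f ^^ k) ((f ^^ (i + p)) x)" by (simp add: funpow_add)
      also have "\<dots> = (f ^^ (k + i)) x" using period[OF x] by (simp add: funpow_add)
      finally show ?thesis by (simp add: n add.assoc)
    qed
    have iter: "(f ^^ (K + m * p)) x = (f ^^ K) x" for m
    proof (induction m)
      case (Suc m)
      have "i \<le> K" using p by (simp add: K_def trans_le_add2)
      then show ?case using shift[of "K + m * p"] Suc by (simp add: algebra_simps)
    qed simp
    have "(f ^^ K) ((f ^^ K) x) = (f ^^ (K + K)) x" by (simp add: funpow_add)
    also have "\<dots> = (f ^^ K) x" using iter[of "Suc i"] by (simp add: K_def)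
    finally show ?thesis .
  qed
  moreover have "K > 0" using p by (simp add: K_def)
  ultimately show ?thesis by blast
qed

context algebra
begin

section \<open>Unary and binary polynomials\<close>

definition pol1 :: "('a \<Rightarrow> 'a) set" where
  "pol1 = {s. (\<lambda>\<sigma>. s (\<sigma> 0)) \<in> pol}"

definition pol2 :: "('a \<Rightarrow> 'a \<Rightarrow> 'a) set" where
  "pol2 = {T. (\<lambda>\<sigma>. T (\<sigma> 0) (\<sigma> 1)) \<in> pol}"

lemma pol1_comp_pol: "s \<in> pol1 \<Longrightarrow> g \<in> pol \<Longrightarrow> (\<lambda>\<sigma>. s (g \<sigma>)) \<in> pol"
  using pol_subst[of "\<lambda>\<sigma>. s (\<sigma> 0)" "\<lambda>_. g"] by (simp add: pol1_def)

lemma pol2_comp_pol: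
  assumes "T \<in> pol2" "g \<in> pol" "h \<in> pol"
  shows "(\<lambda>\<sigma>. T (g \<sigma>) (h \<sigma>)) \<in> pol"
  using pol_subst[of "\<lambda>\<sigma>. T (\<sigma> 0) (\<sigma> 1)" "\<lambda>i. if i = 0 then g else h"] assms
  by (simp add: pol2_def)

lemma pol1_id: "(\<lambda>x. x) \<in> pol1"
  by (simp add: pol1_def pol.proj)

lemma pol1_const: "a \<in> A \<Longrightarrow> (\<lambda>x. a) \<in> pol1"
  by (simp add: pol1_def pol.const)

lemma pol1_comp: "s \<in> pol1 \<Longrightarrow> k \<in> pol1 \<Longrightarrow> (\<lambda>x. s (k x)) \<in> pol1"
  using pol1_comp_pol[of s "\<lambda>\<sigma>. k (\<sigma> 0)"] by (simp add: pol1_def)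

lemma pol1_comp2: "T \<in> pol2 \<Longrightarrow> s \<in> pol1 \<Longrightarrow> k \<in> pol1 \<Longrightarrow> (\<lambda>x. T (s x) (k x)) \<in> pol1"
  using pol2_comp_pol[of T "\<lambda>\<sigma>. s (\<sigma> 0)" "\<lambda>\<sigma>. k (\<sigma> 0)"] by (simp add: pol1_def)

lemma pol1_funpow: "s \<in> pol1 \<Longrightarrow> (s ^^ n) \<in> pol1"
proof (induction n)
  case 0
  then show ?case using pol1_id by (simp add: id_def)
next
  case (Suc n)
  then show ?case using pol1_comp[of s "s ^^ n"] by (simp add: comp_def)
qed

lemma pol2_left: "s \<in> pol1 \<Longrightarrow> (\<lambda>x y. s x) \<in> pol2"
  by (simp add: pol1_def pol2_def)

lemma pol2_right: "s \<in> pol1 \<Longrightarrow> (\<lambda>x y. s y) \<in> pol2"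
  using pol1_comp_pol[of s "\<lambda>\<sigma>. \<sigma> 1"] by (simp add: pol2_def pol.proj)

lemma pol2_comp1: "s \<in> pol1 \<Longrightarrow> T \<in> pol2 \<Longrightarrow> (\<lambda>x y. s (T x y)) \<in> pol2"
  using pol1_comp_pol[of s "\<lambda>\<sigma>. T (\<sigma> 0) (\<sigma> 1)"] by (simp add: pol2_def)

lemma pol2_comp2:
  "T \<in> pol2 \<Longrightarrow> P \<in> pol2 \<Longrightarrow> Q \<in> pol2 \<Longrightarrow> (\<lambda>x y. T (P x y) (Q x y)) \<in> pol2"
  using pol2_comp_pol[of T "\<lambda>\<sigma>. P (\<sigma> 0) (\<sigma> 1)" "\<lambda>\<sigma>. Q (\<sigma> 0) (\<sigma> 1)"] by (simp add: pol2_def)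

lemma pol2_swap: "T \<in> pol2 \<Longrightarrow> (\<lambda>x y. T y x) \<in> pol2"
  using pol2_comp2[OF _ pol2_right[OF pol1_id] pol2_left[OF pol1_id]] .

lemma pol2_funpow: "T \<in> pol2 \<Longrightarrow> (\<lambda>x. T x ^^ n) \<in> pol2"
proof (induction n)
  case 0
  then show ?case using pol2_right[OF pol1_id] by (simp add: id_def)
next
  case (Suc n)
  then show ?case
    using pol2_comp2[of T "\<lambda>x y. x" "\<lambda>x. T x ^^ n"] pol2_left[OF pol1_id] by (simp add: comp_def)
qed

lemma pol1_val: "s \<in> pol1 \<Longrightarrow> x \<in> A \<Longrightarrow> s x \<in> A"
  using pol_val[of "\<lambda>\<sigma>. s (\<sigma> 0)" "\<lambda>_. x"] by (simp add: pol1_def)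

lemma pol2_val: "T \<in> pol2 \<Longrightarrow> x \<in> A \<Longrightarrow> y \<in> A \<Longrightarrow> T x y \<in> A"
  using pol_val[of "\<lambda>\<sigma>. T (\<sigma> 0) (\<sigma> 1)" "\<lambda>i. if i = 0 then x else y"] by (simp add: pol2_def)

lemma pol1_Con: "s \<in> pol1 \<Longrightarrow> \<alpha> \<in> Con F ar A I \<Longrightarrow> (x, y) \<in> \<alpha> \<Longrightarrow> (s x, s y) \<in> \<alpha>"
  using pol_Con[of "\<lambda>\<sigma>. s (\<sigma> 0)" \<alpha> "\<lambda>_. x" "\<lambda>_. y"] by (simp add: pol1_def)

lemma pol2_Con:
  "T \<in> pol2 \<Longrightarrow> \<alpha> \<in> Con F ar A I \<Longrightarrow> (x, x') \<in> \<alpha> \<Longrightarrow> (y, y') \<in> \<alpha> \<Longrightarrow> (T x y, T x' y') \<in> \<alpha>"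
  using pol_Con[of "\<lambda>\<sigma>. T (\<sigma> 0) (\<sigma> 1)" \<alpha> "\<lambda>i. if i = 0 then x else y" "\<lambda>i. if i = 0 then x' else y'"]
  by (simp add: pol2_def)

text \<open>One argument place is the hole \<open>y\<close>, the others depend on the common
  variable \<open>x\<close>. Such contexts are what compatibility of a relation on
  \<open>pol1\<close> has to be tested with.\<close>

lemma pol_op_update:
  assumes "f \<in> F" "length rs = ar f" "set rs \<subseteq> pol1"
  shows "(\<lambda>y x. I f (map (\<lambda>r. r x) (rs[k := \<lambda>_. y]))) \<in> pol2"
proof -
  let ?gs = "(map (\<lambda>r (\<sigma> :: nat \<Rightarrow> 'a). r (\<sigma> 1)) rs)[k := \<lambda>\<sigma>. \<sigma> 0]"
  have "\<forall>g\<in>set ?gs. g \<in> pol"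
  proof
    fix g
    assume "g \<in> set ?gs"
    then have "g \<in> insert (\<lambda>\<sigma>. \<sigma> 0) (set (map (\<lambda>r (\<sigma> :: nat \<Rightarrow> 'a). r (\<sigma> 1)) rs))"
      using set_update_subset_insert by fast
    then show "g \<in> pol"
      using assms(3) pol1_comp_pol[OF _ pol.proj[of 1]] by (auto intro: pol.proj)
  qed
  then have "(\<lambda>\<sigma>. I f (map (\<lambda>g. g \<sigma>) ?gs)) \<in> pol"
    using assms by (intro pol.op) auto
  then show ?thesis by (simp add: pol2_def map_update comp_def)
qed

end

locale central_congruence = algebra F ar A I
  for F :: "'f set" and ar :: "'f \<Rightarrow> nat" and A :: "'a set" and I :: "'f \<Rightarrow> 'a list \<Rightarrow> 'a" +
  fixes \<alpha> :: "'a rel"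
  assumes fin: "finite A" and \<alpha>: "\<alpha> \<in> Con F ar A I" and cen: "central \<alpha>"
    and nontrivial: "\<exists>u v. (u, v) \<in> \<alpha> \<and> u \<noteq> v"
begin

lemmas \<alpha>_refl = Con_refl[OF \<alpha>]
lemmas \<alpha>_sym = Con_sym[OF \<alpha>]
lemmas \<alpha>_trans = Con_trans[OF \<alpha>]

lemma \<alpha>_A: "(x, y) \<in> \<alpha> \<Longrightarrow> x \<in> A" "(x, y) \<in> \<alpha> \<Longrightarrow> y \<in> A"
  using Con_subset[OF \<alpha>] by auto

lemma context_pol:
  assumes "R \<in> pol" "T \<in> pol2"
  shows "(\<lambda>\<sigma>. R (case_nat (T (\<sigma> 0) (\<sigma> 1)) (\<lambda>i. \<sigma> (Suc (Suc i))))) \<in> pol"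
  by (rule pol_case_nat[OF assms(1)]) (use assms(2) in \<open>auto simp: pol2_def intro: pol.proj\<close>)

text \<open>Centrality, with \<open>y\<close> followed by \<open>c\<close> and \<open>y'\<close>
  followed by \<open>d\<close> as the \<alpha>-related parameters, applied in both
  directions.\<close>

lemma context_param:
  assumes R: "R \<in> pol" and T: "T \<in> pol2" and ab: "a \<in> A" "b \<in> A"
    and y: "(y, y') \<in> \<alpha>" and cd: "\<And>i. (c i, d i) \<in> \<alpha>"
  shows "R (case_nat (T a y) c) = R (case_nat (T a y') d) \<longleftrightarrow>
         R (case_nat (T b y) c) = R (case_nat (T b y') d)"
proof -
  have *: "(case_nat y c i, case_nat y' d i) \<in> \<alpha>" for i
    using y cd by (cases i) auto
  show ?thesis
    using centralD[OF cen context_pol[OF R T] ab, of "case_nat y c" "case_nat y' d"]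
      centralD[OF cen context_pol[OF R T] ab(2,1), of "case_nat y c" "case_nat y' d"] *
    by auto
qed

lemma central_pol2:
  assumes "T \<in> pol2" "x \<in> A" "y \<in> A" "(u, v) \<in> \<alpha>" "T x u = T x v"
  shows "T y u = T y v"
  using context_param[OF pol.proj[of 0] assms(1-4), of "\<lambda>_. u" "\<lambda>_. v"] assms(4,5) by simp

text \<open>Equality of the maps induced on the quotient of \<open>\<alpha>\<close>, as a subalgebra of \<open>A \<times> A\<close>, by the
  syntactic congruence of the diagonal.\<close>

definition eqv :: "('a \<Rightarrow> 'a) \<Rightarrow> ('a \<Rightarrow> 'a) \<Rightarrow> bool" where
  "eqv s s' \<longleftrightarrow> (\<forall>R\<in>pol. \<forall>y y' c d. (y, y') \<in> \<alpha> \<longrightarrow> (\<forall>i. (c i, d i) \<in> \<alpha>) \<longrightarrow>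
     (R (case_nat (s y) c) = R (case_nat (s y') d) \<longleftrightarrow>
      R (case_nat (s' y) c) = R (case_nat (s' y') d)))"

lemma eqvI:
  assumes "\<And>R y y' c d. R \<in> pol \<Longrightarrow> (y, y') \<in> \<alpha> \<Longrightarrow> (\<And>i. (c i, d i) \<in> \<alpha>) \<Longrightarrow>
     R (case_nat (s y) c) = R (case_nat (s y') d) \<longleftrightarrow> R (case_nat (s' y) c) = R (case_nat (s' y') d)"
  shows "eqv s s'"
  using assms unfolding eqv_def by blast

lemma eqvD:
  assumes "eqv s s'" "R \<in> pol" "(y, y') \<in> \<alpha>" "\<And>i. (c i, d i) \<in> \<alpha>"
  shows "R (case_nat (s y) c) = R (case_nat (s y') d) \<longleftrightarrow>
    R (case_nat (s' y) c) = R (case_nat (s' y') d)"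
  using assms unfolding eqv_def by blast

lemma eqv_sym: "eqv s s' \<Longrightarrow> eqv s' s"
  unfolding eqv_def by blast

lemma eqv_agree: "(\<And>x. x \<in> A \<Longrightarrow> s x = s' x) \<Longrightarrow> eqv s s'"
  by (rule eqvI) (simp add: \<alpha>_A)

lemma eqv_comp:
  assumes "eqv s s'" "k \<in> pol1"
  shows "eqv (\<lambda>x. s (k x)) (\<lambda>x. s' (k x))"
  by (rule eqvI) (rule eqvD[OF assms(1) _ pol1_Con[OF assms(2) \<alpha>]])

text \<open>The second argument of \<open>T\<close> joins the parameters of the context, where the
  \<alpha>-related pair \<open>y\<close>, \<open>y'\<close> is admissible.\<close>

lemma eqv_context:
  assumes "eqv s s'" "T \<in> pol2"
  shows "eqv (\<lambda>x. T (s x) x) (\<lambda>x. T (s' x) x)"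
proof (rule eqvI)
  fix R y y' and c d :: "nat \<Rightarrow> 'a"
  assume R: "R \<in> pol" and y: "(y, y') \<in> \<alpha>" and cd: "\<And>i. (c i, d i) \<in> \<alpha>"
  have *: "(case_nat y c i, case_nat y' d i) \<in> \<alpha>" for i
    using y cd by (cases i) auto
  show "R (case_nat (T (s y) y) c) = R (case_nat (T (s y') y') d) \<longleftrightarrow>
    R (case_nat (T (s' y) y) c) = R (case_nat (T (s' y') y') d)"
    using eqvD[OF assms(1) context_pol[OF R assms(2)] y, of "case_nat y c" "case_nat y' d"] * by simp
qed

lemma eqv_pol1: "eqv s s' \<Longrightarrow> f \<in> pol1 \<Longrightarrow> eqv (\<lambda>x. f (s x)) (\<lambda>x. f (s' x))"
  using eqv_context[OF _ pol2_left] .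

text \<open>Here centrality enters the calculus of \<open>eqv\<close>: parameters from
  \<open>A\<close> do not matter, and in particular all constants are equivalent.\<close>

lemma eqv_param: "T \<in> pol2 \<Longrightarrow> a \<in> A \<Longrightarrow> b \<in> A \<Longrightarrow> eqv (\<lambda>x. T a x) (\<lambda>x. T b x)"
  by (rule eqvI) (rule context_param)

text \<open>The maps that are composed, up to \<open>eqv\<close>, of polynomials whose range has
  fewer than \<open>c\<close> elements. The rule \<open>comp\<close> asks for a small map at every
  variable, even if \<open>f\<close> is constant; hence \<open>small 0\<close> stays empty.\<close>

inductive_set small :: "nat \<Rightarrow> ('a \<Rightarrow> 'a) set" for c where
  rank: "s \<in> pol1 \<Longrightarrow> card (s ` A) < c \<Longrightarrow> s \<in> small c"
| comp: "f \<in> pol \<Longrightarrow> \<forall>i. s i \<in> small c \<Longrightarrow> (\<lambda>x. f (\<lambda>i. s i x)) \<in> small c"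
| eqv: "s \<in> small c \<Longrightarrow> s' \<in> pol1 \<Longrightarrow> eqv s s' \<Longrightarrow> s' \<in> small c"

lemma small_pol1: "s \<in> small c \<Longrightarrow> s \<in> pol1"
proof (induction rule: small.induct)
  case (comp f s)
  have "(\<lambda>\<sigma>. f (\<lambda>i. s i (\<sigma> 0))) \<in> pol"
    by (rule pol_subst[OF comp(1)]) (use comp in \<open>auto simp: pol1_def\<close>)
  then show ?case by (simp add: pol1_def)
qed auto

lemma small_comp_right: "s \<in> small c \<Longrightarrow> k \<in> pol1 \<Longrightarrow> (\<lambda>x. s (k x)) \<in> small c"
proof (induction rule: small.induct)
  case (rank s)
  have "(\<lambda>x. s (k x)) ` A \<subseteq> s ` A" using pol1_val[OF rank(3)] by auto
  then have "card ((\<lambda>x. s (k x)) ` A) < c"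
    using rank(2) card_mono[OF finite_imageI[OF fin]] by (metis le_less_trans)
  then show ?case using rank pol1_comp by (intro small.rank) auto
next
  case (comp f s)
  then show ?case using small.comp[of f "\<lambda>i x. s i (k x)" c] by blast
next
  case (eqv s s')
  then show ?case using small.eqv pol1_comp eqv_comp by blast
qed

lemma small_comp_left: "s \<in> small c \<Longrightarrow> f \<in> pol1 \<Longrightarrow> (\<lambda>x. f (s x)) \<in> small c"
  using small.comp[of "\<lambda>\<sigma>. f (\<sigma> 0)" "\<lambda>_. s" c] by (simp add: pol1_def)

lemma small_comp2: "g \<in> small c \<Longrightarrow> h \<in> small c \<Longrightarrow> T \<in> pol2 \<Longrightarrow> (\<lambda>x. T (g x) (h x)) \<in> small c"
  using small.comp[of "\<lambda>\<sigma>. T (\<sigma> 0) (\<sigma> 1)" "\<lambda>i. if i = 0 then g else h" c] by (simp add: pol2_def)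

lemma small_agree: "s \<in> small c \<Longrightarrow> s' \<in> pol1 \<Longrightarrow> (\<And>x. x \<in> A \<Longrightarrow> s x = s' x) \<Longrightarrow> s' \<in> small c"
  using small.eqv eqv_agree by blast

lemma small_mono: "s \<in> small c \<Longrightarrow> c \<le> d \<Longrightarrow> s \<in> small d"
  by (induction rule: small.induct) (auto intro: small.intros)

lemma small_0: "s \<notin> small 0"
proof
  assume "s \<in> small 0"
  then show False by (induction rule: small.induct) auto
qed

text \<open>Rank below 2 means constant on \<open>A\<close>, and the other two rules preserve the
  collapsing of \<alpha>-related pairs; for \<open>eqv\<close> the projection is the context that
  shows it.\<close>

lemma small_2: "s \<in> small 2 \<Longrightarrow> (y, y') \<in> \<alpha> \<Longrightarrow> s y = s y'"
proof (induction arbitrary: y y' rule: small.induct)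
  case (rank s)
  then have "card (s ` A) \<le> 1" by simp
  then show ?case
    using fin rank(3) \<alpha>_A by (metis One_nat_def card_le_Suc0_iff_eq finite_imageI imageI)
next
  case (comp f s)
  then have "(\<lambda>i. s i y) = (\<lambda>i. s i y')" by blast
  then show ?case by simp
next
  case (eqv s s')
  then show ?case
    using eqvD[OF eqv(3) pol.proj[of 0] eqv(5), of "\<lambda>_. y" "\<lambda>_. y'"] by simp
qed

text \<open>\<open>c\<close> is the last stage before the identity becomes small. It is at least 2
  because maps in \<open>small 2\<close> collapse the nontrivial \<alpha>.\<close>

lemma critical_rank: "\<exists>c\<ge>2. (\<lambda>x. x) \<notin> small c \<and> (\<lambda>x. x) \<in> small (Suc c)"
proof -
  have "(\<lambda>x. x) \<in> small (Suc (card A))"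
    by (rule small.rank) (auto intro: pol1_id)
  then obtain c where c: "(\<lambda>x. x) \<notin> small c" "(\<lambda>x. x) \<in> small (Suc c)"
    using ex_least_nat_less[of "\<lambda>c. (\<lambda>x. x) \<in> small c"] small_0 by blast
  have "c \<ge> 2"
  proof (rule ccontr)
    assume "\<not> c \<ge> 2"
    then have "(\<lambda>x. x) \<in> small 2" using c(2) small_mono[of _ "Suc c" 2] by simp
    then show False using small_2 nontrivial by blast
  qed
  then show ?thesis using c by blast
qed

text \<open>Induction on the construction of \<open>h\<close>: if all constituents of a composition
  became small after \<open>s\<close>, so would the composite. Some constituent therefore fails,
  down to a generator, which has rank at most \<open>c\<close>.\<close>

lemma nonsmall_factor:
  "h \<in> small (Suc c) \<Longrightarrow> s \<in> pol1 \<Longrightarrow> (\<lambda>x. h (s x)) \<notin> small c \<Longrightarrow>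
    \<exists>g\<in>pol1. card (g ` A) \<le> c \<and> (\<lambda>x. g (s x)) \<notin> small c"
proof (induction rule: small.induct)
  case (rank h)
  then show ?case by (intro bexI[of _ h]) auto
next
  case (comp f h)
  have "\<exists>i. (\<lambda>x. h i (s x)) \<notin> small c"
    using small.comp[of f "\<lambda>i x. h i (s x)" c] comp by blast
  then show ?case using comp by blast
next
  case (eqv h h')
  have "(\<lambda>x. h (s x)) \<notin> small c"
    using small.eqv[of "\<lambda>x. h (s x)" c "\<lambda>x. h' (s x)"] eqv eqv_comp pol1_comp by blast
  then show ?case using eqv by blast
qed

text \<open>A unary polynomial outside \<open>small c\<close> can be followed by one of rank at most
  \<open>c\<close> and stay outside. On the finite set \<open>A\<close> the sequence obtained by
  repetition returns to an earlier term, and the factor that links the two equal terms is the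
  retraction.\<close>

lemma nonsmall_idempotent:
  assumes "(\<lambda>x. x) \<notin> small c" "(\<lambda>x. x) \<in> small (Suc c)"
  shows "\<exists>e\<in>pol1. e \<notin> small c \<and> card (e ` A) = c \<and> (\<forall>x\<in>A. e (e x) = e x)"
proof -
  have "\<exists>g. \<forall>s. s \<in> pol1 \<and> s \<notin> small c \<longrightarrow>
      g s \<in> pol1 \<and> card (g s ` A) \<le> c \<and> (\<lambda>x. g s (s x)) \<notin> small c"
    using nonsmall_factor[OF assms(2)] by (intro choice) auto
  then obtain g where g: "\<And>s. s \<in> pol1 \<Longrightarrow> s \<notin> small c \<Longrightarrow>
      g s \<in> pol1 \<and> card (g s ` A) \<le> c \<and> (\<lambda>x. g s (s x)) \<notin> small c" by blast
  define f where "f = rec_nat (\<lambda>x. x) (\<lambda>_ s x. g s (s x))"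
  have f_Suc: "f (Suc n) = (\<lambda>x. g (f n) (f n x))" for n
    by (simp add: f_def)
  have f: "f n \<in> pol1 \<and> f n \<notin> small c" for n
  proof (induction n)
    case 0
    then show ?case using assms(1) pol1_id by (simp add: f_def)
  next
    case (Suc n)
    then show ?case using g pol1_comp unfolding f_Suc by blast
  qed
  have factor: "\<exists>w\<in>pol1. card (w ` A) \<le> c \<and> f (n + Suc m) = (\<lambda>x. w (f n x))" for n m
  proof (induction m)
    case 0
    then show ?case using g[of "f n"] f f_Suc by auto
  next
    case (Suc m)
    then obtain w where w: "w \<in> pol1" "card (w ` A) \<le> c" "f (n + Suc m) = (\<lambda>x. w (f n x))" by blast
    let ?g = "g (f (n + Suc m))"
    have "card ((\<lambda>x. ?g (w x)) ` A) \<le> card (w ` A)"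
      using card_image_le[OF finite_imageI[OF fin], of ?g w] by (simp add: image_image)
    moreover have "(\<lambda>x. ?g (w x)) \<in> pol1"
      using pol1_comp[of ?g w] g f w(1) by blast
    moreover have "f (n + Suc (Suc m)) = (\<lambda>x. ?g (w (f n x)))"
      using f_Suc[of "n + Suc m"] w(3) by simp
    ultimately show ?case
      using w(2) by (intro bexI[of _ "\<lambda>x. ?g (w x)"]) auto
  qed
  have "(\<lambda>n. restrict (f n) A) ` UNIV \<subseteq> A \<rightarrow>\<^sub>E A"
    using f pol1_val by auto
  then have "finite (range (\<lambda>n. restrict (f n) A))"
    using finite_PiE[OF fin, of "\<lambda>_. A"] fin finite_subset by auto
  then have "\<not> inj (\<lambda>n. restrict (f n) A)" using finite_imageD by fastforce
  then obtain a b where ab: "a < b" "restrict (f a) A = restrict (f b) A"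
    unfolding inj_def by (metis linorder_neqE_nat)
  then obtain m where "b = a + Suc m" using less_imp_Suc_add by auto
  then obtain w where w: "w \<in> pol1" "card (w ` A) \<le> c" "f b = (\<lambda>x. w (f a x))"
    using factor by blast
  \<comment> \<open>\<open>w\<close> fixes the range of \<open>f a\<close>. That range has at least
    \<open>c\<close> elements, as \<open>f a\<close> is not small, while \<open>w\<close> has rank
    at most \<open>c\<close>; so the two ranges coincide.\<close>
  have fix_f: "w (f a x) = f a x" if "x \<in> A" for x
    using ab(2) w(3) that by (metis restrict_apply')
  have "f a ` A \<subseteq> w ` A"
    using fix_f f pol1_val by (metis image_subsetI imageI)
  moreover have "c \<le> card (f a ` A)"
    using f[of a] small.rank[of "f a" c] by (meson not_le)
  ultimately have eq: "f a ` A = w ` A" and card: "card (w ` A) = c"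
    using w(2) fin card_mono[of "w ` A" "f a ` A"] card_seteq[of "w ` A" "f a ` A"] by auto
  have "w (w x) = w x" if "x \<in> A" for x
    using eq fix_f that by (metis imageE imageI)
  moreover have "w \<notin> small c"
  proof
    assume "w \<in> small c"
    then have "(\<lambda>x. w (f a x)) \<in> small c" using small_comp_right f by blast
    then show False using small_agree[of _ c "f a"] fix_f f by blast
  qed
  ultimately show ?thesis using w(1) card by blast
qed

end

section \<open>The critical retraction\<close>

locale critical_retract = central_congruence F ar A I \<alpha>
  for F :: "'f set" and ar :: "'f \<Rightarrow> nat" and A :: "'a set" and I :: "'f \<Rightarrow> 'a list \<Rightarrow> 'a"
    and \<alpha> :: "'a rel" +
  fixes c :: nat and e :: "'a \<Rightarrow> 'a"
  assumes c_ge_2: "c \<ge> 2" and id_small: "(\<lambda>x. x) \<in> small (Suc c)"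
    and e: "e \<in> pol1" and e_not_small: "e \<notin> small c" and card_e: "card (e ` A) = c"
    and e_idem: "\<And>x. x \<in> A \<Longrightarrow> e (e x) = e x"
begin

section \<open>Permutations of the range of the critical retraction\<close>

definition U :: "'a set" where "U = e ` A"

lemma U_A: "x \<in> U \<Longrightarrow> x \<in> A"
  using pol1_val[OF e] by (auto simp: U_def)

lemma e_U: "x \<in> A \<Longrightarrow> e x \<in> U"
  by (simp add: U_def)

lemma e_fix: "x \<in> U \<Longrightarrow> e x = x"
  using e_idem by (auto simp: U_def)

lemma finite_U: "finite U"
  using fin by (simp add: U_def)

lemma card_U: "card U = c"
  by (simp add: U_def card_e)

lemma ex_U: "\<exists>x. x \<in> U"
proof (rule ccontr)
  assume "\<nexists>x. x \<in> U"
  then have "U = {}" by blast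
  then show False using card_U c_ge_2 by simp
qed

lemma const_not_inj_on_U: "\<not> inj_on (\<lambda>_. a) U"
proof
  assume "inj_on (\<lambda>_. a) U"
  then have "card U = card ((\<lambda>_. a) ` U)" by (simp add: card_image)
  also have "\<dots> \<le> 1" using card_mono[of "{a}" "(\<lambda>_. a) ` U"] by auto
  finally show False using card_U c_ge_2 by simp
qed

definition K :: nat where
  "K = (SOME K. K > 0 \<and> (\<forall>f. f ` U \<subseteq> U \<longrightarrow> (\<forall>x\<in>U. (f ^^ K) ((f ^^ K) x) = (f ^^ K) x)))"

lemma K: "K > 0" "f ` U \<subseteq> U \<Longrightarrow> x \<in> U \<Longrightarrow> (f ^^ K) ((f ^^ K) x) = (f ^^ K) x"
proof -
  have "K > 0 \<and> (\<forall>f. f ` U \<subseteq> U \<longrightarrow> (\<forall>x\<in>U. (f ^^ K) ((f ^^ K) x) = (f ^^ K) x))"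
    unfolding K_def by (rule someI_ex[OF ex_idempotent_exponent[OF finite_U]])
  then show "K > 0" "f ` U \<subseteq> U \<Longrightarrow> x \<in> U \<Longrightarrow> (f ^^ K) ((f ^^ K) x) = (f ^^ K) x"
    by blast+
qed

text \<open>\<open>f ^^ K\<close> is both idempotent and injective on \<open>U\<close>, hence the
  identity there. Thus \<open>f ^^ (K - 1)\<close> inverts \<open>f\<close> on \<open>U\<close>, and
  it is a polynomial if \<open>f\<close> is one.\<close>

lemma K_inj:
  assumes "f ` U \<subseteq> U" "inj_on f U" "x \<in> U"
  shows "(f ^^ K) x = x"
  using inj_onD[OF inj_on_funpow[OF assms(1,2)] K(2)[OF assms(1,3)]] assms funpow_closed[OF assms(1)]
  by blast

lemma funpow_K: "(f ^^ K) x = (f ^^ (K - 1)) (f x)"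
proof -
  have "f ^^ K = f ^^ (K - 1) \<circ> f"
    using K(1) funpow_Suc_right[of "K - 1" f] by simp
  then show ?thesis by simp
qed

lemma small_if_not_inj:
  assumes "h \<in> pol1" "\<not> inj_on h U"
  shows "(\<lambda>x. h (e x)) \<in> small c"
proof (rule small.rank)
  show "(\<lambda>x. h (e x)) \<in> pol1" by (rule pol1_comp[OF assms(1) e])
  have "card (h ` U) \<noteq> card U" using assms(2) eq_card_imp_inj_on[OF finite_U] by blast
  then have "card (h ` U) < c" using card_image_le[OF finite_U, of h] card_U by simp
  then show "card ((\<lambda>x. h (e x)) ` A) < c" by (simp add: U_def image_image)
qed

text \<open>Following the map by the inverse permutation \<open>h ^^ (K - 1)\<close> would bring
  \<open>e\<close> into \<open>small c\<close>. Together with \<open>small_if_not_inj\<close>,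
  smallness detects exactly the polynomials that fail to permute \<open>U\<close>.\<close>

lemma not_small_if_inj:
  assumes "h \<in> pol1" "h ` U \<subseteq> U" "inj_on h U"
  shows "(\<lambda>x. h (e x)) \<notin> small c"
proof
  assume "(\<lambda>x. h (e x)) \<in> small c"
  then have "(\<lambda>x. (h ^^ (K - 1)) (h (e x))) \<in> small c"
    by (rule small_comp_left[OF _ pol1_funpow[OF assms(1)]])
  moreover have "(h ^^ (K - 1)) (h (e x)) = e x" if "x \<in> A" for x
    using K_inj[OF assms(2,3) e_U[OF that]] by (simp add: funpow_K)
  ultimately have "e \<in> small c" using small_agree[OF _ e] by blast
  then show False using e_not_small by simp
qed

text \<open>For a polynomial \<open>s\<close> this says that \<open>e \<circ> s\<close> permutes the
  finite set \<open>U\<close>.\<close>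

definition unit :: "('a \<Rightarrow> 'a) \<Rightarrow> bool" where
  "unit s \<longleftrightarrow> inj_on (\<lambda>x. e (s x)) U"

lemma unit_iff: "(\<And>x. x \<in> U \<Longrightarrow> s x \<in> U) \<Longrightarrow> unit s \<longleftrightarrow> inj_on s U"
  unfolding unit_def by (rule inj_on_cong) (simp add: e_fix)

text \<open>Being a unit is the failure of \<open>e \<circ> s \<circ> e\<close> to be small, and
  smallness is closed under \<open>eqv\<close>.\<close>

lemma unit_eqv:
  assumes "s \<in> pol1" "s' \<in> pol1" "eqv s s'" "unit s"
  shows "unit s'"
proof (rule ccontr)
  assume "\<not> unit s'"
  then have "(\<lambda>x. e (s' (e x))) \<in> small c"
    using small_if_not_inj[OF pol1_comp[OF e assms(2)]] by (simp add: unit_def)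
  moreover have "eqv (\<lambda>x. e (s' (e x))) (\<lambda>x. e (s (e x)))"
    using eqv_sym[OF eqv_pol1[OF eqv_comp[OF assms(3) e] e]] .
  ultimately have "(\<lambda>x. e (s (e x))) \<in> small c"
    using small.eqv pol1_comp[OF e pol1_comp[OF assms(1) e]] by blast
  moreover have "(\<lambda>x. e (s x)) ` U \<subseteq> U"
    using pol1_val[OF assms(1)] U_A e_U by blast
  ultimately show False
    using not_small_if_inj[OF pol1_comp[OF e assms(1)]] assms(4) by (simp add: unit_def)
qed

section \<open>Binary polynomials on the range of the retraction\<close>

definition op2 :: "('a \<Rightarrow> 'a \<Rightarrow> 'a) set" where
  "op2 = {T \<in> pol2. \<forall>x\<in>U. \<forall>y\<in>U. T x y \<in> U}"

lemma op2_pol2: "T \<in> op2 \<Longrightarrow> T \<in> pol2"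
  and op2_val: "T \<in> op2 \<Longrightarrow> x \<in> U \<Longrightarrow> y \<in> U \<Longrightarrow> T x y \<in> U"
  by (auto simp: op2_def)

lemma op2_swap: "T \<in> op2 \<Longrightarrow> (\<lambda>x y. T y x) \<in> op2"
  using pol2_swap by (auto simp: op2_def)

lemma op2_e: "T \<in> pol2 \<Longrightarrow> (\<lambda>x y. e (T x y)) \<in> op2"
  using pol2_comp1[OF e] pol2_val U_A e_U by (auto simp: op2_def)

lemma op2_funpow: "T \<in> op2 \<Longrightarrow> (\<lambda>x. T x ^^ n) \<in> op2"
  using pol2_funpow[of T n] funpow_closed[of "T x" U for x] by (simp add: op2_def image_subset_iff)

lemma op2_image: "T \<in> op2 \<Longrightarrow> x \<in> U \<Longrightarrow> T x ` U \<subseteq> U"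
  using op2_val by auto

text \<open>By centrality the maps \<open>T a\<close> and \<open>T b\<close> are equivalent, and
  units are stable under \<open>eqv\<close>.\<close>

lemma inj_param:
  assumes T: "T \<in> op2" and ab: "a \<in> U" "b \<in> U" and inj: "inj_on (T a) U"
  shows "inj_on (T b) U"
proof -
  have pol: "T x \<in> pol1" if "x \<in> U" for x
    using pol1_comp2[OF op2_pol2[OF T] pol1_const pol1_id] U_A[OF that] by simp
  have "unit (T a)" using inj unit_iff[of "T a"] op2_val[OF T ab(1)] by simp
  then have "unit (T b)"
    using unit_eqv[OF pol[OF ab(1)] pol[OF ab(2)]] eqv_param[OF op2_pol2[OF T]] ab U_A by blast
  then show ?thesis using unit_iff[of "T b"] op2_val[OF T ab(2)] by simp
qed

text \<open>Up to \<open>eqv\<close> the parameter \<open>a\<close> may be replaced by the argument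
  \<open>e y\<close> itself, and there \<open>W\<close> is the second projection; so the map is
  equivalent to \<open>e\<close>.\<close>

lemma not_small_if_local_projection:
  assumes W: "W \<in> pol2" and proj: "\<And>x y. x \<in> U \<Longrightarrow> y \<in> U \<Longrightarrow> (x, y) \<in> \<alpha> \<Longrightarrow> W x y = y"
    and a: "a \<in> U"
  shows "(\<lambda>y. W a (e y)) \<notin> small c"
proof
  assume small: "(\<lambda>y. W a (e y)) \<in> small c"
  have const: "W x z = W x' z" if "x \<in> U" "x' \<in> U" "(x, x') \<in> \<alpha>" "z \<in> A" for x x' z
  proof -
    have "W x x = W x' x"
      using proj[of x x] proj[of x' x] that \<alpha>_refl \<alpha>_sym U_A by metis
    then show ?thesis
      using central_pol2[OF pol2_swap[OF W], of x z x x'] that U_A by blast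
  qed
  have "eqv (\<lambda>y. W a (e y)) e"
  proof (rule eqvI)
    fix R y y' and c d :: "nat \<Rightarrow> 'a"
    assume R: "R \<in> pol" and y: "(y, y') \<in> \<alpha>" and cd: "\<And>i. (c i, d i) \<in> \<alpha>"
    have ey: "(e y, e y') \<in> \<alpha>" using pol1_Con[OF e \<alpha> y] .
    have U: "e y \<in> U" "e y' \<in> U" using y \<alpha>_A e_U by blast+
    have "R (case_nat (W a (e y)) c) = R (case_nat (W a (e y')) d) \<longleftrightarrow>
        R (case_nat (W (e y) (e y)) c) = R (case_nat (W (e y) (e y')) d)"
      using context_param[OF R W U_A[OF a] U_A[OF U(1)] ey cd] .
    moreover have "W (e y) (e y) = e y"
      using proj[OF U(1) U(1)] \<alpha>_refl U_A[OF U(1)] by blast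
    moreover have "W (e y) (e y') = e y'"
      using proj[OF U ey] .
    ultimately show "R (case_nat (W a (e y)) c) = R (case_nat (W a (e y')) d) \<longleftrightarrow>
        R (case_nat (e y) c) = R (case_nat (e y') d)"
      by simp
  qed
  then show False using small.eqv[OF small e] e_not_small by blast
qed

text \<open>If both one-variable parts of an idempotent binary \<open>T\<close> were singular, iterating \<open>T\<close> in its
  second variable would yield a rectangular band on the \<open>\<alpha>\<close>-blocks, and hence a decomposition of
  \<open>e\<close> into maps of smaller rank.\<close>

lemma idempotent_op2_part_inj:
  assumes T: "T \<in> op2" and idem: "\<And>x. x \<in> U \<Longrightarrow> T x x = x" and ab: "a \<in> U" "b \<in> U"
    and part1: "\<not> inj_on (\<lambda>x. T x a) U" and part2: "\<not> inj_on (T b) U"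
  shows False
proof -
  define q where "q = (\<lambda>x. T x ^^ K)"
  have q: "q \<in> op2" unfolding q_def by (rule op2_funpow[OF T])
  have q_idem: "q x x = x" if "x \<in> U" for x
  proof -
    have "(T x ^^ n) x = x" for n by (induction n) (auto simp: idem that)
    then show ?thesis by (simp add: q_def)
  qed
  have q_q: "q x (q x y) = q x y" if "x \<in> U" "y \<in> U" for x y
    unfolding q_def using K(2)[OF op2_image[OF T that(1)] that(2)] .
  have q_loc: "(q x y, y) \<in> \<alpha>" "(q x y, x) \<in> \<alpha>" if "x \<in> U" "y \<in> U" "(x, y) \<in> \<alpha>" for x y
  proof -
    show "(q x y, y) \<in> \<alpha>"
      using pol2_Con[OF op2_pol2[OF q] \<alpha> that(3) \<alpha>_refl[OF U_A[OF that(2)]]] q_idem[OF that(2)] by simp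
    then show "(q x y, x) \<in> \<alpha>" using \<alpha>_trans \<alpha>_sym that(3) by blast
  qed
  \<comment> \<open>Centrality moves the equation \<open>q_q\<close> from the first argument
    \<open>x\<close> to any first argument \<open>z\<close>.\<close>
  have q1: "q z (q x y) = q z y" if "x \<in> U" "y \<in> U" "(x, y) \<in> \<alpha>" "z \<in> U" for x y z
    using central_pol2[OF op2_pol2[OF q] U_A[OF that(1)] U_A[OF that(4)] q_loc(1)[OF that(1-3)]]
      q_q[OF that(1,2)] by blast
  have q2: "q (q x y) z = q x z" if "x \<in> U" "y \<in> U" "(x, y) \<in> \<alpha>" "z \<in> U" for x y z
  proof -
    have w: "q x y \<in> U" using op2_val[OF q that(1,2)] .
    \<comment> \<open>Idempotence gives an equation in which, again by centrality, the second
      argument \<open>y\<close> can be moved to \<open>z\<close>.\<close>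
    have "q (q x y) y = q x y" using q1[OF that(1-3) w] q_idem[OF w] by simp
    then show ?thesis
      using central_pol2[OF pol2_swap[OF op2_pol2[OF q]] U_A[OF that(2)] U_A[OF that(4)]
          q_loc(2)[OF that(1-3)]] by blast
  qed
  show False
  proof (cases "\<forall>x\<in>U. \<forall>y\<in>U. (x, y) \<in> \<alpha> \<longrightarrow> q x y = x")
    \<comment> \<open>Now \<open>q\<close> is the first projection on \<alpha>-blocks, which makes
      \<open>T\<close> injective in its first variable on each block. The iterate \<open>q'\<close>
      in that variable is then a local projection, although \<open>part1\<close> makes it
      singular.\<close>
    case True
    define q' where "q' = (\<lambda>y x. ((\<lambda>z. T z y) ^^ K) x)"
    have q': "q' \<in> op2" unfolding q'_def using op2_funpow[OF op2_swap[OF T]] .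
    have inj: "x = x'" if "x \<in> U" "x' \<in> U" "(x, x') \<in> \<alpha>" "y \<in> U" "T x y = T x' y" for x x' y
    proof -
      have T_eq: "T x w = T x' w" if "w \<in> U" for w
        using central_pol2[OF pol2_swap[OF op2_pol2[OF T]] U_A[OF \<open>y \<in> U\<close>] U_A[OF that] \<open>(x, x') \<in> \<alpha>\<close>]
          \<open>T x y = T x' y\<close> by blast
      have "(T x ^^ n) w = (T x' ^^ n) w" if "w \<in> U" for n w
      proof (induction n)
        case (Suc n)
        then show ?case
          using T_eq funpow_closed[OF op2_image[OF T \<open>x' \<in> U\<close>] that] by simp
      qed simp
      then have "q x x = q x' x" using that(1) by (simp add: q_def)
      then show ?thesis using q_idem[OF that(1)] True that \<alpha>_sym by metis
    qed
    have T_loc: "(T x y, y) \<in> \<alpha>" if "(x, y) \<in> \<alpha>" "y \<in> U" for x y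
      using pol2_Con[OF op2_pol2[OF T] \<alpha> that(1) \<alpha>_refl[OF U_A[OF that(2)]]] idem[OF that(2)] by simp
    have pow_loc: "(((\<lambda>z. T z y) ^^ n) x, y) \<in> \<alpha>" if "(x, y) \<in> \<alpha>" "y \<in> U" for x y n
      using that T_loc by (induction n) auto
    have pow_U: "((\<lambda>z. T z y) ^^ n) x \<in> U" if "x \<in> U" "y \<in> U" for x y n
      using funpow_closed[of "\<lambda>z. T z y" U] op2_val[OF T] that by auto
    have pow_inj: "x = x'" if "x \<in> U" "x' \<in> U" "y \<in> U" "(x, y) \<in> \<alpha>" "(x', y) \<in> \<alpha>"
      "((\<lambda>z. T z y) ^^ n) x = ((\<lambda>z. T z y) ^^ n) x'" for x x' y n
      using that(6)
    proof (induction n)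
      case (Suc n)
      have "((\<lambda>z. T z y) ^^ n) x = ((\<lambda>z. T z y) ^^ n) x'"
      proof (rule inj)
        show "(((\<lambda>z. T z y) ^^ n) x, ((\<lambda>z. T z y) ^^ n) x') \<in> \<alpha>"
          using pow_loc[OF that(4,3)] pow_loc[OF that(5,3)] \<alpha>_trans \<alpha>_sym by blast
      qed (use that pow_U Suc in auto)
      then show ?case by (rule Suc.IH)
    qed simp
    have proj: "q' x y = y" if "x \<in> U" "y \<in> U" "(x, y) \<in> \<alpha>" for x y
    proof -
      have yx: "(y, x) \<in> \<alpha>" using \<alpha>_sym that(3) .
      have "((\<lambda>z. T z x) ^^ K) (((\<lambda>z. T z x) ^^ K) y) = ((\<lambda>z. T z x) ^^ K) y"
        using K(2)[of "\<lambda>z. T z x" y] op2_val[OF T] that by auto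
      then show ?thesis
        unfolding q'_def using pow_inj[OF pow_U[OF that(2,1)] that(2,1) pow_loc[OF yx that(1)] yx] by blast
    qed
    have "\<not> inj_on (q' a) U"
      using part1 inj_on_of_funpow[OF _ K(1)] unfolding q'_def by blast
    moreover have "q' a \<in> pol1"
      using pol1_comp2[OF op2_pol2[OF q'] pol1_const[OF U_A[OF ab(1)]] pol1_id] by simp
    ultimately have "(\<lambda>y. q' a (e y)) \<in> small c" by (intro small_if_not_inj)
    then show False
      using not_small_if_local_projection[OF op2_pol2[OF q'] proj ab(1)] by blast
  next
    \<comment> \<open>By the band law \<open>q2\<close>, injectivity in the first variable would
      make \<open>q\<close> the first projection. So both parts of \<open>q\<close> are singular,
      and \<open>W\<close> is a local projection composed of them.\<close>
    case False
    have part1': "\<not> inj_on (\<lambda>x. q x b) U"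
    proof
      assume inj: "inj_on (\<lambda>x. q x b) U"
      have "q x y = x" if "x \<in> U" "y \<in> U" "(x, y) \<in> \<alpha>" for x y
        using inj_onD[OF inj q2[OF that ab(2)]] op2_val[OF q that(1,2)] that(1) by blast
      then show False using False by blast
    qed
    have part2': "\<not> inj_on (q b) U"
      using part2 inj_on_of_funpow[OF _ K(1)] unfolding q_def by blast
    define W where "W = (\<lambda>x y. q (q y x) (q x y))"
    have W: "W \<in> pol2"
      unfolding W_def by (rule pol2_comp2[OF op2_pol2[OF q] pol2_swap[OF op2_pol2[OF q]] op2_pol2[OF q]])
    have proj: "W x y = y" if "x \<in> U" "y \<in> U" "(x, y) \<in> \<alpha>" for x y
      unfolding W_def
      using q2[OF that(2,1) \<alpha>_sym[OF that(3)] op2_val[OF q that(1,2)]] q1[OF that that(2)] q_idem[OF that(2)]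
      by simp
    have "(\<lambda>x. q x b) \<in> pol1" "q b \<in> pol1"
      using pol1_comp2[OF op2_pol2[OF q] pol1_id pol1_const[OF U_A[OF ab(2)]]]
        pol1_comp2[OF op2_pol2[OF q] pol1_const[OF U_A[OF ab(2)]] pol1_id] by simp_all
    then have "(\<lambda>y. q (q (e y) b) (q b (e y))) \<in> small c"
      using small_comp2[OF small_if_not_inj[OF _ part1'] small_if_not_inj[OF _ part2'] op2_pol2[OF q]] by blast
    then show False
      using not_small_if_local_projection[OF W proj ab(2)] by (simp add: W_def)
  qed
qed

text \<open>Following \<open>T\<close> by the inverse of its diagonal makes it idempotent, and a
  singular part stays singular.\<close>

lemma diag_inj_imp_part_inj:
  assumes T: "T \<in> op2" and diag: "inj_on (\<lambda>x. T x x) U" and ab: "a \<in> U" "b \<in> U"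
  shows "inj_on (\<lambda>x. T x a) U \<or> inj_on (T b) U"
proof (rule ccontr)
  assume parts: "\<not> (inj_on (\<lambda>x. T x a) U \<or> inj_on (T b) U)"
  define g where "g = (\<lambda>x. T x x)"
  have g: "g \<in> pol1" unfolding g_def by (rule pol1_comp2[OF op2_pol2[OF T] pol1_id pol1_id])
  have gU: "g ` U \<subseteq> U" using op2_val[OF T] by (auto simp: g_def)
  define T' where "T' = (\<lambda>x y. (g ^^ (K - 1)) (T x y))"
  show False
  proof (rule idempotent_op2_part_inj)
    show "T' \<in> op2"
      using pol2_comp1[OF pol1_funpow[OF g] op2_pol2[OF T]] funpow_closed[OF gU] op2_val[OF T]
      by (auto simp: op2_def T'_def)
    show "T' x x = x" if "x \<in> U" for x
      using K_inj[OF gU _ that] diag funpow_K[of g x] by (simp add: T'_def g_def)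
    show "\<not> inj_on (\<lambda>x. T' x a) U"
      using parts inj_on_imageI2[of "g ^^ (K - 1)" "\<lambda>x. T x a" U] by (auto simp: T'_def comp_def)
    show "\<not> inj_on (T' b) U"
      using parts inj_on_imageI2[of "g ^^ (K - 1)" "T b" U] by (auto simp: T'_def comp_def)
  qed (use ab in auto)
qed

text \<open>Suppose the diagonal \<open>g\<close> is singular, and let \<open>r x\<close> be the
  inverse of \<open>T x\<close>. Then \<open>r x (g y)\<close> has the identity as diagonal, hence
  an injective part. The part in \<open>y\<close> factors through \<open>g\<close>, and the part in
  \<open>x\<close> is an iterate that is singular by induction on the exponent.\<close>

lemma diag_inj_if_one_part_inj:
  assumes T: "T \<in> op2" and ab: "a \<in> U" "b \<in> U"
    and part1: "\<not> inj_on (\<lambda>x. T x a) U" and part2: "inj_on (T b) U"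
  shows "inj_on (\<lambda>x. T x x) U"
proof (rule ccontr)
  assume diag: "\<not> inj_on (\<lambda>x. T x x) U"
  define r where "r = (\<lambda>x. T x ^^ (K - 1))"
  define g where "g = (\<lambda>x. T x x)"
  have r: "r \<in> op2" unfolding r_def by (rule op2_funpow[OF T])
  have g: "g \<in> pol1" unfolding g_def by (rule pol1_comp2[OF op2_pol2[OF T] pol1_id pol1_id])
  have gU: "g x \<in> U" if "x \<in> U" for x using op2_val[OF T that that] by (simp add: g_def)
  have inj: "inj_on (T x) U" if "x \<in> U" for x using inj_param[OF T ab(2) that part2] .
  have part1_all: "\<not> inj_on (\<lambda>x. T x y) U" if "y \<in> U" for y
    using inj_param[OF op2_swap[OF T] that ab(1)] part1 by blast
  define q where "q = (\<lambda>x y. r x (g y))"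
  have q: "q \<in> op2"
    using pol2_comp2[OF op2_pol2[OF r] pol2_left[OF pol1_id] pol2_right[OF g]] op2_val[OF r] gU
    by (auto simp: q_def op2_def)
  have "q x x = x" if "x \<in> U" for x
    using K_inj[OF op2_image[OF T that] inj[OF that] that] by (simp add: q_def r_def g_def funpow_K)
  then have "inj_on (\<lambda>x. q x x) U" by (simp add: inj_on_def)
  then have "inj_on (\<lambda>x. q x b) U \<or> inj_on (q b) U"
    using diag_inj_imp_part_inj[OF q _ ab(2) ab(2)] by blast
  moreover have "\<not> inj_on (q b) U"
    using diag inj_on_imageI2[of "r b" g U] by (auto simp: q_def g_def comp_def)
  moreover have "\<not> inj_on (\<lambda>x. (T x ^^ n) (g b)) U" for n
  proof (induction n)
    case 0
    then show ?case using const_not_inj_on_U by simp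
  next
    case (Suc n)
    let ?w = "\<lambda>x. (T x ^^ n) (g b)"
    have w: "?w \<in> pol1"
      using pol1_comp2[OF op2_pol2[OF op2_funpow[OF T]] pol1_id pol1_const[OF U_A[OF gU[OF ab(2)]]]] .
    have wU: "?w x \<in> U" if "x \<in> U" for x
      using op2_val[OF op2_funpow[OF T] that gU[OF ab(2)]] .
    \<comment> \<open>Both parts of this operation are singular, the first by
      \<open>part1_all\<close> and the second because \<open>?w\<close> is; hence so is its
      diagonal, the next iterate.\<close>
    have T': "(\<lambda>x y. T x (?w y)) \<in> op2"
      using pol2_comp2[OF op2_pol2[OF T] pol2_left[OF pol1_id] pol2_right[OF w]] op2_val[OF T] wU
      by (auto simp: op2_def)
    have "\<not> inj_on (\<lambda>y. T b (?w y)) U"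
      using Suc inj_on_imageI2[of "T b" ?w U] by (auto simp: comp_def)
    then have "\<not> inj_on (\<lambda>x. T x (?w x)) U"
      using diag_inj_imp_part_inj[OF T' _ ab(2) ab(2)] part1_all[OF wU[OF ab(2)]] by blast
    then show ?case by simp
  qed
  ultimately show False by (simp add: q_def r_def)
qed

text \<open>The working form of the two preceding facts: a variable in which \<open>T\<close> is
  singular may be frozen at any value when the diagonal is tested.\<close>

lemma diag_inj_iff:
  assumes "T \<in> op2" "a \<in> U" "b \<in> U" "\<not> inj_on (\<lambda>x. T x a) U"
  shows "inj_on (\<lambda>x. T x x) U \<longleftrightarrow> inj_on (T b) U"
  using diag_inj_imp_part_inj[OF assms(1) _ assms(2,3)] diag_inj_if_one_part_inj[OF assms] assms(4) by blast

text \<open>The kernel of \<open>\<Psi>\<close> is the syntactic congruence of the set of units.\<close>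

definition \<Psi> :: "('a \<Rightarrow> 'a) \<Rightarrow> ('a \<Rightarrow> 'a \<Rightarrow> 'a) set" where
  "\<Psi> s = {T \<in> pol2. unit (\<lambda>x. T (s x) x)}"

lemma \<Psi>_agree: "(\<And>x. x \<in> U \<Longrightarrow> p x = q x) \<Longrightarrow> \<Psi> p = \<Psi> q"
proof -
  assume "\<And>x. x \<in> U \<Longrightarrow> p x = q x"
  then have "unit (\<lambda>x. T (p x) x) = unit (\<lambda>x. T (q x) x)" for T
    unfolding unit_def by (intro inj_on_cong) simp
  then show ?thesis by (simp add: \<Psi>_def)
qed

text \<open>The contexts that define \<open>\<Psi>\<close> may use the variable \<open>x\<close>
  besides the hole, so a context composed with \<open>G\<close> is again one of them.\<close>

lemma \<Psi>_cong:
  assumes "G \<in> pol2" "\<Psi> p = \<Psi> q"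
  shows "\<Psi> (\<lambda>x. G (p x) x) = \<Psi> (\<lambda>x. G (q x) x)"
proof -
  have "T \<in> \<Psi> (\<lambda>x. G (s x) x) \<longleftrightarrow> T \<in> pol2 \<and> (\<lambda>y x. T (G y x) x) \<in> \<Psi> s" for T s
    using pol2_comp2[OF _ assms(1) pol2_right[OF pol1_id]] by (auto simp: \<Psi>_def)
  then show ?thesis using assms(2) by auto
qed

lemma \<Psi>_cong1: "f \<in> pol1 \<Longrightarrow> \<Psi> p = \<Psi> q \<Longrightarrow> \<Psi> (\<lambda>x. f (p x)) = \<Psi> (\<lambda>x. f (q x))"
  using \<Psi>_cong[OF pol2_left] .

lemma \<Psi>_op:
  assumes "f \<in> F" "length ps = ar f" "length qs = ar f" "set ps \<subseteq> pol1" "set qs \<subseteq> pol1"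
    "\<forall>i<ar f. \<Psi> (ps ! i) = \<Psi> (qs ! i)"
  shows "\<Psi> (\<lambda>x. I f (map (\<lambda>p. p x) ps)) = \<Psi> (\<lambda>x. I f (map (\<lambda>p. p x) qs))"
proof (rule list_replace_one_by_one[where n = "ar f" and P = pol1 and E = "\<lambda>p q. \<Psi> p = \<Psi> q"
      and G = "\<lambda>ps. \<Psi> (\<lambda>x. I f (map (\<lambda>p. p x) ps))"])
  fix rs k p q
  assume rs: "length rs = ar f" "set rs \<subseteq> pol1" and pq: "\<Psi> p = \<Psi> q"
  show "\<Psi> (\<lambda>x. I f (map (\<lambda>p. p x) (rs[k := p]))) = \<Psi> (\<lambda>x. I f (map (\<lambda>p. p x) (rs[k := q])))"
    using \<Psi>_cong[OF pol_op_update[OF assms(1) rs, of k] pq] by (simp add: map_update)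
qed (use assms in auto)

lemma \<Psi>_pol:
  assumes "f \<in> pol" "\<And>i. p i \<in> pol1" "\<And>i. q i \<in> pol1" "\<And>i. \<Psi> (p i) = \<Psi> (q i)"
  shows "\<Psi> (\<lambda>x. f (\<lambda>i. p i x)) = \<Psi> (\<lambda>x. f (\<lambda>i. q i x))"
  using assms(1)
proof (induction rule: pol.induct)
  case (op f gs)
  have pol: "(\<lambda>x. g (\<lambda>i. p i x)) \<in> pol1 \<and> (\<lambda>x. g (\<lambda>i. q i x)) \<in> pol1" if "g \<in> pol" for g
    using pol_subst[OF that, of "\<lambda>i \<sigma>. p i (\<sigma> 0)"] pol_subst[OF that, of "\<lambda>i \<sigma>. q i (\<sigma> 0)"] assms(2,3)
    by (simp add: pol1_def)
  have "\<Psi> (\<lambda>x. I f (map (\<lambda>p. p x) (map (\<lambda>g x. g (\<lambda>i. p i x)) gs))) =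
      \<Psi> (\<lambda>x. I f (map (\<lambda>p. p x) (map (\<lambda>g x. g (\<lambda>i. q i x)) gs)))"
    by (rule \<Psi>_op) (use op pol in auto)
  then show ?case by (simp add: comp_def)
qed (use assms in auto)

lemma \<Psi>_eqv:
  assumes "eqv s s'" "s \<in> pol1" "s' \<in> pol1"
  shows "\<Psi> s = \<Psi> s'"
proof -
  have "unit (\<lambda>x. T (s x) x) = unit (\<lambda>x. T (s' x) x)" if T: "T \<in> pol2" for T
    using unit_eqv[OF pol1_comp2[OF T assms(2) pol1_id] pol1_comp2[OF T assms(3) pol1_id] eqv_context[OF assms(1) T]]
      unit_eqv[OF pol1_comp2[OF T assms(3) pol1_id] pol1_comp2[OF T assms(2) pol1_id] eqv_sym[OF eqv_context[OF assms(1) T]]]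
    by blast
  then show ?thesis by (auto simp: \<Psi>_def)
qed

text \<open>The common class of all constants; it becomes the idempotent element of the small
  algebra.\<close>

definition Z :: "('a \<Rightarrow> 'a \<Rightarrow> 'a) set" where
  "Z = \<Psi> (\<lambda>_. SOME a. a \<in> A)"

lemma \<Psi>_const:
  assumes "a \<in> A"
  shows "\<Psi> (\<lambda>_. a) = Z"
proof -
  have b: "(SOME a. a \<in> A) \<in> A" using assms by (rule someI)
  show ?thesis
    unfolding Z_def
    using \<Psi>_eqv[OF eqv_param[OF pol2_left[OF pol1_id] assms b] pol1_const[OF assms] pol1_const[OF b]] .
qed

lemma \<Psi>_pol1_Z: "f \<in> pol1 \<Longrightarrow> \<Psi> p = Z \<Longrightarrow> \<Psi> (\<lambda>x. f (p x)) = Z"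
proof -
  assume f: "f \<in> pol1" and p: "\<Psi> p = Z"
  obtain a where a: "a \<in> A" using ex_U U_A by blast
  show ?thesis
    using \<Psi>_cong1[OF f, of p "\<lambda>_. a"] p \<Psi>_const[OF a] \<Psi>_const[OF pol1_val[OF f a]] by simp
qed

text \<open>If no unary polynomial turns \<open>p\<close> into a unit, then \<open>W\<close> is
  singular in its first variable, which can be frozen at \<open>a\<close>; after that,
  \<open>p a\<close> is exchanged for \<open>a\<close> by centrality.\<close>

lemma \<Psi>_eq_Z_if_no_unit:
  assumes p: "p \<in> pol1" and no_unit: "\<And>f. f \<in> pol1 \<Longrightarrow> \<not> unit (\<lambda>x. f (p x))"
  shows "\<Psi> p = Z"
proof -
  obtain a where a: "a \<in> U" using ex_U by blast
  have "unit (\<lambda>x. T (p x) x) \<longleftrightarrow> unit (\<lambda>x. T a x)" if T: "T \<in> pol2" for T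
  proof -
    define W where "W = (\<lambda>y x. e (T (p y) x))"
    have W: "W \<in> op2"
      unfolding W_def using op2_e[OF pol2_comp2[OF T pol2_left[OF p] pol2_right[OF pol1_id]]] .
    have "\<not> inj_on (\<lambda>y. W y a) U"
      using no_unit[OF pol1_comp2[OF T pol1_id pol1_const[OF U_A[OF a]]]] by (simp add: W_def unit_def)
    then have "unit (\<lambda>x. T (p x) x) \<longleftrightarrow> unit (\<lambda>x. T (p a) x)"
      using diag_inj_iff[OF W a a] by (simp add: W_def unit_def)
    moreover have "inj_on (\<lambda>x. e (T (p a) x)) U \<longleftrightarrow> inj_on (\<lambda>x. e (T a x)) U"
    proof -
      have pol: "(\<lambda>x. T z x) \<in> pol1" if "z \<in> A" for z
        using pol1_comp2[OF T pol1_const[OF that] pol1_id] .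
      have pa: "p a \<in> A" "a \<in> A" using pol1_val[OF p] U_A[OF a] by auto
      show ?thesis
        using unit_eqv[OF pol[OF pa(1)] pol[OF pa(2)] eqv_param[OF T pa]]
          unit_eqv[OF pol[OF pa(2)] pol[OF pa(1)] eqv_param[OF T pa(2,1)]] by (auto simp: unit_def)
    qed
    ultimately show ?thesis by (simp add: unit_def)
  qed
  then have "\<Psi> p = \<Psi> (\<lambda>_. a)" by (auto simp: \<Psi>_def)
  then show ?thesis using \<Psi>_const[OF U_A[OF a]] by simp
qed

lemma \<Psi>_e_eq_Z:
  assumes "h \<in> pol1" "\<not> unit h"
  shows "\<Psi> (\<lambda>x. e (h x)) = Z"
proof (rule \<Psi>_eq_Z_if_no_unit[OF pol1_comp[OF e assms(1)]])
  show "\<not> unit (\<lambda>x. f (e (h x)))" if "f \<in> pol1" for f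
    using assms(2) inj_on_imageI2[of "\<lambda>y. e (f y)" "\<lambda>x. e (h x)" U] by (auto simp: unit_def comp_def)
qed

lemma \<Psi>_neq_Z_if_unit:
  assumes "unit h"
  shows "\<Psi> h \<noteq> Z"
proof
  assume *: "\<Psi> h = Z"
  obtain a where a: "a \<in> A" using ex_U U_A by blast
  have "(\<lambda>y x. y) \<in> \<Psi> h" using assms pol2_left[OF pol1_id] by (simp add: \<Psi>_def)
  then have "unit (\<lambda>_. a)" using * \<Psi>_const[OF a] by (auto simp: \<Psi>_def)
  then show False using const_not_inj_on_U[of "e a"] unfolding unit_def by blast
qed

lemma unit_id: "unit (\<lambda>x. x)"
  by (simp add: unit_def inj_on_def e_fix)

text \<open>Points at which the values of a polynomial decide whether its class is \<open>Z\<close>.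
  By \<open>\<Psi>_eq_if_sep\<close> they then decide the whole class.\<close>

definition sep :: "'a set \<Rightarrow> bool" where
  "sep X \<longleftrightarrow> (\<forall>p\<in>pol1. \<forall>p'\<in>pol1. (\<forall>x\<in>X. p x = p' x) \<longrightarrow> \<Psi> p' = Z \<longrightarrow> \<Psi> p = Z)"

lemma sepD:
  "sep X \<Longrightarrow> p \<in> pol1 \<Longrightarrow> p' \<in> pol1 \<Longrightarrow> \<forall>x\<in>X. p x = p' x \<Longrightarrow> \<Psi> p' = Z \<Longrightarrow> \<Psi> p = Z"
  unfolding sep_def by blast

text \<open>A context that makes a unit of \<open>p\<close> but not of \<open>p'\<close> yields,
  after \<open>e\<close>, two polynomials that agree on \<open>X\<close>, the first a unit and the
  second of class \<open>Z\<close>; \<open>sep\<close> forbids this.\<close>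

lemma \<Psi>_eq_if_sep:
  assumes sep: "sep X" and p: "p \<in> pol1" "p' \<in> pol1" and eq: "\<And>x. x \<in> X \<Longrightarrow> p x = p' x"
  shows "\<Psi> p = \<Psi> p'"
proof -
  have "\<Psi> p \<subseteq> \<Psi> p'" if p: "p \<in> pol1" "p' \<in> pol1" and eq: "\<And>x. x \<in> X \<Longrightarrow> p x = p' x" for p p'
  proof
    fix T
    assume "T \<in> \<Psi> p"
    then have T: "T \<in> pol2" and u: "unit (\<lambda>x. T (p x) x)" by (auto simp: \<Psi>_def)
    have pol: "(\<lambda>x. T (p x) x) \<in> pol1" "(\<lambda>x. T (p' x) x) \<in> pol1"
      using pol1_comp2[OF T _ pol1_id] p by auto
    show "T \<in> \<Psi> p'"
    proof (rule ccontr)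
      assume "T \<notin> \<Psi> p'"
      then have "\<not> unit (\<lambda>x. T (p' x) x)" using T by (simp add: \<Psi>_def)
      then have "\<Psi> (\<lambda>x. e (T (p' x) x)) = Z" by (rule \<Psi>_e_eq_Z[OF pol(2)])
      moreover have "\<forall>x\<in>X. e (T (p x) x) = e (T (p' x) x)" by (simp add: eq)
      ultimately have "\<Psi> (\<lambda>x. e (T (p x) x)) = Z"
        using sepD[OF sep pol1_comp[OF e pol(1)] pol1_comp[OF e pol(2)]] by blast
      moreover have "unit (\<lambda>x. e (T (p x) x))"
        using u pol1_val[OF pol(1)] U_A by (auto simp: unit_def inj_on_def e_idem)
      ultimately show False using \<Psi>_neq_Z_if_unit by blast
    qed
  qed
  from this[OF p eq] this[OF p(2,1) eq[symmetric]] show ?thesis by blast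
qed

end

section \<open>A small algebra with an idempotent element\<close>

context critical_retract
begin

text \<open>A failure of \<open>sep Y\<close> provides a single pair that agrees on
  \<open>Y\<close>. Some \<open>f\<close> turns its nonzero member into a unit; undoing that unit
  and applying \<open>s\<close> gives this member the class of \<open>s\<close>, while the other one
  keeps the class \<open>Z\<close>.\<close>

lemma lift_pair:
  assumes "\<not> sep Y" "s \<in> pol1"
  shows "\<exists>p\<in>pol1. \<exists>p'\<in>pol1. (\<forall>x\<in>Y. p x = p' x) \<and> \<Psi> p = \<Psi> s \<and> \<Psi> p' = Z"
proof -
  obtain p p' where p: "p \<in> pol1" "p' \<in> pol1" "\<forall>x\<in>Y. p x = p' x" "\<Psi> p' = Z" "\<Psi> p \<noteq> Z"
    using assms(1) unfolding sep_def by blast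
  obtain f where f: "f \<in> pol1" "unit (\<lambda>x. f (p x))"
    using \<Psi>_eq_Z_if_no_unit[OF p(1)] p(5) by blast
  define \<phi> where "\<phi> = (\<lambda>x. e (f (p x)))"
  have \<phi>: "\<phi> \<in> pol1" unfolding \<phi>_def by (rule pol1_comp[OF e pol1_comp[OF f(1) p(1)]])
  have \<phi>U: "\<phi> ` U \<subseteq> U" using pol1_val[OF pol1_comp[OF f(1) p(1)]] U_A e_U by (auto simp: \<phi>_def)
  have \<phi>_inj: "inj_on \<phi> U" using f(2) by (simp add: unit_def \<phi>_def)
  define k where "k = (\<lambda>y. s ((\<phi> ^^ (K - 1)) (e (f y))))"
  have k: "k \<in> pol1"
    unfolding k_def by (rule pol1_comp[OF assms(2) pol1_comp[OF pol1_funpow[OF \<phi>] pol1_comp[OF e f(1)]]])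
  have "k (p x) = s x" if "x \<in> U" for x
    using K_inj[OF \<phi>U \<phi>_inj that] funpow_K[of \<phi> x] by (simp add: k_def \<phi>_def)
  then have "\<Psi> (\<lambda>x. k (p x)) = \<Psi> s" by (rule \<Psi>_agree)
  moreover have "\<Psi> (\<lambda>x. k (p' x)) = Z" by (rule \<Psi>_pol1_Z[OF k p(4)])
  moreover have "\<forall>x\<in>Y. k (p x) = k (p' x)" using p(3) by simp
  ultimately show ?thesis
    by (intro bexI[OF _ pol1_comp[OF k p(1)]] bexI[OF _ pol1_comp[OF k p(2)]] conjI)
qed

text \<open>When \<open>Y\<close> lacks just one point of a set \<open>X\<close> with \<open>sep X\<close>, a covering of the identity map
  represents all values of \<open>\<Psi>\<close> by polynomials that differ in a single value.\<close>

definition cover :: "'a set \<Rightarrow> ('a \<Rightarrow> 'a) \<Rightarrow> bool" where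
  "cover Y h \<longleftrightarrow> (\<exists>p0\<in>pol1. \<forall>s\<in>pol1. \<exists>p\<in>pol1. (\<forall>x\<in>Y. p x = p0 x) \<and> \<Psi> p = \<Psi> (\<lambda>x. h (s x)))"

lemma finite_range_\<Psi>: "finite (\<Psi> ` pol1)"
proof (rule finite_subset)
  show "\<Psi> ` pol1 \<subseteq> \<Psi> ` (A \<rightarrow>\<^sub>E A)"
  proof
    fix d
    assume "d \<in> \<Psi> ` pol1"
    then obtain s where s: "s \<in> pol1" "d = \<Psi> s" by blast
    have "\<Psi> s = \<Psi> (restrict s A)" by (rule \<Psi>_agree) (simp add: U_A)
    moreover have "restrict s A \<in> A \<rightarrow>\<^sub>E A" using pol1_val[OF s(1)] by simp
    ultimately show "d \<in> \<Psi> ` (A \<rightarrow>\<^sub>E A)" using s(2) by blast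
  qed
  show "finite (\<Psi> ` (A \<rightarrow>\<^sub>E A))" using finite_PiE[OF fin, of "\<lambda>_. A"] fin by simp
qed

text \<open>\<open>T\<close> yields an operation with neutral elements, for which \<open>Z\<close>
  acts as zero. Lifted pairs for the finitely many classes are added up one after the other to
  obtain a common base on \<open>Y\<close>.\<close>

lemma cover_e_if_addition:
  assumes Y: "\<not> sep Y" and T: "T \<in> op2" and ab: "a \<in> U" "b \<in> U"
    and left: "inj_on (\<lambda>x. T x a) U" and right: "inj_on (T b) U"
  shows "cover Y e"
proof -
  define \<phi> where "\<phi> = (\<lambda>x. T x a)"
  define \<psi> where "\<psi> = T a"
  have \<phi>: "\<phi> \<in> pol1" "\<phi> ` U \<subseteq> U" "inj_on \<phi> U"
    using pol1_comp2[OF op2_pol2[OF T] pol1_id pol1_const[OF U_A[OF ab(1)]]] op2_val[OF T _ ab(1)] left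
    by (auto simp: \<phi>_def)
  have \<psi>: "\<psi> \<in> pol1" "\<psi> ` U \<subseteq> U" "inj_on \<psi> U"
    using pol1_comp2[OF op2_pol2[OF T] pol1_const[OF U_A[OF ab(1)]] pol1_id] op2_val[OF T ab(1)]
      inj_param[OF T ab(2,1) right] by (auto simp: \<psi>_def)
  \<comment> \<open>The principal isotope that turns a quasigroup into a loop: undoing the two
    translations by \<open>a\<close> makes \<open>T a a\<close>, which is both \<open>l\<close> and
    \<open>r\<close>, neutral.\<close>
  define S where "S = (\<lambda>x y. T ((\<phi> ^^ (K - 1)) x) ((\<psi> ^^ (K - 1)) y))"
  have S: "S \<in> pol2"
    unfolding S_def
    by (rule pol2_comp2[OF op2_pol2[OF T] pol2_left[OF pol1_funpow[OF \<phi>(1)]] pol2_right[OF pol1_funpow[OF \<psi>(1)]]])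
  have step: "f ((f ^^ (K - 1)) x) = (f ^^ K) x" for f :: "'a \<Rightarrow> 'a" and x
    using K(1) by (metis Suc_diff_1 comp_apply funpow.simps(2))
  define l where "l = \<phi> a"
  define r where "r = \<psi> a"
  have lr: "l \<in> U" "r \<in> U" using \<phi>(2) \<psi>(2) ab(1) by (auto simp: l_def r_def)
  have S_r: "S x r = x" if "x \<in> U" for x
  proof -
    have "(\<psi> ^^ (K - 1)) r = a" using K_inj[OF \<psi>(2,3) ab(1)] funpow_K[of \<psi> a] by (simp add: r_def)
    then have "S x r = \<phi> ((\<phi> ^^ (K - 1)) x)" by (simp add: S_def \<phi>_def)
    then show ?thesis using K_inj[OF \<phi>(2,3) that] step[of \<phi> x] by simp
  qed
  have S_l: "S l y = y" if "y \<in> U" for y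
  proof -
    have "(\<phi> ^^ (K - 1)) l = a" using K_inj[OF \<phi>(2,3) ab(1)] funpow_K[of \<phi> a] by (simp add: l_def)
    then have "S l y = \<psi> ((\<psi> ^^ (K - 1)) y)" by (simp add: S_def \<psi>_def)
    then show ?thesis using K_inj[OF \<psi>(2,3) that] step[of \<psi> y] by simp
  qed
  have add_Z: "\<Psi> (\<lambda>x. S (e (p x)) (e (q x))) = \<Psi> (\<lambda>x. e (p x))"
    if p: "p \<in> pol1" and q: "\<Psi> q = Z" for p q
  proof -
    have G: "(\<lambda>y x. S (e (p x)) (e y)) \<in> pol2"
      by (rule pol2_comp2[OF S pol2_right[OF pol1_comp[OF e p]] pol2_left[OF e]])
    have "\<Psi> (\<lambda>x. S (e (p x)) (e (q x))) = \<Psi> (\<lambda>x. S (e (p x)) (e r))"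
      using \<Psi>_cong[OF G, of q "\<lambda>_. r"] q \<Psi>_const[OF U_A[OF lr(2)]] by simp
    also have "\<dots> = \<Psi> (\<lambda>x. e (p x))"
      by (rule \<Psi>_agree) (use S_r e_fix[OF lr(2)] e_U pol1_val[OF p] U_A in simp)
    finally show ?thesis .
  qed
  have Z_add: "\<Psi> (\<lambda>x. S (e (p x)) (e (q x))) = \<Psi> (\<lambda>x. e (q x))"
    if p: "\<Psi> p = Z" and q: "q \<in> pol1" for p q
  proof -
    have G: "(\<lambda>y x. S (e y) (e (q x))) \<in> pol2"
      by (rule pol2_comp2[OF S pol2_left[OF e] pol2_right[OF pol1_comp[OF e q]]])
    have "\<Psi> (\<lambda>x. S (e (p x)) (e (q x))) = \<Psi> (\<lambda>x. S (e l) (e (q x)))"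
      using \<Psi>_cong[OF G, of p "\<lambda>_. l"] p \<Psi>_const[OF U_A[OF lr(1)]] by simp
    also have "\<dots> = \<Psi> (\<lambda>x. e (q x))"
      by (rule \<Psi>_agree) (use S_l e_fix[OF lr(1)] e_U pol1_val[OF q] U_A in simp)
    finally show ?thesis .
  qed
  have e_e: "\<Psi> (\<lambda>x. e (p x)) = \<Psi> (\<lambda>x. e (s x))" if "\<Psi> p = \<Psi> (\<lambda>x. e (s x))" "s \<in> pol1" for p s
  proof -
    have "\<Psi> (\<lambda>x. e (p x)) = \<Psi> (\<lambda>x. e (e (s x)))" by (rule \<Psi>_cong1[OF e that(1)])
    also have "\<dots> = \<Psi> (\<lambda>x. e (s x))"
      by (rule \<Psi>_agree) (use e_idem pol1_val[OF that(2)] U_A in simp)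
    finally show ?thesis .
  qed
  \<comment> \<open>Induction on a finite set of classes. The new base is \<open>add p0 p1'\<close>,
    with \<open>p1'\<close> from the lifted pair for the new class \<open>d\<close>; old classes are
    represented by \<open>add p p1'\<close> and \<open>d\<close> by
    \<open>add p0 p1\<close>.\<close>
  have "\<exists>p0\<in>pol1. \<Psi> p0 = Z \<and> (\<forall>s\<in>pol1. \<Psi> (\<lambda>x. e (s x)) \<in> \<D> \<longrightarrow>
      (\<exists>p\<in>pol1. (\<forall>x\<in>Y. p x = p0 x) \<and> \<Psi> p = \<Psi> (\<lambda>x. e (s x))))" if "finite \<D>" for \<D>
    using that
  proof (induction rule: finite_induct)
    case empty
    then show ?case using pol1_const[OF U_A[OF ab(1)]] \<Psi>_const[OF U_A[OF ab(1)]] by blast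
  next
    case (insert d \<D>)
    then obtain p0 where p0: "p0 \<in> pol1" "\<Psi> p0 = Z"
      and IH: "\<And>s. s \<in> pol1 \<Longrightarrow> \<Psi> (\<lambda>x. e (s x)) \<in> \<D> \<Longrightarrow>
        \<exists>p\<in>pol1. (\<forall>x\<in>Y. p x = p0 x) \<and> \<Psi> p = \<Psi> (\<lambda>x. e (s x))" by blast
    show ?case
    proof (cases "\<exists>t\<in>pol1. \<Psi> (\<lambda>x. e (t x)) = d")
      case False
      have "\<exists>p\<in>pol1. (\<forall>x\<in>Y. p x = p0 x) \<and> \<Psi> p = \<Psi> (\<lambda>x. e (s x))"
        if "s \<in> pol1" "\<Psi> (\<lambda>x. e (s x)) \<in> insert d \<D>" for s
        using IH[OF that(1)] that False by blast
      then show ?thesis using p0 by blast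
    next
      case True
      then obtain t where t: "t \<in> pol1" "\<Psi> (\<lambda>x. e (t x)) = d" by blast
      obtain p1 p1' where p1: "p1 \<in> pol1" "p1' \<in> pol1" "\<forall>x\<in>Y. p1 x = p1' x"
        "\<Psi> p1 = \<Psi> (\<lambda>x. e (t x))" "\<Psi> p1' = Z"
        using lift_pair[OF Y pol1_comp[OF e t(1)]] by blast
      define add :: "('a \<Rightarrow> 'a) \<Rightarrow> ('a \<Rightarrow> 'a) \<Rightarrow> 'a \<Rightarrow> 'a"
        where "add = (\<lambda>p q x. S (e (p x)) (e (q x)))"
      have add: "add p q \<in> pol1" if "p \<in> pol1" "q \<in> pol1" for p q
        unfolding add_def by (rule pol1_comp2[OF S pol1_comp[OF e that(1)] pol1_comp[OF e that(2)]])
      have add_eq: "\<forall>x\<in>Y. add p q x = add p0 p1' x" if "\<forall>x\<in>Y. p x = p0 x" "\<forall>x\<in>Y. q x = p1' x" for p q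
        using that by (simp add: add_def)
      have "\<exists>p\<in>pol1. (\<forall>x\<in>Y. p x = add p0 p1' x) \<and> \<Psi> p = \<Psi> (\<lambda>x. e (s x))"
        if s: "s \<in> pol1" "\<Psi> (\<lambda>x. e (s x)) \<in> insert d \<D>" for s
      proof (cases "\<Psi> (\<lambda>x. e (s x)) = d")
        case True
        have "\<Psi> (add p0 p1) = \<Psi> (\<lambda>x. e (t x))"
          unfolding add_def Z_add[OF p0(2) p1(1)] by (rule e_e[OF p1(4) t(1)])
        then show ?thesis
          using add[OF p0(1) p1(1)] add_eq[of p0 p1] p1(3) True t(2) by blast
      next
        case False
        then obtain p where p: "p \<in> pol1" "\<forall>x\<in>Y. p x = p0 x" "\<Psi> p = \<Psi> (\<lambda>x. e (s x))"
          using IH[OF s(1)] s(2) by blast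
        have "\<Psi> (add p p1') = \<Psi> (\<lambda>x. e (s x))"
          unfolding add_def add_Z[OF p(1) p1(5)] by (rule e_e[OF p(3) s(1)])
        then show ?thesis
          using add[OF p(1) p1(2)] add_eq[OF p(2), of p1'] by blast
      qed
      moreover have "\<Psi> (add p0 p1') = Z"
        unfolding add_def add_Z[OF p0(1) p1(5)] by (rule \<Psi>_pol1_Z[OF e p0(2)])
      ultimately show ?thesis using add[OF p0(1) p1(2)] by blast
    qed
  qed
  from this[OF finite_range_\<Psi>] obtain p0 where "p0 \<in> pol1"
    "\<And>s. s \<in> pol1 \<Longrightarrow> \<Psi> (\<lambda>x. e (s x)) \<in> \<Psi> ` pol1 \<Longrightarrow>
      \<exists>p\<in>pol1. (\<forall>x\<in>Y. p x = p0 x) \<and> \<Psi> p = \<Psi> (\<lambda>x. e (s x))" by blast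
  then show ?thesis
    using pol1_comp[OF e] unfolding cover_def by blast
qed

text \<open>The parts of \<open>V\<close> and \<open>W\<close> differ by the permutation \<phi> of
  \<open>U\<close> and a change of parameter. Since the two parts are never both injective, they
  determine the diagonal by \<open>diag_inj_iff\<close>.\<close>

lemma \<Psi>_e_unit_if_no_addition:
  assumes no_add: "\<And>T a b. T \<in> op2 \<Longrightarrow> a \<in> U \<Longrightarrow> b \<in> U \<Longrightarrow> \<not> (inj_on (\<lambda>x. T x a) U \<and> inj_on (T b) U)"
    and s: "s \<in> pol1" and u: "unit s"
  shows "\<Psi> (\<lambda>x. e (s x)) = \<Psi> e"
proof -
  obtain a where a: "a \<in> U" using ex_U by blast
  have "inj_on (\<lambda>x. e (T (e (s x)) x)) U \<longleftrightarrow> inj_on (\<lambda>x. e (T (e x) x)) U" if T: "T \<in> pol2" for T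
  proof -
    define W where "W = (\<lambda>y x. e (T (e y) x))"
    define V where "V = (\<lambda>y x. e (T (e (s y)) x))"
    have W: "W \<in> op2"
      unfolding W_def by (rule op2_e[OF pol2_comp2[OF T pol2_left[OF e] pol2_right[OF pol1_id]]])
    have V: "V \<in> op2"
      unfolding V_def
      by (rule op2_e[OF pol2_comp2[OF T pol2_left[OF pol1_comp[OF e s]] pol2_right[OF pol1_id]]])
    define \<phi> where "\<phi> = (\<lambda>x. e (s x))"
    have \<phi>U: "\<phi> ` U \<subseteq> U" using e_U pol1_val[OF s] U_A by (auto simp: \<phi>_def)
    have \<phi>_inj: "inj_on \<phi> U" using u by (simp add: unit_def \<phi>_def)
    have V_W: "V y x = W (\<phi> y) x" if "y \<in> U" for x y
      using e_idem pol1_val[OF s] U_A[OF that] by (simp add: V_def W_def \<phi>_def)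
    have \<phi>_onto: "\<phi> ` U = U"
      using \<phi>U \<phi>_inj finite_U by (simp add: endo_inj_surj)
    have left: "inj_on (\<lambda>y. V y a) U \<longleftrightarrow> inj_on (\<lambda>y. W y a) U"
    proof -
      have "inj_on (\<lambda>y. V y a) U \<longleftrightarrow> inj_on ((\<lambda>y. W y a) \<circ> \<phi>) U"
        by (rule inj_on_cong) (simp add: V_W)
      also have "\<dots> \<longleftrightarrow> inj_on (\<lambda>y. W y a) U"
        using comp_inj_on_iff[OF \<phi>_inj, of "\<lambda>y. W y a"] \<phi>_onto by simp
      finally show ?thesis .
    qed
    have right: "inj_on (V a) U \<longleftrightarrow> inj_on (W a) U"
    proof -
      have \<phi>a: "\<phi> a \<in> U" using \<phi>U a by blast
      have "V a = W (\<phi> a)" using V_W[OF a] by blast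
      then show ?thesis using inj_param[OF W \<phi>a a] inj_param[OF W a \<phi>a] by metis
    qed
    have "inj_on (\<lambda>x. V x x) U \<longleftrightarrow> inj_on (\<lambda>x. W x x) U"
    proof (cases "inj_on (\<lambda>y. W y a) U")
      case True
      then have "\<not> inj_on (W a) U" "\<not> inj_on (V a) U"
        using no_add[OF W a a] right by blast+
      then show ?thesis
        using diag_inj_iff[OF op2_swap[OF V] a a] diag_inj_iff[OF op2_swap[OF W] a a] left by simp
    next
      case False
      then show ?thesis
        using diag_inj_iff[OF V a a] diag_inj_iff[OF W a a] left right by simp
    qed
    then show ?thesis by (simp add: V_def W_def)
  qed
  then show ?thesis by (auto simp: \<Psi>_def unit_def)
qed

text \<open>Without an addition the maps \<open>e \<circ> s\<close> have only the classes of
  \<open>e\<close> and \<open>Z\<close>, and one lifted pair represents both.\<close>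

lemma cover_e:
  assumes Y: "\<not> sep Y"
  shows "cover Y e"
proof (cases "\<exists>T\<in>op2. \<exists>a\<in>U. \<exists>b\<in>U. inj_on (\<lambda>x. T x a) U \<and> inj_on (T b) U")
  case True
  then show ?thesis using cover_e_if_addition[OF Y] by blast
next
  case False
  obtain p p' where p: "p \<in> pol1" "p' \<in> pol1" "\<forall>x\<in>Y. p x = p' x" "\<Psi> p = \<Psi> e" "\<Psi> p' = Z"
    using lift_pair[OF Y e] by blast
  have "\<exists>q\<in>pol1. (\<forall>x\<in>Y. q x = p' x) \<and> \<Psi> q = \<Psi> (\<lambda>x. e (s x))" if s: "s \<in> pol1" for s
  proof (cases "unit s")
    case True
    then have "\<Psi> (\<lambda>x. e (s x)) = \<Psi> e" using \<Psi>_e_unit_if_no_addition[OF _ s] False by blast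
    then show ?thesis using p by (intro bexI[of _ p]) auto
  next
    case False
    then have "\<Psi> (\<lambda>x. e (s x)) = Z" by (rule \<Psi>_e_eq_Z[OF s])
    then show ?thesis using p by (intro bexI[of _ p']) auto
  qed
  then show ?thesis using p(2) unfolding cover_def by blast
qed

text \<open>Unless only the class \<open>Z\<close> occurs, \<open>h \<circ> s\<close> is injective
  on \<open>U\<close> for some \<open>s\<close>, and by the bound on the rank its values there
  exhaust the range of \<open>h\<close>. On that range \<open>e \<circ> f\<close> has the polynomial
  left inverse \<open>k\<close>, which carries the covering for \<open>e\<close> over to
  \<open>h\<close>.\<close>

lemma cover_rank:
  assumes Y: "\<not> sep Y" and h: "h \<in> pol1" and rank: "card (h ` A) \<le> c"
  shows "cover Y h"
proof (cases "\<forall>s\<in>pol1. \<Psi> (\<lambda>x. h (s x)) = Z")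
  case True
  obtain a where a: "a \<in> A" using ex_U U_A by blast
  show ?thesis
    unfolding cover_def
    by (intro bexI[of _ "\<lambda>_. a"] ballI) (use True pol1_const[OF a] \<Psi>_const[OF a] in auto)
next
  case False
  then obtain s where s: "s \<in> pol1" "\<Psi> (\<lambda>x. h (s x)) \<noteq> Z" by blast
  obtain f where f: "f \<in> pol1" "unit (\<lambda>x. f (h (s x)))"
    using \<Psi>_eq_Z_if_no_unit[OF pol1_comp[OF h s(1)]] s(2) by blast
  define \<phi> where "\<phi> = (\<lambda>x. e (f (h (s x))))"
  have \<phi>: "\<phi> \<in> pol1"
    unfolding \<phi>_def by (rule pol1_comp[OF e pol1_comp[OF f(1) pol1_comp[OF h s(1)]]])
  have \<phi>U: "\<phi> ` U \<subseteq> U"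
    using pol1_val[OF pol1_comp[OF f(1) pol1_comp[OF h s(1)]]] U_A e_U by (auto simp: \<phi>_def)
  have \<phi>_inj: "inj_on \<phi> U" using f(2) by (simp add: unit_def \<phi>_def)
  then have "inj_on (\<lambda>x. h (s x)) U"
    using inj_on_imageI2[of "\<lambda>y. e (f y)" "\<lambda>x. h (s x)" U] by (simp add: \<phi>_def comp_def)
  then have "card ((\<lambda>x. h (s x)) ` U) = c" using card_image card_U by metis
  moreover have "(\<lambda>x. h (s x)) ` U \<subseteq> h ` A" using pol1_val[OF s(1)] U_A by auto
  ultimately have image: "(\<lambda>x. h (s x)) ` U = h ` A"
    using card_seteq[of "h ` A" "(\<lambda>x. h (s x)) ` U"] fin rank by simp
  define k where "k = (\<lambda>y. h (s ((\<phi> ^^ (K - 1)) y)))"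
  have k: "k \<in> pol1"
    unfolding k_def by (rule pol1_comp[OF h pol1_comp[OF s(1) pol1_funpow[OF \<phi>]]])
  have k_e_f: "k (e (f y)) = y" if y: "y \<in> h ` A" for y
  proof -
    from y image obtain x where x: "x \<in> U" "y = h (s x)" by blast
    then have "k (e (f y)) = h (s ((\<phi> ^^ K) x))"
      unfolding funpow_K k_def by (simp add: \<phi>_def)
    then show ?thesis using K_inj[OF \<phi>U \<phi>_inj x(1)] x(2) by simp
  qed
  obtain p0 where p0: "p0 \<in> pol1" and cov: "\<And>t. t \<in> pol1 \<Longrightarrow>
      \<exists>p\<in>pol1. (\<forall>x\<in>Y. p x = p0 x) \<and> \<Psi> p = \<Psi> (\<lambda>x. e (t x))"
    using cover_e[OF Y] unfolding cover_def by blast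
  have "\<exists>p\<in>pol1. (\<forall>x\<in>Y. p x = k (p0 x)) \<and> \<Psi> p = \<Psi> (\<lambda>x. h (t x))" if t: "t \<in> pol1" for t
  proof -
    obtain p where p: "p \<in> pol1" "\<forall>x\<in>Y. p x = p0 x" "\<Psi> p = \<Psi> (\<lambda>x. e (f (h (t x))))"
      using cov[OF pol1_comp[OF f(1) pol1_comp[OF h t]]] by blast
    have "\<Psi> (\<lambda>x. k (p x)) = \<Psi> (\<lambda>x. k (e (f (h (t x)))))" by (rule \<Psi>_cong1[OF k p(3)])
    also have "\<dots> = \<Psi> (\<lambda>x. h (t x))"
      by (rule \<Psi>_agree) (use k_e_f pol1_val[OF t] U_A in simp)
    finally show ?thesis using pol1_comp[OF k p(1)] p(2) by (intro bexI[of _ "\<lambda>x. k (p x)"]) auto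
  qed
  then show ?thesis using pol1_comp[OF k p0] unfolding cover_def by blast
qed

text \<open>Coverings survive the rules of \<open>small\<close> because \<open>\<Psi>\<close>
  respects polynomials and \<open>eqv\<close>. The case of interest is the identity map.\<close>

lemma cover_small:
  assumes Y: "\<not> sep Y" and "h \<in> small (Suc c)"
  shows "cover Y h"
  using assms(2)
proof (induction rule: small.induct)
  case (rank h)
  then show ?case using cover_rank[OF Y] by simp
next
  case (comp f h)
  have h: "h i \<in> pol1" for i using comp(2) small_pol1 by blast
  have "\<forall>i. \<exists>p0. p0 \<in> pol1 \<and> (\<forall>s\<in>pol1. \<exists>p\<in>pol1. (\<forall>x\<in>Y. p x = p0 x) \<and> \<Psi> p = \<Psi> (\<lambda>x. h i (s x)))"
    using comp(2) unfolding cover_def by blast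
  then obtain p0 where p0: "\<And>i. p0 i \<in> pol1" and cov: "\<And>i s. s \<in> pol1 \<Longrightarrow>
      \<exists>p\<in>pol1. (\<forall>x\<in>Y. p x = p0 i x) \<and> \<Psi> p = \<Psi> (\<lambda>x. h i (s x))"
    using choice[of "\<lambda>i p0. p0 \<in> pol1 \<and> (\<forall>s\<in>pol1. \<exists>p\<in>pol1. (\<forall>x\<in>Y. p x = p0 x) \<and> \<Psi> p = \<Psi> (\<lambda>x. h i (s x)))"]
    by blast
  have pol: "(\<lambda>x. f (\<lambda>i. p i x)) \<in> pol1" if "\<And>i. p i \<in> pol1" for p
    using pol_subst[OF comp(1), of "\<lambda>i \<sigma>. p i (\<sigma> 0)"] that by (simp add: pol1_def)
  have "\<exists>p\<in>pol1. (\<forall>x\<in>Y. p x = f (\<lambda>i. p0 i x)) \<and> \<Psi> p = \<Psi> (\<lambda>x. f (\<lambda>i. h i (s x)))"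
    if s: "s \<in> pol1" for s
  proof -
    have "\<forall>i. \<exists>p. p \<in> pol1 \<and> (\<forall>x\<in>Y. p x = p0 i x) \<and> \<Psi> p = \<Psi> (\<lambda>x. h i (s x))"
      using cov[OF s] by blast
    then obtain p where p: "\<And>i. p i \<in> pol1" "\<And>i x. x \<in> Y \<Longrightarrow> p i x = p0 i x"
      "\<And>i. \<Psi> (p i) = \<Psi> (\<lambda>x. h i (s x))"
      using choice[of "\<lambda>i p. p \<in> pol1 \<and> (\<forall>x\<in>Y. p x = p0 i x) \<and> \<Psi> p = \<Psi> (\<lambda>x. h i (s x))"] by blast
    have "\<Psi> (\<lambda>x. f (\<lambda>i. p i x)) = \<Psi> (\<lambda>x. f (\<lambda>i. h i (s x)))"
      using \<Psi>_pol[OF comp(1), of p "\<lambda>i x. h i (s x)"] p(1,3) pol1_comp[OF h s] by blast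
    moreover have "\<forall>x\<in>Y. f (\<lambda>i. p i x) = f (\<lambda>i. p0 i x)" using p(2) by simp
    ultimately show ?thesis by (intro bexI[OF _ pol[of p, OF p(1)]] conjI)
  qed
  then show ?case unfolding cover_def by (rule bexI[OF ballI pol[of p0, OF p0]])
next
  case (eqv h h')
  have h: "h \<in> pol1" by (rule small_pol1[OF eqv(1)])
  have "\<Psi> (\<lambda>x. h (s x)) = \<Psi> (\<lambda>x. h' (s x))" if "s \<in> pol1" for s
    by (rule \<Psi>_eqv[OF eqv_comp[OF eqv(3) that] pol1_comp[OF h that] pol1_comp[OF eqv(2) that]])
  then show ?case using eqv(4) unfolding cover_def by simp
qed

text \<open>A point is removed from a separating set of least size. There is such a point, since
  over the empty set the identity would get the class of a constant.\<close>

lemma critical_set: "\<exists>X x0. sep X \<and> x0 \<in> X \<and> \<not> sep (X - {x0})"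
proof -
  have "sep A" unfolding sep_def using \<Psi>_agree U_A by metis
  then obtain X where X: "X \<subseteq> A \<and> sep X" and least: "\<And>Y. Y \<subseteq> A \<and> sep Y \<Longrightarrow> card X \<le> card Y"
    using ex_has_least_nat[of "\<lambda>X. X \<subseteq> A \<and> sep X" A card] by blast
  have "\<not> sep {}"
  proof
    assume "sep {}"
    obtain a where a: "a \<in> A" using ex_U U_A by blast
    show False
      using sepD[OF \<open>sep {}\<close> pol1_id pol1_const[OF a]] \<Psi>_const[OF a] \<Psi>_neq_Z_if_unit[OF unit_id] by simp
  qed
  then obtain x0 where x0: "x0 \<in> X" using X by fastforce
  have "card (X - {x0}) < card X"
    using x0 X fin by (meson card_Diff1_less finite_subset)
  then have "\<not> sep (X - {x0})" using least[of "X - {x0}"] X by fastforce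
  then show ?thesis using X x0 by blast
qed

theorem not_in_good_variety:
  assumes good: "good_variety F ar \<Sigma> TYPE('a)" and V: "in_variety F ar \<Sigma> A I"
  shows False
proof -
  obtain X x0 where X: "sep X" "x0 \<in> X" "\<not> sep (X - {x0})" using critical_set by blast
  obtain p0 where p0: "\<And>s. s \<in> pol1 \<Longrightarrow> \<exists>p\<in>pol1. (\<forall>x\<in>X - {x0}. p x = p0 x) \<and> \<Psi> p = \<Psi> s"
    using cover_small[OF X(3) id_small] unfolding cover_def by blast
  \<comment> \<open>All representatives agree with \<open>p0\<close> on \<open>X\<close> except
    perhaps at \<open>x0\<close>. As \<open>X\<close> is separating, the value at \<open>x0\<close>
    alone names the class, and the classes embed into the carrier type.\<close>
  define pick where "pick d = (SOME p. p \<in> pol1 \<and> (\<forall>x\<in>X - {x0}. p x = p0 x) \<and> \<Psi> p = d)" for d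
  have pick: "pick d \<in> pol1" "\<And>x. x \<in> X - {x0} \<Longrightarrow> pick d x = p0 x" "\<Psi> (pick d) = d"
    if "d \<in> \<Psi> ` pol1" for d
  proof -
    have "\<exists>p. p \<in> pol1 \<and> (\<forall>x\<in>X - {x0}. p x = p0 x) \<and> \<Psi> p = d" using that p0 by blast
    from someI_ex[OF this] show "pick d \<in> pol1" "\<And>x. x \<in> X - {x0} \<Longrightarrow> pick d x = p0 x" "\<Psi> (pick d) = d"
      unfolding pick_def by blast+
  qed
  define \<Phi> where "\<Phi> s = pick (\<Psi> s) x0" for s
  have \<Phi>: "\<Phi> p = \<Phi> q \<longleftrightarrow> \<Psi> p = \<Psi> q" if "p \<in> pol1" "q \<in> pol1" for p q
  proof
    assume eq: "\<Phi> p = \<Phi> q"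
    have d: "\<Psi> p \<in> \<Psi> ` pol1" "\<Psi> q \<in> \<Psi> ` pol1" using that by auto
    have "pick (\<Psi> p) x = pick (\<Psi> q) x" if "x \<in> X" for x
      using eq pick(2)[OF d(1), of x] pick(2)[OF d(2), of x] that by (cases "x = x0") (auto simp: \<Phi>_def)
    then show "\<Psi> p = \<Psi> q"
      using \<Psi>_eq_if_sep[OF X(1) pick(1)[OF d(1)] pick(1)[OF d(2)]] pick(3)[OF d(1)] pick(3)[OF d(2)] by simp
  qed (simp add: \<Phi>_def)
  interpret subpower_image F ar \<Sigma> A I A pol1 \<Phi>
  proof
    show "wf_identities F ar \<Sigma>" using good by (simp add: good_variety_def)
    show "in_variety F ar \<Sigma> A I" by (rule V)
    show "pol1 \<noteq> {}" using pol1_id by blast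
    show "p x \<in> A" if "p \<in> pol1" "x \<in> A" for p x using pol1_val[OF that] .
    show "(\<lambda>x. I f (map (\<lambda>p. p x) ps)) \<in> pol1" if "f \<in> F" "length ps = ar f" "set ps \<subseteq> pol1" for f ps
    proof -
      have "(\<lambda>\<sigma>. I f (map (\<lambda>g. g \<sigma>) (map (\<lambda>p \<sigma>. p (\<sigma> 0)) ps))) \<in> pol"
        by (rule pol.op) (use that in \<open>auto simp: pol1_def\<close>)
      then show ?thesis by (simp add: pol1_def comp_def)
    qed
    show "\<Phi> p = \<Phi> q" if "\<And>x. x \<in> A \<Longrightarrow> p x = q x" for p q
      using \<Psi>_agree[of p q] that U_A by (simp add: \<Phi>_def)
    fix f rs k p q
    assume f: "f \<in> F" and rs: "length rs = ar f" "set rs \<subseteq> pol1" and pq: "p \<in> pol1" "q \<in> pol1" "\<Phi> p = \<Phi> q"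
    have "\<Psi> (\<lambda>x. I f (map (\<lambda>r. r x) (rs[k := p]))) = \<Psi> (\<lambda>x. I f (map (\<lambda>r. r x) (rs[k := q])))"
      using \<Psi>_cong[OF pol_op_update[OF f rs, of k], of p q] \<Phi>[OF pq(1,2)] pq(3) by (simp add: map_update)
    then show "\<Phi> (\<lambda>x. I f (map (\<lambda>r. r x) (rs[k := p]))) = \<Phi> (\<lambda>x. I f (map (\<lambda>r. r x) (rs[k := q])))"
      by (simp add: \<Phi>_def)
  qed
  obtain a where a: "a \<in> A" using ex_U U_A by blast
  \<comment> \<open>Operations send constants to constants, so their class is idempotent;
    semidegeneracy then puts the identity, which is a unit, into it.\<close>
  have "\<Phi> (\<lambda>x. x) = \<Phi> (\<lambda>_. a)"
  proof (rule trivial_if_pointed[OF good, where e = "\<lambda>_. a"])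
    show "(\<lambda>_. a) \<in> pol1" "(\<lambda>x. x) \<in> pol1" using pol1_const[OF a] pol1_id by auto
    show "\<Phi> (\<lambda>x. I f (replicate (ar f) a)) = \<Phi> (\<lambda>_. a)" if "f \<in> F" for f
    proof -
      have "I f (replicate (ar f) a) \<in> A"
        using op_closed[OF that, of "replicate (ar f) a"] a by (auto simp: set_replicate_conv_if)
      then show ?thesis using \<Psi>_const a by (simp add: \<Phi>_def)
    qed
  qed
  then have "\<Psi> (\<lambda>x. x) = Z" using \<Phi>[OF pol1_id pol1_const[OF a]] \<Psi>_const[OF a] by simp
  then show False using \<Psi>_neq_Z_if_unit[OF unit_id] by simp
qed

end

theorem central_trivial:
  assumes good: "good_variety F ar \<Sigma> TYPE('a)" and V: "in_variety F ar \<Sigma> (A :: 'a set) I"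
    and \<alpha>: "\<alpha> \<in> Con F ar A I" and central: "algebra.central F ar A I \<alpha>" and uv: "(u, v) \<in> \<alpha>"
  shows "u = v"
proof -
  interpret algebra F ar A I
    by unfold_locales (use V in \<open>simp add: in_variety_def\<close>)
  show ?thesis
  proof (cases "finite (UNIV :: 'a set)")
    case False
    then show ?thesis using central_trivial_infinite[OF _ good V \<alpha> central uv] by blast
  next
    case True
    show ?thesis
    proof (rule ccontr)
      assume "u \<noteq> v"
      then interpret central_congruence F ar A I \<alpha>
        using True \<alpha> central uv finite_subset[of A UNIV] by unfold_locales auto
      obtain c where c: "c \<ge> 2" "(\<lambda>x. x) \<notin> small c" "(\<lambda>x. x) \<in> small (Suc c)"
        using critical_rank by blast
      obtain e where e: "e \<in> pol1" "e \<notin> small c" "card (e ` A) = c" "\<forall>x\<in>A. e (e x) = e x"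
        using nonsmall_idempotent[OF c(2,3)] by blast
      interpret critical_retract F ar A I \<alpha> c e
        using c e by unfold_locales auto
      show False using not_in_good_variety[OF good V] .
    qed
  qed
qed

section \<open>Complemented congruences\<close>

text \<open>The carrier \<open>A // \<delta>\<close> has the wrong type for the hypothesis on the
  variety; choosing one representative in each block keeps quotients inside
  \<open>'a\<close>.\<close>

definition con_rep :: "'a rel \<Rightarrow> 'a \<Rightarrow> 'a" where
  "con_rep \<delta> x = (SOME y. (x, y) \<in> \<delta>)"

lemma con_rep:
  assumes "\<delta> \<in> Con F ar A I" "x \<in> A"
  shows "(x, con_rep \<delta> x) \<in> \<delta>"
  unfolding con_rep_def by (rule someI[of _ x]) (rule Con_refl[OF assms])

lemma con_rep_A: "\<delta> \<in> Con F ar A I \<Longrightarrow> x \<in> A \<Longrightarrow> con_rep \<delta> x \<in> A"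
  using con_rep Con_subset by fastforce

lemma con_rep_eq_iff:
  assumes \<delta>: "\<delta> \<in> Con F ar A I" and "x \<in> A" "y \<in> A"
  shows "con_rep \<delta> x = con_rep \<delta> y \<longleftrightarrow> (x, y) \<in> \<delta>"
proof
  assume "con_rep \<delta> x = con_rep \<delta> y"
  then show "(x, y) \<in> \<delta>"
    using con_rep[OF assms(1,2)] con_rep[OF assms(1,3)] Con_sym[OF \<delta>] Con_trans[OF \<delta>] by metis
next
  assume xy: "(x, y) \<in> \<delta>"
  have "(x, z) \<in> \<delta> \<longleftrightarrow> (y, z) \<in> \<delta>" for z
    using xy Con_sym[OF \<delta>] Con_trans[OF \<delta>] by blast
  then show "con_rep \<delta> x = con_rep \<delta> y" by (simp add: con_rep_def)
qed

text \<open>A quotient is an image of the first power of \<open>A\<close>, indexed by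
  \<open>unit\<close>.\<close>

lemma quotient_subpower_image:
  fixes A :: "'a set"
  assumes wf: "wf_identities F ar \<Sigma>" and V: "in_variety F ar \<Sigma> A I" and \<delta>: "\<delta> \<in> Con F ar A I"
  shows "subpower_image F ar \<Sigma> A I (UNIV :: unit set) {p. p () \<in> A} (\<lambda>p. con_rep \<delta> (p ()))"
proof
  have alg: "algebra F ar A I" using V by (simp add: algebra_def in_variety_def)
  show "wf_identities F ar \<Sigma>" "in_variety F ar \<Sigma> A I" by (rule wf, rule V)
  show "{p :: unit \<Rightarrow> 'a. p () \<in> A} \<noteq> {}"
  proof -
    obtain a where "a \<in> A" using alg unfolding algebra_def is_alg_def by blast
    then have "(\<lambda>_. a) \<in> {p :: unit \<Rightarrow> 'a. p () \<in> A}" by simp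
    then show ?thesis by (metis empty_iff)
  qed
  show "p x \<in> A" if "p \<in> {p. p () \<in> A}" for p :: "unit \<Rightarrow> 'a" and x
    using that by simp
  show "(\<lambda>x. I f (map (\<lambda>p. p x) ps)) \<in> {p. p () \<in> A}"
    if "f \<in> F" "length ps = ar f" "set ps \<subseteq> {p. p () \<in> A}" for f and ps :: "(unit \<Rightarrow> 'a) list"
    using algebra.op_closed[OF alg that(1), of "map (\<lambda>p. p ()) ps"] that by auto
  show "con_rep \<delta> (p ()) = con_rep \<delta> (q ())" if "\<And>x. x \<in> UNIV \<Longrightarrow> p x = q x" for p q :: "unit \<Rightarrow> 'a"
    using that by simp
  fix f k and rs :: "(unit \<Rightarrow> 'a) list" and p q :: "unit \<Rightarrow> 'a"
  assume f: "f \<in> F" and rs: "length rs = ar f" "set rs \<subseteq> {p. p () \<in> A}" and k: "k < ar f"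
    and p: "p \<in> {p. p () \<in> A}" and q: "q \<in> {p. p () \<in> A}" and eq: "con_rep \<delta> (p ()) = con_rep \<delta> (q ())"
  have pq: "(p (), q ()) \<in> \<delta>" using con_rep_eq_iff[OF \<delta>] p q eq by simp
  have "(I f (map (\<lambda>r. r ()) (rs[k := p])), I f (map (\<lambda>r. r ()) (rs[k := q]))) \<in> \<delta>"
  proof (rule Con_compat[OF \<delta> f])
    fix i
    assume i: "i < ar f"
    have "(rs ! i) () \<in> A" using subsetD[OF rs(2) nth_mem[of i rs]] i rs(1) by simp
    then show "(map (\<lambda>r. r ()) (rs[k := p]) ! i, map (\<lambda>r. r ()) (rs[k := q]) ! i) \<in> \<delta>"
      using pq i rs(1) Con_refl[OF \<delta>, of "(rs ! i) ()"] by (cases "i = k") simp_all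
  qed (use rs in auto)
  then show "con_rep \<delta> (I f (map (\<lambda>r. r ()) (rs[k := p]))) = con_rep \<delta> (I f (map (\<lambda>r. r ()) (rs[k := q])))"
    using con_rep_eq_iff[OF \<delta>] Con_subset[OF \<delta>] by blast
qed

text \<open>Modulo \<delta>, on the set \<open>B\<close> of representatives, the two meets become
  trivial; the image of \<alpha> is then central, and \<open>central_trivial\<close>
  applies.\<close>

lemma two_complements_trivial_mod:
  assumes good: "good_variety F ar \<Sigma> TYPE('a)" and V: "in_variety F ar \<Sigma> (A :: 'a set) I"
    and con: "\<alpha> \<in> Con F ar A I" "\<beta> \<in> Con F ar A I" "\<gamma> \<in> Con F ar A I" "\<delta> \<in> Con F ar A I"
    and meet: "\<alpha> \<inter> \<beta> = \<delta>" "\<alpha> \<inter> \<gamma> = \<delta>" and join: "cjoin F ar A I \<beta> \<gamma> = Nabla A"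
  shows "\<alpha> \<subseteq> \<delta>"
proof -
  let ?\<Phi> = "\<lambda>p. con_rep \<delta> (p ())"
  let ?P = "{p :: unit \<Rightarrow> 'a. p () \<in> A}"
  have wf: "wf_identities F ar \<Sigma>" using good by (simp add: good_variety_def)
  interpret quot: subpower_image F ar \<Sigma> A I "UNIV :: unit set" ?P ?\<Phi>
    by (rule quotient_subpower_image[OF wf V con(4)])
  interpret algebra F ar A I using V by (simp add: algebra_def in_variety_def)
  define B where "B = con_rep \<delta> ` A"
  have image: "?\<Phi> ` ?P = B"
  proof
    show "B \<subseteq> ?\<Phi> ` ?P"
    proof
      fix b assume "b \<in> B"
      then obtain a where "a \<in> A" "b = con_rep \<delta> a" by (auto simp: B_def)
      then show "b \<in> ?\<Phi> ` ?P" by (intro image_eqI[of _ _ "\<lambda>_. a"]) auto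
    qed
  qed (auto simp: B_def)
  let ?J = quot.img_ops
  have VB: "in_variety F ar \<Sigma> B ?J" using quot.in_variety_image unfolding image .
  then interpret B: algebra F ar B ?J by (simp add: algebra_def in_variety_def)
  have BA: "x \<in> A" if "x \<in> B" for x using that con_rep_A[OF con(4)] by (auto simp: B_def)
  have rep_B: "con_rep \<delta> x = x" if x: "x \<in> B" for x
  proof -
    obtain a where a: "a \<in> A" "x = con_rep \<delta> a" using x by (auto simp: B_def)
    then show ?thesis using con_rep_eq_iff[OF con(4) a(1) BA[OF x]] con_rep[OF con(4) a(1)] by simp
  qed
  have J: "?J f xs = con_rep \<delta> (I f xs)" if "f \<in> F" "length xs = ar f" "set xs \<subseteq> B" for f xs
  proof -
    have "map ?\<Phi> (map (\<lambda>x _. x) xs) = xs" using that(3) rep_B by (simp add: comp_def subset_iff map_idI)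
    moreover have "set (map (\<lambda>x _. x) xs) \<subseteq> ?P" using that(3) BA by auto
    ultimately show ?thesis
      using quot.img_ops[OF that(1), of "map (\<lambda>x _. x) xs"] that(2) by (simp add: comp_def)
  qed
  have le: "\<delta> \<subseteq> \<alpha>" "\<delta> \<subseteq> \<beta>" "\<delta> \<subseteq> \<gamma>" using meet by auto
  have rep_rel: "(con_rep \<delta> x, con_rep \<delta> y) \<in> \<rho> \<longleftrightarrow> (x, y) \<in> \<rho>"
    if \<rho>: "\<rho> \<in> Con F ar A I" "\<delta> \<subseteq> \<rho>" and "x \<in> A" "y \<in> A" for \<rho> x y
  proof -
    have x: "(x, con_rep \<delta> x) \<in> \<rho>" and y: "(y, con_rep \<delta> y) \<in> \<rho>"
      using con_rep[OF con(4)] that by auto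
    show ?thesis
    proof
      assume "(con_rep \<delta> x, con_rep \<delta> y) \<in> \<rho>"
      from Con_trans[OF \<rho>(1) Con_trans[OF \<rho>(1) x this] Con_sym[OF \<rho>(1) y]] show "(x, y) \<in> \<rho>" .
    next
      assume "(x, y) \<in> \<rho>"
      from Con_trans[OF \<rho>(1) Con_trans[OF \<rho>(1) Con_sym[OF \<rho>(1) x] this] y]
      show "(con_rep \<delta> x, con_rep \<delta> y) \<in> \<rho>" .
    qed
  qed
  have restr: "\<rho> \<inter> B \<times> B \<in> Con F ar B ?J" if \<rho>: "\<rho> \<in> Con F ar A I" "\<delta> \<subseteq> \<rho>" for \<rho>
  proof (rule ConI)
    fix f xs ys
    assume f: "f \<in> F" and len: "length xs = ar f" "length ys = ar f" and B: "set xs \<subseteq> B" "set ys \<subseteq> B"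
      and rel: "\<forall>i<ar f. (xs ! i, ys ! i) \<in> \<rho> \<inter> B \<times> B"
    have A: "I f xs \<in> A" "I f ys \<in> A" using op_closed[OF f] len B BA by auto
    have "(I f xs, I f ys) \<in> \<rho>" using Con_compat[OF \<rho>(1) f len] rel by blast
    then have "(con_rep \<delta> (I f xs), con_rep \<delta> (I f ys)) \<in> \<rho>" using rep_rel[OF \<rho> A] by simp
    then show "(?J f xs, ?J f ys) \<in> \<rho> \<inter> B \<times> B"
      using J[OF f len(1) B(1)] J[OF f len(2) B(2)] A by (simp add: B_def)
  next
    show "(x, x) \<in> \<rho> \<inter> B \<times> B" if "x \<in> B" for x using Con_refl[OF \<rho>(1) BA[OF that]] that by simp
    show "(y, x) \<in> \<rho> \<inter> B \<times> B" if "(x, y) \<in> \<rho> \<inter> B \<times> B" for x y using that Con_sym[OF \<rho>(1)] by simp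
    show "(x, z) \<in> \<rho> \<inter> B \<times> B" if "(x, y) \<in> \<rho> \<inter> B \<times> B" "(y, z) \<in> \<rho> \<inter> B \<times> B" for x y z
      using that Con_trans[OF \<rho>(1), of x y z] by simp
  qed simp
  have Delta: "\<delta> \<inter> B \<times> B = Delta B"
  proof -
    have "x = y" if "(x, y) \<in> \<delta>" "x \<in> B" "y \<in> B" for x y
      using con_rep_eq_iff[OF con(4) BA BA, of x y] that rep_B by simp
    then show ?thesis using Con_refl[OF con(4)] BA by (auto simp: Delta_def)
  qed
  have join_B: "cjoin F ar B ?J (\<beta> \<inter> B \<times> B) (\<gamma> \<inter> B \<times> B) = Nabla B" (is "?\<rho> = _")
  proof -
    have \<rho>: "?\<rho> \<in> Con F ar B ?J"
      by (rule cjoin_Con[OF B.alg restr[OF con(2) le(2)] restr[OF con(3) le(3)]])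
    \<comment> \<open>The pullback of the join to \<open>A\<close> is a congruence above \<beta> and
      \<gamma>, hence the top; this avoids an elementwise description of joins.\<close>
    define \<sigma> where "\<sigma> = {(x, y) \<in> A \<times> A. (con_rep \<delta> x, con_rep \<delta> y) \<in> ?\<rho>}"
    have "\<sigma> \<in> Con F ar A I"
    proof (rule ConI)
      fix f xs ys
      assume f: "f \<in> F" and len: "length xs = ar f" "length ys = ar f" and A: "set xs \<subseteq> A" "set ys \<subseteq> A"
        and rel: "\<forall>i<ar f. (xs ! i, ys ! i) \<in> \<sigma>"
      have J': "?J f (map (con_rep \<delta>) zs) = con_rep \<delta> (I f zs)" if "length zs = ar f" "set zs \<subseteq> A" for zs
        using quot.img_ops[OF f, of "map (\<lambda>x _. x) zs"] that by (auto simp: comp_def subset_iff)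
      have "(?J f (map (con_rep \<delta>) xs), ?J f (map (con_rep \<delta>) ys)) \<in> ?\<rho>"
        by (rule Con_compat[OF \<rho> f]) (use len rel in \<open>auto simp: \<sigma>_def\<close>)
      then show "(I f xs, I f ys) \<in> \<sigma>"
        using J' len A op_closed[OF f] by (simp add: \<sigma>_def)
    next
      show "(x, x) \<in> \<sigma>" if "x \<in> A" for x using that Con_refl[OF \<rho>] by (simp add: \<sigma>_def B_def)
      show "(y, x) \<in> \<sigma>" if "(x, y) \<in> \<sigma>" for x y using that Con_sym[OF \<rho>] by (simp add: \<sigma>_def)
      show "(x, z) \<in> \<sigma>" if "(x, y) \<in> \<sigma>" "(y, z) \<in> \<sigma>" for x y z
        using that Con_trans[OF \<rho>, of "con_rep \<delta> x" "con_rep \<delta> y" "con_rep \<delta> z"] by (simp add: \<sigma>_def)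
    qed (auto simp: \<sigma>_def)
    moreover have "\<epsilon> \<subseteq> \<sigma>" if \<epsilon>: "\<epsilon> \<in> Con F ar A I" "\<delta> \<subseteq> \<epsilon>" "\<epsilon> \<inter> B \<times> B \<subseteq> ?\<rho>" for \<epsilon>
    proof
      fix z
      assume z: "z \<in> \<epsilon>"
      then obtain x y where xy: "z = (x, y)" "x \<in> A" "y \<in> A" using Con_subset[OF \<epsilon>(1)] by auto
      then have "(con_rep \<delta> x, con_rep \<delta> y) \<in> \<epsilon> \<inter> B \<times> B"
        using rep_rel[OF \<epsilon>(1,2) xy(2,3)] z by (simp add: B_def)
      then show "z \<in> \<sigma>" using \<epsilon>(3) xy by (auto simp: \<sigma>_def)
    qed
    ultimately have "Nabla A \<subseteq> \<sigma>"
      using cjoin_least[of \<sigma> F ar A I \<beta> \<gamma>] con le join cjoin_ub1 cjoin_ub2 by metis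
    then have "Nabla B \<subseteq> ?\<rho>" by (auto simp: Nabla_def \<sigma>_def B_def)
    then show ?thesis by (rule Con_eq_NablaI[OF \<rho>])
  qed
  have central: "B.central (\<alpha> \<inter> B \<times> B)"
  proof (rule B.central_if_two_complements[OF restr[OF con(1) le(1)] restr[OF con(2) le(2)]
        restr[OF con(3) le(3)] _ _ join_B])
    show "(\<alpha> \<inter> B \<times> B) \<inter> (\<beta> \<inter> B \<times> B) = Delta B" "(\<alpha> \<inter> B \<times> B) \<inter> (\<gamma> \<inter> B \<times> B) = Delta B"
      using Delta meet by auto
  qed
  show ?thesis
  proof
    fix z
    assume z: "z \<in> \<alpha>"
    then obtain x y where xy: "z = (x, y)" "x \<in> A" "y \<in> A" using Con_subset[OF con(1)] by auto
    then have "(con_rep \<delta> x, con_rep \<delta> y) \<in> \<alpha> \<inter> B \<times> B"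
      using rep_rel[OF con(1) le(1) xy(2,3)] z by (simp add: B_def)
    then have "con_rep \<delta> x = con_rep \<delta> y"
      by (rule central_trivial[OF good VB restr[OF con(1) le(1)] central])
    then show "z \<in> \<delta>" using con_rep_eq_iff[OF con(4) xy(2,3)] xy(1) by simp
  qed
qed

section \<open>Covers, the radical and complemented congruences\<close>

locale good_algebra =
  fixes F :: "'f set" and ar :: "'f \<Rightarrow> nat" and \<Sigma> :: "(('f,nat) trm \<times> ('f,nat) trm) set"
    and A :: "'a set" and I :: "'f \<Rightarrow> 'a list \<Rightarrow> 'a"
  assumes good: "good_variety F ar \<Sigma> TYPE('a)" and V: "in_variety F ar \<Sigma> A I"
begin

sublocale algebra F ar A I
  using V by (simp add: algebra_def in_variety_def)

abbreviation "ConA \<equiv> Con F ar A I"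
abbreviation join (infixl "\<squnion>" 65) where "\<alpha> \<squnion> \<beta> \<equiv> cjoin F ar A I \<alpha> \<beta>"

lemma modular:
  "\<alpha> \<in> ConA \<Longrightarrow> \<beta> \<in> ConA \<Longrightarrow> \<gamma> \<in> ConA \<Longrightarrow> \<alpha> \<subseteq> \<gamma> \<Longrightarrow> \<alpha> \<squnion> (\<beta> \<inter> \<gamma>) = (\<alpha> \<squnion> \<beta>) \<inter> \<gamma>"
proof -
  have "con_modular F ar A I" using good V unfolding good_variety_def by blast
  then show "\<alpha> \<in> ConA \<Longrightarrow> \<beta> \<in> ConA \<Longrightarrow> \<gamma> \<in> ConA \<Longrightarrow> \<alpha> \<subseteq> \<gamma> \<Longrightarrow> \<alpha> \<squnion> (\<beta> \<inter> \<gamma>) = (\<alpha> \<squnion> \<beta>) \<inter> \<gamma>"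
    unfolding con_modular_def by blast
qed

text \<open>Let \<delta> be the right-hand side. Enlarge each of \<beta> and \<gamma> by the meet of
  \<alpha> with the other one. By modularity both enlarged congruences meet \<alpha> exactly in
  \<delta>, and their join is still the top, so \<alpha> is trivial modulo \<delta>.\<close>

lemma split_along_cover:
  assumes \<alpha>: "\<alpha> \<in> ConA" and \<beta>: "\<beta> \<in> ConA" and \<gamma>: "\<gamma> \<in> ConA" and top: "\<beta> \<squnion> \<gamma> = Nabla A"
  shows "\<alpha> \<subseteq> (\<alpha> \<inter> \<beta>) \<squnion> (\<alpha> \<inter> \<gamma>)"
proof -
  define \<delta> where "\<delta> = (\<alpha> \<inter> \<beta>) \<squnion> (\<alpha> \<inter> \<gamma>)"
  have \<alpha>\<beta>: "\<alpha> \<inter> \<beta> \<in> ConA" and \<alpha>\<gamma>: "\<alpha> \<inter> \<gamma> \<in> ConA" using Int_Con[OF \<alpha> \<beta>] Int_Con[OF \<alpha> \<gamma>] .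
  have \<delta>: "\<delta> \<in> ConA" unfolding \<delta>_def by (rule cjoin_Con[OF alg \<alpha>\<beta> \<alpha>\<gamma>])
  have \<beta>': "\<alpha> \<inter> \<gamma> \<squnion> \<beta> \<in> ConA" and \<gamma>': "\<alpha> \<inter> \<beta> \<squnion> \<gamma> \<in> ConA"
    by (intro cjoin_Con[OF alg] \<alpha>\<beta> \<alpha>\<gamma> \<beta> \<gamma>)+
  have "\<alpha> \<inter> \<gamma> \<squnion> (\<beta> \<inter> \<alpha>) = \<delta>"
    unfolding \<delta>_def cjoin_def by (simp add: Un_commute Int_commute)
  then have meet1: "\<alpha> \<inter> (\<alpha> \<inter> \<gamma> \<squnion> \<beta>) = \<delta>"
    using modular[OF \<alpha>\<gamma> \<beta> \<alpha>] by (simp add: Int_commute)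
  have "\<alpha> \<inter> \<beta> \<squnion> (\<gamma> \<inter> \<alpha>) = \<delta>"
    unfolding \<delta>_def by (simp add: Int_commute)
  then have meet2: "\<alpha> \<inter> (\<alpha> \<inter> \<beta> \<squnion> \<gamma>) = \<delta>"
    using modular[OF \<alpha>\<beta> \<gamma> \<alpha>] by (simp add: Int_commute)
  have J: "(\<alpha> \<inter> \<gamma> \<squnion> \<beta>) \<squnion> (\<alpha> \<inter> \<beta> \<squnion> \<gamma>) \<in> ConA" by (rule cjoin_Con[OF alg \<beta>' \<gamma>'])
  have "\<beta> \<subseteq> \<alpha> \<inter> \<gamma> \<squnion> \<beta>" "\<gamma> \<subseteq> \<alpha> \<inter> \<beta> \<squnion> \<gamma>" by (rule cjoin_ub2)+
  then have "\<beta> \<squnion> \<gamma> \<subseteq> (\<alpha> \<inter> \<gamma> \<squnion> \<beta>) \<squnion> (\<alpha> \<inter> \<beta> \<squnion> \<gamma>)"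
    by (intro cjoin_least[OF J]) (blast intro: subsetD[OF cjoin_ub1] subsetD[OF cjoin_ub2])+
  then have "(\<alpha> \<inter> \<gamma> \<squnion> \<beta>) \<squnion> (\<alpha> \<inter> \<beta> \<squnion> \<gamma>) = Nabla A"
    using Con_eq_NablaI[OF J] top by simp
  then show ?thesis
    using two_complements_trivial_mod[OF good V \<alpha> \<beta>' \<gamma>' \<delta> meet1 meet2] by (simp add: \<delta>_def)
qed

text \<open>One pair for each of the finitely many operation symbols makes \<open>a\<close>
  idempotent in the quotient, which is then trivial by semidegeneracy.\<close>

lemma Nabla_finitely_generated: "\<exists>G. finite G \<and> G \<subseteq> A \<times> A \<and> Cg F ar A I G = Nabla A"
proof -
  obtain a where a: "a \<in> A" using alg unfolding is_alg_def by blast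
  define G where "G = (\<lambda>f. (I f (replicate (ar f) a), a)) ` F"
  have fA: "I f (replicate (ar f) a) \<in> A" if "f \<in> F" for f
    using op_closed[OF that, of "replicate (ar f) a"] a by (auto simp: set_replicate_conv_if)
  have G: "finite G" "G \<subseteq> A \<times> A"
    using good fA a by (auto simp: G_def good_variety_def)
  define \<delta> where "\<delta> = Cg F ar A I G"
  have \<delta>: "\<delta> \<in> ConA" unfolding \<delta>_def by (rule Cg_Con[OF alg G(2)])
  have wf: "wf_identities F ar \<Sigma>" using good by (simp add: good_variety_def)
  interpret quot: subpower_image F ar \<Sigma> A I "UNIV :: unit set" "{p. p () \<in> A}" "\<lambda>p. con_rep \<delta> (p ())"
    by (rule quotient_subpower_image[OF wf V \<delta>])
  have "con_rep \<delta> x = con_rep \<delta> a" if "x \<in> A" for x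
  proof -
    have "con_rep \<delta> ((\<lambda>_. x) ()) = con_rep \<delta> ((\<lambda>_. a) ())"
    proof (rule quot.trivial_if_pointed[OF good, where e = "\<lambda>_. a" and p = "\<lambda>_. x"])
      show "con_rep \<delta> (I f (replicate (ar f) a)) = con_rep \<delta> a" if "f \<in> F" for f
        using con_rep_eq_iff[OF \<delta> fA[OF that] a] Cg_ext[of G F ar A I] that by (auto simp: \<delta>_def G_def)
    qed (use a that in auto)
    then show ?thesis by simp
  qed
  then have "(x, y) \<in> \<delta>" if "x \<in> A" "y \<in> A" for x y
    using con_rep_eq_iff[OF \<delta> that] that by simp
  then have "Nabla A \<subseteq> \<delta>" by (auto simp: Nabla_def)
  then show ?thesis using G Con_eq_NablaI[OF \<delta>] by (auto simp: \<delta>_def)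
qed

lemma Union_chain_Con:
  assumes "C \<noteq> {}" "subset.chain S C" "S \<subseteq> ConA"
  shows "\<Union>C \<in> ConA"
proof -
  have C: "\<gamma> \<in> ConA" if "\<gamma> \<in> C" for \<gamma> using assms(2,3) that unfolding subset.chain_def by blast
  have fin: "\<exists>\<gamma>\<in>C. R \<subseteq> \<gamma>" if "finite R" "R \<subseteq> \<Union>C" for R
    using finite_subset_Union_chain[OF that assms(1,2)] by blast
  show ?thesis
  proof (rule ConI)
    show "\<Union>C \<subseteq> A \<times> A" using C Con_subset by blast
    show "(x, x) \<in> \<Union>C" if "x \<in> A" for x
    proof -
      obtain \<gamma> where "\<gamma> \<in> C" using assms(1) by blast
      then show ?thesis using Con_refl[OF C that] by blast
    qed
    show "(y, x) \<in> \<Union>C" if "(x, y) \<in> \<Union>C" for x y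
    proof -
      obtain \<gamma> where "\<gamma> \<in> C" "(x, y) \<in> \<gamma>" using \<open>(x, y) \<in> \<Union>C\<close> by blast
      then show ?thesis using Con_sym[OF C] by blast
    qed
    show "(x, z) \<in> \<Union>C" if xyz: "(x, y) \<in> \<Union>C" "(y, z) \<in> \<Union>C" for x y z
    proof -
      obtain \<gamma> where "\<gamma> \<in> C" "{(x, y), (y, z)} \<subseteq> \<gamma>" using fin[of "{(x, y), (y, z)}"] xyz by auto
      then show ?thesis using Con_trans[OF C, of \<gamma> x y z] by blast
    qed
    fix f xs ys
    assume f: "f \<in> F" and len: "length xs = ar f" "length ys = ar f"
      and rel: "\<forall>i<ar f. (xs ! i, ys ! i) \<in> \<Union>C"
    obtain \<gamma> where \<gamma>: "\<gamma> \<in> C" "(\<lambda>i. (xs ! i, ys ! i)) ` {..<ar f} \<subseteq> \<gamma>"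
      using fin[of "(\<lambda>i. (xs ! i, ys ! i)) ` {..<ar f}"] rel by auto
    then have "(I f xs, I f ys) \<in> \<gamma>"
      by (intro Con_compat[OF C[OF \<gamma>(1)] f len]) auto
    then show "(I f xs, I f ys) \<in> \<Union>C" using \<gamma>(1) by blast
  qed
qed

text \<open>Finite generation of the top keeps unions of chains of proper congruences proper. So a
  proper \<delta> lies below a maximal congruence, which contains \<theta> as well.\<close>

lemma Rad_superfluous:
  assumes \<theta>: "\<theta> \<subseteq> Rad F ar A I" and \<delta>: "\<delta> \<in> ConA" and top: "\<delta> \<squnion> \<theta> = Nabla A"
  shows "\<delta> = Nabla A"
proof (rule ccontr)
  assume neq: "\<delta> \<noteq> Nabla A"
  obtain G where G: "finite G" "G \<subseteq> A \<times> A" "Cg F ar A I G = Nabla A"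
    using Nabla_finitely_generated by blast
  define S where "S = {\<gamma> \<in> ConA. \<delta> \<subseteq> \<gamma> \<and> \<gamma> \<noteq> Nabla A}"
  have "\<exists>\<mu>\<in>S. \<forall>\<gamma>\<in>S. \<mu> \<subseteq> \<gamma> \<longrightarrow> \<gamma> = \<mu>"
  proof (rule subset_Zorn_nonempty)
    show "S \<noteq> {}" using \<delta> neq by (auto simp: S_def)
    fix C
    assume C: "C \<noteq> {}" "subset.chain S C"
    have CS: "C \<subseteq> S" using C(2) by (simp add: subset.chain_def)
    have "\<Union>C \<noteq> Nabla A"
    proof
      assume "\<Union>C = Nabla A"
      then have "G \<subseteq> \<Union>C" using G(2) by (simp add: Nabla_def)
      then obtain \<gamma> where \<gamma>: "\<gamma> \<in> C" "G \<subseteq> \<gamma>"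
        using finite_subset_Union_chain[OF G(1) _ C] by blast
      have \<gamma>S: "\<gamma> \<in> ConA" "\<gamma> \<noteq> Nabla A" using \<gamma>(1) CS by (auto simp: S_def)
      have "Nabla A \<subseteq> \<gamma>" using Cg_least[OF \<gamma>S(1) \<gamma>(2)] G(3) by simp
      then show False using Con_eq_NablaI[OF \<gamma>S(1)] \<gamma>S(2) by blast
    qed
    moreover have "\<Union>C \<in> ConA" by (rule Union_chain_Con[OF C]) (auto simp: S_def)
    moreover have "\<delta> \<subseteq> \<Union>C" using C(1) CS by (auto simp: S_def)
    ultimately show "\<Union>C \<in> S" by (simp add: S_def)
  qed
  then obtain \<mu> where \<mu>: "\<mu> \<in> S" and max: "\<And>\<gamma>. \<gamma> \<in> S \<Longrightarrow> \<mu> \<subseteq> \<gamma> \<Longrightarrow> \<gamma> = \<mu>" by blast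
  have "\<gamma> = \<mu> \<or> \<gamma> = Nabla A" if "\<gamma> \<in> ConA" "\<mu> \<subseteq> \<gamma>" for \<gamma>
    using max[of \<gamma>] that \<mu> by (auto simp: S_def)
  then have "\<mu> \<in> max_con F ar A I" using \<mu> by (auto simp: max_con_def S_def)
  then have "\<theta> \<subseteq> \<mu>" using \<theta> by (auto simp: Rad_def)
  then have "Nabla A \<subseteq> \<mu>"
    using cjoin_least[of \<mu> F ar A I \<delta> \<theta>] \<mu> top by (simp add: S_def)
  then show False using Con_eq_NablaI[of \<mu> F ar A I] \<mu> by (auto simp: S_def)
qed

lemma BCon_cases:
  assumes "\<alpha> \<in> BCon F ar A I"
  obtains \<alpha>' where "\<alpha> \<in> ConA" "\<alpha>' \<in> ConA" "\<alpha> \<inter> \<alpha>' = Delta A" "\<alpha> \<squnion> \<alpha>' = Nabla A"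
  using assms by (auto simp: BCon_def)

text \<open>The complement of \<alpha> joins with \<beta> to the top modulo \<theta>, hence
  outright. Splitting \<alpha> along this cover leaves only the part inside \<beta>.\<close>

lemma BCon_le_if_join_eq:
  assumes \<theta>: "\<theta> \<subseteq> Rad F ar A I" "\<theta> \<in> ConA" and \<alpha>: "\<alpha> \<in> BCon F ar A I" and \<beta>: "\<beta> \<in> ConA"
    and eq: "\<alpha> \<squnion> \<theta> = \<beta> \<squnion> \<theta>"
  shows "\<alpha> \<subseteq> \<beta>"
proof -
  obtain \<alpha>' where \<alpha>': "\<alpha> \<in> ConA" "\<alpha>' \<in> ConA" "\<alpha> \<inter> \<alpha>' = Delta A" "\<alpha> \<squnion> \<alpha>' = Nabla A"
    using BCon_cases[OF \<alpha>] .
  define \<delta> where "\<delta> = \<alpha>' \<squnion> \<beta>"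
  have \<delta>: "\<delta> \<in> ConA" unfolding \<delta>_def by (rule cjoin_Con[OF alg \<alpha>'(2) \<beta>])
  have J: "\<delta> \<squnion> \<theta> \<in> ConA" by (rule cjoin_Con[OF alg \<delta> \<theta>(2)])
  have \<delta>_le: "\<delta> \<subseteq> \<delta> \<squnion> \<theta>" "\<theta> \<subseteq> \<delta> \<squnion> \<theta>" by (rule cjoin_ub1, rule cjoin_ub2)
  have "\<alpha>' \<subseteq> \<delta>" "\<beta> \<subseteq> \<delta>" unfolding \<delta>_def by (rule cjoin_ub1, rule cjoin_ub2)
  then have "\<beta> \<squnion> \<theta> \<subseteq> \<delta> \<squnion> \<theta>" "\<alpha>' \<subseteq> \<delta> \<squnion> \<theta>"
    using cjoin_least[OF J, of \<beta> \<theta>] \<delta>_le by auto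
  moreover have "\<alpha> \<subseteq> \<alpha> \<squnion> \<theta>" by (rule cjoin_ub1)
  ultimately have "\<alpha> \<squnion> \<alpha>' \<subseteq> \<delta> \<squnion> \<theta>"
    using cjoin_least[OF J, of \<alpha> \<alpha>'] eq by auto
  then have "\<delta> \<squnion> \<theta> = Nabla A" using \<alpha>'(4) Con_eq_NablaI[OF J] by simp
  then have "\<alpha>' \<squnion> \<beta> = Nabla A" using Rad_superfluous[OF \<theta>(1) \<delta>] by (simp add: \<delta>_def)
  then have "\<alpha> \<subseteq> (\<alpha> \<inter> \<alpha>') \<squnion> (\<alpha> \<inter> \<beta>)" using split_along_cover[OF \<alpha>'(1,2) \<beta>] by simp
  also have "\<dots> \<subseteq> \<beta>" using \<alpha>'(3) Con_Delta_least[OF \<beta>] by (intro cjoin_least[OF \<beta>]) auto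
  finally show ?thesis .
qed

lemma BCon_meet_eq_Delta:
  assumes \<theta>: "\<theta> \<subseteq> Rad F ar A I" "\<theta> \<in> ConA"
    and \<alpha>: "\<alpha> \<in> BCon F ar A I" and \<beta>: "\<beta> \<in> BCon F ar A I" and le: "\<alpha> \<inter> \<beta> \<subseteq> \<theta>"
  shows "\<alpha> \<inter> \<beta> = Delta A"
proof -
  obtain \<alpha>' where \<alpha>': "\<alpha> \<in> ConA" "\<alpha>' \<in> ConA" "\<alpha> \<inter> \<alpha>' = Delta A" "\<alpha> \<squnion> \<alpha>' = Nabla A"
    using BCon_cases[OF \<alpha>] .
  obtain \<beta>' where \<beta>': "\<beta> \<in> ConA" "\<beta>' \<in> ConA" "\<beta> \<inter> \<beta>' = Delta A" "\<beta> \<squnion> \<beta>' = Nabla A"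
    using BCon_cases[OF \<beta>] .
  define \<delta> where "\<delta> = \<alpha>' \<squnion> \<beta>'"
  have \<delta>: "\<delta> \<in> ConA" unfolding \<delta>_def by (rule cjoin_Con[OF alg \<alpha>'(2) \<beta>'(2)])
  have J: "\<delta> \<squnion> \<theta> \<in> ConA" by (rule cjoin_Con[OF alg \<delta> \<theta>(2)])
  have \<delta>_le: "\<delta> \<subseteq> \<delta> \<squnion> \<theta>" "\<theta> \<subseteq> \<delta> \<squnion> \<theta>" by (rule cjoin_ub1, rule cjoin_ub2)
  have \<alpha>'\<beta>': "\<alpha>' \<subseteq> \<delta>" "\<beta>' \<subseteq> \<delta>" unfolding \<delta>_def by (rule cjoin_ub1, rule cjoin_ub2)
  have "\<alpha> \<subseteq> (\<alpha> \<inter> \<beta>) \<squnion> (\<alpha> \<inter> \<beta>')" by (rule split_along_cover[OF \<alpha>'(1) \<beta>'(1,2,4)])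
  also have "\<dots> \<subseteq> \<delta> \<squnion> \<theta>" using le \<delta>_le \<alpha>'\<beta>' by (intro cjoin_least[OF J]) auto
  finally have "\<alpha> \<squnion> \<alpha>' \<subseteq> \<delta> \<squnion> \<theta>" using \<delta>_le \<alpha>'\<beta>' by (intro cjoin_least[OF J]) auto
  then have "\<delta> \<squnion> \<theta> = Nabla A" using \<alpha>'(4) Con_eq_NablaI[OF J] by simp
  then have top: "\<alpha>' \<squnion> \<beta>' = Nabla A" using Rad_superfluous[OF \<theta>(1) \<delta>] by (simp add: \<delta>_def)
  have \<kappa>: "\<alpha> \<inter> \<beta> \<in> ConA" by (rule Int_Con[OF \<alpha>'(1) \<beta>'(1)])
  have \<Delta>: "Delta A \<in> ConA" using Int_Con[OF \<alpha>'(1,2)] \<alpha>'(3) by simp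
  have "\<alpha> \<inter> \<beta> \<subseteq> (\<alpha> \<inter> \<beta> \<inter> \<alpha>') \<squnion> (\<alpha> \<inter> \<beta> \<inter> \<beta>')"
    by (rule split_along_cover[OF \<kappa> \<alpha>'(2) \<beta>'(2) top])
  also have "\<dots> \<subseteq> Delta A"
    using \<alpha>'(3) \<beta>'(3) by (intro cjoin_least[OF \<Delta>]) auto
  finally show ?thesis using Con_Delta_least[OF \<kappa>] by blast
qed

section \<open>The map on congruences induced by the canonical surjection\<close>

lemma pbullet_memberD:
  assumes \<theta>: "\<theta> \<in> ConA" and \<alpha>: "\<alpha> \<in> ConA" and xy: "x \<in> A" "y \<in> A"
  shows "(\<theta> `` {x}, \<theta> `` {y}) \<in> pbullet F ar A I \<theta> \<alpha> \<longleftrightarrow> (x, y) \<in> \<alpha> \<squnion> \<theta>"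
proof
  have J: "\<alpha> \<squnion> \<theta> \<in> ConA" by (rule cjoin_Con[OF alg \<alpha> \<theta>])
  assume "(\<theta> `` {x}, \<theta> `` {y}) \<in> pbullet F ar A I \<theta> \<alpha>"
  then obtain x' y' where x'y': "(x', y') \<in> \<alpha> \<squnion> \<theta>" "\<theta> `` {x} = \<theta> `` {x'}" "\<theta> `` {y} = \<theta> `` {y'}"
    by (auto simp: pbullet_def)
  then have "x' \<in> A" "y' \<in> A" using Con_subset[OF J] by auto
  then have "(x, x') \<in> \<theta>" "(y', y) \<in> \<theta>"
    using x'y' xy eq_equiv_class[OF _ Con_equiv[OF \<theta>]] by metis+
  then have "(x, x') \<in> \<alpha> \<squnion> \<theta>" "(y', y) \<in> \<alpha> \<squnion> \<theta>" using cjoin_ub2 by blast+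
  then show "(x, y) \<in> \<alpha> \<squnion> \<theta>" using x'y'(1) Con_trans[OF J] by blast
qed (auto simp: pbullet_def)

lemma pbullet_eqD:
  assumes "\<theta> \<in> ConA" "\<alpha> \<in> ConA" "\<beta> \<in> ConA" "pbullet F ar A I \<theta> \<alpha> = pbullet F ar A I \<theta> \<beta>"
  shows "\<alpha> \<squnion> \<theta> = \<beta> \<squnion> \<theta>"
proof -
  have "(x, y) \<in> \<alpha> \<squnion> \<theta> \<longleftrightarrow> (x, y) \<in> \<beta> \<squnion> \<theta>" for x y
  proof (cases "x \<in> A \<and> y \<in> A")
    case True
    then show ?thesis
      using pbullet_memberD[OF assms(1,2)] pbullet_memberD[OF assms(1,3)] assms(4) by blast
  next
    case False
    then show ?thesis
      using Con_subset[OF cjoin_Con[OF alg assms(2,1)]] Con_subset[OF cjoin_Con[OF alg assms(3,1)]] by blast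
  qed
  then show ?thesis by auto
qed

text \<open>Used twice: for the uniqueness of the lifting, and to keep the images of distinct
  members of \<open>\<Omega>\<close> distinct, so that orthogonality of \<open>\<Omega>'\<close>
  speaks about them.\<close>

lemma pbullet_inj_on_BCon:
  assumes "\<theta> \<subseteq> Rad F ar A I" "\<theta> \<in> ConA"
  shows "inj_on (pbullet F ar A I \<theta>) (BCon F ar A I)"
proof (rule inj_onI)
  fix \<alpha> \<beta>
  assume \<alpha>: "\<alpha> \<in> BCon F ar A I" and \<beta>: "\<beta> \<in> BCon F ar A I"
    and eq: "pbullet F ar A I \<theta> \<alpha> = pbullet F ar A I \<theta> \<beta>"
  have con: "\<alpha> \<in> ConA" "\<beta> \<in> ConA" using \<alpha> \<beta> by (auto simp: BCon_def)
  have "\<alpha> \<squnion> \<theta> = \<beta> \<squnion> \<theta>" by (rule pbullet_eqD[OF assms(2) con eq])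
  then show "\<alpha> = \<beta>"
    using BCon_le_if_join_eq[OF assms \<alpha> con(2)] BCon_le_if_join_eq[OF assms \<beta> con(1)] by auto
qed

lemma pbullet_orthogonalD:
  assumes \<theta>: "\<theta> \<in> ConA" and con: "\<alpha> \<in> ConA" "\<beta> \<in> ConA"
    and meet: "pbullet F ar A I \<theta> \<alpha> \<inter> pbullet F ar A I \<theta> \<beta> = Delta (A // \<theta>)"
  shows "\<alpha> \<inter> \<beta> \<subseteq> \<theta>"
proof
  fix z
  assume "z \<in> \<alpha> \<inter> \<beta>"
  then obtain x y where xy: "z = (x, y)" "(x, y) \<in> \<alpha>" "(x, y) \<in> \<beta>" by (cases z) auto
  have A: "x \<in> A" "y \<in> A" using Con_subset[OF con(1)] xy(2) by auto
  have "(x, y) \<in> \<alpha> \<squnion> \<theta>" "(x, y) \<in> \<beta> \<squnion> \<theta>"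
    using subsetD[OF cjoin_ub1 xy(2)] subsetD[OF cjoin_ub1 xy(3)] by blast+
  then have "(\<theta> `` {x}, \<theta> `` {y}) \<in> Delta (A // \<theta>)"
    using pbullet_memberD[OF \<theta> con(1) A] pbullet_memberD[OF \<theta> con(2) A] meet by blast
  then have "\<theta> `` {x} = \<theta> `` {y}" by (auto simp: Delta_def)
  then show "z \<in> \<theta>" using eq_equiv_class[OF _ Con_equiv[OF \<theta>] A(2)] xy(1) by blast
qed

end

theorem theorem7p3:
  fixes F :: "'f set" and ar :: "'f \<Rightarrow> nat"
    and \<Sigma> :: "(('f,nat) trm \<times> ('f,nat) trm) set"
    and A :: "'a set" and I :: "'f \<Rightarrow> 'a list \<Rightarrow> 'a"
    and \<theta> :: "'a rel" and \<Omega> :: "'a rel set" and \<Omega>' :: "'a set rel set"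
  assumes V: "good_variety F ar \<Sigma> TYPE('a)"
    and A: "in_variety F ar \<Sigma> A I"
    and theta: "\<theta> \<in> Con F ar A I" "\<theta> \<subseteq> Rad F ar A I"
    and Omega': "\<Omega>' \<subseteq> BCon F ar (A // \<theta>) (quot_ops \<theta> I)"
      "orthogonal (A // \<theta>) \<Omega>'"
    and Omega: "\<Omega> \<subseteq> BCon F ar A I"
    and lift: "\<Omega>' = pbullet F ar A I \<theta> ` \<Omega>"
  shows "(\<forall>\<Phi>. \<Phi> \<subseteq> BCon F ar A I \<and> \<Omega>' = pbullet F ar A I \<theta> ` \<Phi> \<longrightarrow> \<Phi> = \<Omega>)
         \<and> orthogonal A \<Omega>"
proof -
  interpret good_algebra F ar \<Sigma> A I by unfold_locales (rule V, rule A)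
  have inj: "inj_on (pbullet F ar A I \<theta>) (BCon F ar A I)"
    by (rule pbullet_inj_on_BCon[OF theta(2,1)])
  have "\<Phi> = \<Omega>" if "\<Phi> \<subseteq> BCon F ar A I" "\<Omega>' = pbullet F ar A I \<theta> ` \<Phi>" for \<Phi>
    using inj_on_image_eq_iff[OF inj that(1) Omega] that(2) lift by simp
  moreover have "orthogonal A \<Omega>"
    unfolding orthogonal_def
  proof (intro ballI impI)
    fix \<alpha> \<beta>
    assume \<alpha>: "\<alpha> \<in> \<Omega>" and \<beta>: "\<beta> \<in> \<Omega>" and neq: "\<alpha> \<noteq> \<beta>"
    have B: "\<alpha> \<in> BCon F ar A I" "\<beta> \<in> BCon F ar A I" using \<alpha> \<beta> Omega by auto
    then have con: "\<alpha> \<in> Con F ar A I" "\<beta> \<in> Con F ar A I" by (auto simp: BCon_def)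
    have "pbullet F ar A I \<theta> \<alpha> \<noteq> pbullet F ar A I \<theta> \<beta>" using inj_onD[OF inj] B neq by blast
    then have "pbullet F ar A I \<theta> \<alpha> \<inter> pbullet F ar A I \<theta> \<beta> = Delta (A // \<theta>)"
      using Omega'(2) lift \<alpha> \<beta> unfolding orthogonal_def by blast
    then have "\<alpha> \<inter> \<beta> \<subseteq> \<theta>" by (rule pbullet_orthogonalD[OF theta(1) con])
    then show "\<alpha> \<inter> \<beta> = Delta A" by (rule BCon_meet_eq_Delta[OF theta(2,1) B])
  qed
  ultimately show ?thesis by blast
qed

end
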